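(* Let $n\ge 3$ and let $p>0$ be a real number with $p\ne 1$. A map $\mu:\mathcal P_o^n\to\mathcal M(S^{n-1})$ is an $\operatorname{SL}(n)$ contravariant valuation of degree $p$ if and only if there exist nonnegative constants $c_1,c_2\in\mathbb R$ such that $$\mu(P,\cdot)=c_1S_p(P,\cdot)+c_2S_p(-P,\cdot)$$ for every $P\in\mathcal P_o^n$.
   Context: $\mathcal P_o^n$ denotes the set of all convex polytopes in $\mathbb R^n$ (of any dimension, including $\{o\}$) that contain the origin $o$. $S^{n-1}$ is the Euclidean unit sphere of $\mathbb R^n$ and $\mathcal M(S^{n-1})$ is the space of finite positive Borel measures on $S^{n-1}$. A map $\mu:\mathcal P_o^n\to\mathcal M(S^{n-1})$ is a valuation if $\mu(P\cup Q,\cdot)+\mu(P\cap Q,\cdot)=\mu(P,\cdot)+\mu(Q,\cdot)$ whenever $P,Q,P\cup Q,P\cap Q\in\mathcal P_o^n$. For $p\in\mathbb R$, $\mu$ is called $\operatorname{SL}(n)$ contravariant of degree $p$ if $$\int_{S^{n-1}}f\,d\mu(\phi P,\cdot)=\int_{S^{n-1}}f\circ\phi^{-t}\,d\mu(P,\cdot)$$ for every $\phi\in\operatorname{SL}(n)$, every $P\in\mathcal P_o^n$, and every continuous function $f:\mathbb R^n\setminus\{o\}\to\mathbb R$ that is $p$-homogeneous (i.e. $f(tx)=t^pf(x)$ for $t>0$). Here $\phi^{-t}$ is the transpose of the inverse of $\phi$. The $L_p$ surface area measure of $P\in\mathcal P_o^n$ is $S_p(P,\cdot)=\sum_{u\in\mathcal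 N^*(P)}h(P,u)^{1-p}V_{n-1}(F_u)\,\delta_u$, where $\mathcal N^*(P)$ is the set of outer unit normals $u$ of facets ($(n-1)$-dimensional faces) $F_u$ of $P$ that do not contain the origin, $h(P,u)=\max\{u\cdot y: y\in P\}$ is the support function, $V_{n-1}$ is $(n-1)$-dimensional volume, and $\delta_u$ is the Dirac probability measure at $u$. *)

theory Defs
  imports "HOL-Analysis.Analysis"
begin

definition polytopes_o :: "'a::euclidean_space set set" where
  "polytopes_o = {P. polytope P \<and> 0 \<in> P}"

definition sphere_borel :: "'a::euclidean_space measure" where
  "sphere_borel = restrict_space borel (sphere 0 1)"

definition sphere_measures :: "'a::euclidean_space measure set" where
  "sphere_measures = {M. sets M = sets sphere_borel \<and> finite_measure M}"

definition measure_valuation :: "('a::euclidean_space set \<Rightarrow> 'a measure) \<Rightarrow> bool" where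
  "measure_valuation \<mu> \<longleftrightarrow>
     (\<forall>P Q. P \<in> polytopes_o \<and> Q \<in> polytopes_o \<and> P \<union> Q \<in> polytopes_o \<and> P \<inter> Q \<in> polytopes_o \<longrightarrow>
        (\<forall>A \<in> sets sphere_borel.
           measure (\<mu> (P \<union> Q)) A + measure (\<mu> (P \<inter> Q)) A = measure (\<mu> P) A + measure (\<mu> Q) A))"

text \<open>Only the values of \<open>f\<close> away from \<open>0\<close> matter, so a function on the punctured space is
  represented by any total extension of it.\<close>

definition SL_contravariant :: "real \<Rightarrow> ((real^'n) set \<Rightarrow> (real^'n) measure) \<Rightarrow> bool" where
  "SL_contravariant p \<mu> \<longleftrightarrow>
     (\<forall>\<phi> :: real^'n^'n. det \<phi> = 1 \<longrightarrow>
       (\<forall>P \<in> polytopes_o. \<forall>f :: real^'n \<Rightarrow> real.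
          continuous_on (- {0}) f \<and> (\<forall>t>0. \<forall>x. x \<noteq> 0 \<longrightarrow> f (t *\<^sub>R x) = t powr p * f x) \<longrightarrow>
          (LINT u|\<mu> ((*v) \<phi> ` P). f u) = (LINT u|\<mu> P. f (transpose (matrix_inv \<phi>) *v u))))"

definition support_function :: "'a::euclidean_space set \<Rightarrow> 'a \<Rightarrow> real" where
  "support_function P u = (SUP y\<in>P. u \<bullet> y)"

definition support_face :: "'a::euclidean_space set \<Rightarrow> 'a \<Rightarrow> 'a set" where
  "support_face P u = {y \<in> P. u \<bullet> y = support_function P u}"

text \<open>Facets are faces of dimension \<open>n - 1\<close>, where \<open>n\<close> is the dimension of the ambient space;
  this differs from the library's \<open>facet_of\<close> (codimension one relative to \<open>P\<close>) when
  \<open>P\<close> is not full-dimensional.\<close>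

definition facet_normals_off_origin :: "'a::euclidean_space set \<Rightarrow> 'a set" where
  "facet_normals_off_origin P =
     {u \<in> sphere 0 1. aff_dim (support_face P u) = int DIM('a) - 1 \<and> 0 \<notin> support_face P u}"

definition flat_chart :: "nat \<Rightarrow> 'a::euclidean_space \<Rightarrow> (nat \<Rightarrow> 'a) \<Rightarrow> (nat \<Rightarrow> real) \<Rightarrow> 'a" where
  "flat_chart d a b c = a + (\<Sum>i<d. c i *\<^sub>R b i)"

definition orthonormal_family :: "nat \<Rightarrow> (nat \<Rightarrow> 'a::euclidean_space) \<Rightarrow> bool" where
  "orthonormal_family d b \<longleftrightarrow> (\<forall>i<d. \<forall>j<d. b i \<bullet> b j = (if i = j then 1 else 0))"

text \<open>The \<open>d\<close>-dimensional volume of a set lying in a \<open>d\<close>-dimensional flat is its Lebesgue measure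
  in orthonormal coordinates of such a flat. It does not depend on the coordinates chosen, since
  Lebesgue measure is invariant under isometries.\<close>

definition flat_volume :: "nat \<Rightarrow> 'a::euclidean_space set \<Rightarrow> real" where
  "flat_volume d F =
     (case (SOME (a, b). orthonormal_family d b \<and> F \<subseteq> range (flat_chart d a b)) of
        (a, b) \<Rightarrow> measure (\<Pi>\<^sub>M i\<in>{..<d}. (lborel :: real measure))
                    {c \<in> {..<d} \<rightarrow>\<^sub>E UNIV. flat_chart d a b c \<in> F})"

definition Lp_surface_area_measure :: "real \<Rightarrow> 'a::euclidean_space set \<Rightarrow> 'a measure" where
  "Lp_surface_area_measure p P =
     measure_of (sphere 0 1) (sets sphere_borel)
       (\<lambda>A. \<Sum>u\<in>facet_normals_off_origin P.
          ennreal (support_function P u powr (1 - p)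
                   * flat_volume (DIM('a) - 1) (support_face P u)) * indicator A u)"

lemma space_sphere_borel [simp]: "space sphere_borel = sphere 0 1"
  by (simp add: sphere_borel_def space_restrict_space)

lemma sets_Lp_surface_area_measure [simp]:
  "sets (Lp_surface_area_measure p (P :: 'a::euclidean_space set)) = sets sphere_borel"
  unfolding Lp_surface_area_measure_def
  using sets.sigma_sets_eq[of "sphere_borel :: 'a measure"]
    sets.space_closed[of "sphere_borel :: 'a measure"]
  by (simp add: sets_measure_of)

lemma emeasure_Lp_surface_area_measure:
  fixes P :: "'a::euclidean_space set"
  assumes "A \<in> sets sphere_borel"
  shows "emeasure (Lp_surface_area_measure p P) A =
    (\<Sum>u\<in>facet_normals_off_origin P.
       ennreal (support_function P u powr (1 - p)
                * flat_volume (DIM('a) - 1) (support_face P u)) * indicator A u)"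
proof -
  let ?w = "\<lambda>u. ennreal (support_function P u powr (1 - p)
                * flat_volume (DIM('a) - 1) (support_face P u))"
  let ?m = "\<lambda>A. \<Sum>u\<in>facet_normals_off_origin P. ?w u * indicator A u"
  have "countably_additive (sets sphere_borel) ?m"
  proof (rule countably_additiveI)
    fix B :: "nat \<Rightarrow> 'a set"
    assume "disjoint_family B"
    then have "(\<Sum>i. indicator (B i) u :: ennreal) = indicator (\<Union>i. B i) u" for u
      by (rule suminf_indicator)
    then show "(\<Sum>i. ?m (B i)) = ?m (\<Union>i. B i)"
      by (subst suminf_sum) auto
  qed
  moreover have "positive (sets sphere_borel) ?m"
    by (simp add: positive_def)
  moreover have "sets (sphere_borel :: 'a measure) \<subseteq> Pow (sphere 0 1)"
    using sets.space_closed[of "sphere_borel :: 'a measure"] by simp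
  ultimately show ?thesis
    using assms by (intro emeasure_measure_of[OF Lp_surface_area_measure_def]) auto
qed

context
  fixes P :: "'a::euclidean_space set"
  assumes P: "P \<in> polytopes_o"
begin

lemma le_support_function: "y \<in> P \<Longrightarrow> u \<bullet> y \<le> support_function P u"
proof -
  assume y: "y \<in> P"
  have "bounded ((\<lambda>y. u \<bullet> y) ` P)"
    using P bounded_linear_image[OF polytope_imp_bounded bounded_linear_inner_right]
    by (auto simp: polytopes_o_def)
  then show ?thesis
    unfolding support_function_def
    using y by (intro cSUP_upper bounded_imp_bdd_above) auto
qed

lemma support_face_face_of: "support_face P u face_of P"
proof -
  have "support_face P u = P \<inter> {y. u \<bullet> y = support_function P u}"
    by (auto simp: support_face_def)
  then show ?thesis
    using P le_support_function
    by (auto simp: polytopes_o_def polytope_imp_convex intro!: face_of_Int_supporting_hyperplane_le)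
qed

lemma support_function_pos:
  assumes "u \<in> facet_normals_off_origin P" shows "support_function P u > 0"
  using assms P le_support_function[of 0 u]
  by (auto simp: facet_normals_off_origin_def support_face_def polytopes_o_def less_le)

lemma inj_on_support_face: "inj_on (support_face P) (facet_normals_off_origin P)"
proof (rule inj_onI)
  fix u v
  assume u: "u \<in> facet_normals_off_origin P" and v: "v \<in> facet_normals_off_origin P"
    and eq: "support_face P u = support_face P v"
  let ?h = "support_function P"
  have hull: "affine hull (support_face P w) = {x. w \<bullet> x = ?h w}"
    if "w \<in> facet_normals_off_origin P" for w
  proof (rule affine_dim_equal)
    have w: "w \<noteq> 0" using that by (auto simp: facet_normals_off_origin_def)
    have "aff_dim (support_face P w) = int DIM('a) - 1"
      using that by (simp add: facet_normals_off_origin_def)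
    then show "aff_dim (affine hull support_face P w) = aff_dim {x. w \<bullet> x = ?h w}"
      using w by (simp add: aff_dim_hyperplane)
    then have "aff_dim (support_face P w) \<ge> 0"
      using w DIM_positive[where 'a='a] by (simp add: aff_dim_hyperplane Suc_leI)
    then show "affine hull support_face P w \<noteq> {}" by auto
    show "affine hull support_face P w \<subseteq> {x. w \<bullet> x = ?h w}"
      by (rule hull_minimal) (auto simp: support_face_def affine_hyperplane)
  qed (auto simp: affine_hyperplane)
  have norm: "u \<bullet> u = 1" "v \<bullet> v = 1"
    using u v by (auto simp: facet_normals_off_origin_def dot_square_norm)
  have pos: "?h u > 0" "?h v > 0"
    using u v by (auto intro: support_function_pos)
  have H: "{x. u \<bullet> x = ?h u} = {x. v \<bullet> x = ?h v}"
    using hull[OF u] hull[OF v] eq by simp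
  have 1: "?h u * (v \<bullet> u) = ?h v"
    using H norm by (auto simp: set_eq_iff dest!: spec[of _ "?h u *\<^sub>R u"])
  have 2: "?h v * (u \<bullet> v) = ?h u"
    using H norm by (auto simp: set_eq_iff dest!: spec[of _ "?h v *\<^sub>R v"])
  define c where "c = u \<bullet> v"
  have e: "?h u * c = ?h v" "?h v * c = ?h u"
    using 1 2 by (simp_all add: c_def inner_commute)
  have "c > 0" using e(1) pos by (metis zero_less_mult_pos)
  moreover have "c * c = 1"
  proof -
    have "?h u * (c * c) = ?h u * 1" using e by (simp flip: mult.assoc)
    then show ?thesis using pos by simp
  qed
  ultimately have "c = 1" by (metis abs_of_pos one_power2 power2_eq_square power2_eq_iff_nonneg less_imp_le zero_le_one)
  then have "(u - v) \<bullet> (u - v) = 0"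
    using norm by (simp add: c_def inner_diff inner_commute)
  then show "u = v" by simp
qed

lemma finite_facet_normals_off_origin: "finite (facet_normals_off_origin P)"
proof (rule finite_imageD[OF _ inj_on_support_face])
  have "support_face P ` facet_normals_off_origin P \<subseteq> {F. F face_of P}"
    using support_face_face_of by auto
  then show "finite (support_face P ` facet_normals_off_origin P)"
    using P finite_polytope_faces by (auto simp: polytopes_o_def intro: finite_subset)
qed

lemma Lp_surface_area_measure_in_sphere_measures:
  "Lp_surface_area_measure p P \<in> sphere_measures"
proof -
  have sp: "space (Lp_surface_area_measure p P) = sphere 0 1"
    using sets_eq_imp_space_eq[OF sets_Lp_surface_area_measure] by simp
  have "sphere 0 1 \<in> sets (sphere_borel :: 'a measure)"
    using sets.top[of "sphere_borel :: 'a measure"] by simp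
  then have "emeasure (Lp_surface_area_measure p P) (space (Lp_surface_area_measure p P)) \<noteq> \<infinity>"
    by (auto simp: sp emeasure_Lp_surface_area_measure finite_facet_normals_off_origin
        indicator_def ennreal_mult_eq_top_iff)
  then show ?thesis
    by (auto simp: sphere_measures_def intro: finite_measureI)
qed

end

end

theory Submission
  imports Defs
begin

text \<open>A valuation on polytopes that contain the origin \<open>o\<close> is additive when a polytope is cut by a
  hyperplane through \<open>o\<close>. Such cuts dissect every polytope into simplices with a vertex at \<open>o\<close>:
  where two facet inequalities \<open>a \<bullet> x \<le> 1\<close> and \<open>b \<bullet> x \<le> 1\<close> compete, the cut along
  \<open>a \<bullet> x = b \<bullet> x\<close> makes one of them redundant on either side, which leaves cones over single facets;
  the cones are split into simplicial ones by the same device, applied to ratios of their constraints.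
  Hence a valuation is determined by its values on simplices (\<open>cut_additive_determined_by_simplices\<close>).

  On simplices a contravariant valuation is tested against the moments
  \<open>\<integral> (max 0 (l \<bullet> u))\<^sup>p d\<mu>(P,u)\<close>. In terms of these, contravariance says that nothing changes when \<open>P\<close>
  and \<open>l\<close> are moved by the same map of determinant one. If \<open>P\<close> lies in a coordinate hyperplane, then
  shears that fix \<open>P\<close> change \<open>l\<close> by arbitrarily large amounts, so that most moments vanish; the
  remaining one satisfies \<open>m = 2 * 2\<^sup>-\<^sup>p * m\<close>, because halving an edge splits the simplex into two
  equivalent pieces, and \<open>p \<noteq> 1\<close> gives \<open>m = 0\<close> (\<open>null_std_simplex\<close>).

  A full-dimensional simplex is the image of the standard simplex under some linear map, and its
  moments, taken in the transported directions, depend only on the determinant \<open>t\<close> of the map. Cutting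
  an edge in the ratio of \<open>1 - \<lambda>\<close> to \<open>\<lambda>\<close> gives pieces of determinant \<open>(1 - \<lambda>) t\<close> and \<open>\<lambda> t\<close>. The moments
  in directions \<open>\<plusminus>e\<^sub>k\<close> are therefore additive in \<open>t\<close>, and linear because they are nonnegative. The moment
  in direction \<open>e\<^sub>i - e\<^sub>j\<close> turns out to be a multiple of \<open>t\<^sup>p\<^sup>+\<^sup>1\<close>, but it is bounded by the linear ones,
  so it is zero. This confines the measure to the two unit normals of the facet opposite to \<open>o\<close>,
  that is, to the directions of \<open>v = \<phi>\<^sup>-\<^sup>t (1, \<dots>, 1)\<close> and \<open>- v\<close>, with masses that are constant multiples
  of \<open>\<bar>v\<bar>\<^sup>p t\<close> (\<open>measure_image_std_simplex\<close>). Two constants remain free. For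
  the \<open>L\<^sub>p\<close> surface area measure they are \<open>(k, 0)\<close> and for its reflection \<open>(0, k)\<close>, where \<open>k > 0\<close>,
  which determines \<open>c\<^sub>1\<close> and \<open>c\<^sub>2\<close>.

  That the \<open>L\<^sub>p\<close> surface area measure itself is a contravariant valuation is seen one direction \<open>u\<close> at
  a time, after the volume of a facet has been rewritten as the volume of the prism of height one
  over it. If \<open>P\<close> and \<open>Q\<close> have a convex union, then either their support values at \<open>u\<close> differ, and
  union and intersection inherit one face each, or the values agree, and the faces unite and
  intersect (\<open>facet_weight_Un_Int\<close>). A map of determinant one takes the prism to a slanted prism of
  the same volume over the image of the face, which yields the power of \<open>\<bar>\<phi>\<^sup>-\<^sup>t u\<bar>\<close> that contravariance
  demands (\<open>facet_weight_linear_image\<close>).\<close>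

section \<open>Dissection into simplices with a vertex at the origin\<close>

lemma polytopes_o_Int_halfspaces:
  assumes "P \<in> polytopes_o"
  shows "P \<inter> {x. b \<bullet> x \<ge> 0} \<in> polytopes_o" "P \<inter> {x. b \<bullet> x \<le> 0} \<in> polytopes_o"
    "P \<inter> {x. b \<bullet> x = 0} \<in> polytopes_o"
  using assms
  by (auto simp: polytopes_o_def polyhedron_halfspace_ge polyhedron_halfspace_le
      polyhedron_hyperplane intro!: polytope_Int_polyhedron)

text \<open>The valuation property for \<open>P\<close> as the union of its two halves on either side of a hyperplane
  through the origin.\<close>

definition cut_additive :: "('a::euclidean_space set \<Rightarrow> real) \<Rightarrow> bool" where
  "cut_additive Z \<longleftrightarrow> (\<forall>P \<in> polytopes_o. \<forall>b.
     Z P + Z (P \<inter> {x. b \<bullet> x = 0}) = Z (P \<inter> {x. b \<bullet> x \<ge> 0}) + Z (P \<inter> {x. b \<bullet> x \<le> 0}))"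

lemma cut_additive_zeroI:
  assumes "cut_additive Z" "P \<in> polytopes_o"
    and "Z (P \<inter> {x. b \<bullet> x \<ge> 0}) = 0" "Z (P \<inter> {x. b \<bullet> x \<le> 0}) = 0" "Z (P \<inter> {x. b \<bullet> x = 0}) = 0"
  shows "Z P = 0"
  using assms unfolding cut_additive_def by (metis add.right_neutral)

text \<open>A direction along which \<open>a\<close> does not increase would put a whole ray into the bounded set.\<close>

lemma bounded_ray_pos:
  fixes a w :: "'a::euclidean_space"
  assumes "bounded P" "w \<noteq> 0" and ray: "\<And>t. t \<ge> 0 \<Longrightarrow> a \<bullet> (t *\<^sub>R w) \<le> 1 \<Longrightarrow> t *\<^sub>R w \<in> P"
  shows "a \<bullet> w > 0"
proof (rule ccontr)
  assume "\<not> a \<bullet> w > 0"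
  then have le: "a \<bullet> (t *\<^sub>R w) \<le> 1" if "t \<ge> 0" for t
    using that by (smt (verit) inner_scaleR_right mult_nonneg_nonpos)
  obtain B where B: "\<And>x. x \<in> P \<Longrightarrow> norm x \<le> B" and "B > 0"
    using assms(1) bounded_pos by blast
  have "((B + 1) / norm w) *\<^sub>R w \<in> P"
    using \<open>B > 0\<close> by (intro ray le) auto
  from B[OF this] show False using assms(2) \<open>B > 0\<close> by simp
qed

text \<open>\<open>W\<close> spans the edges of a simplicial cone; \<open>c w\<close> is the functional that cuts out the facet
  opposite to the edge \<open>w\<close>.\<close>

definition simplicial_frame :: "'a::euclidean_space set \<Rightarrow> ('a \<Rightarrow> 'a) \<Rightarrow> 'a set \<Rightarrow> bool" where
  "simplicial_frame W c L \<longleftrightarrow> finite W \<and> W \<subseteq> L \<and> (\<forall>w\<in>W. c w \<bullet> w > 0) \<and>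
     (\<forall>w\<in>W. \<forall>v\<in>W. v \<noteq> w \<longrightarrow> c w \<bullet> v = 0)"

lemma frame_inner_sum:
  assumes "simplicial_frame W c L" "w \<in> W"
  shows "c w \<bullet> (\<Sum>v\<in>W. t v *\<^sub>R v) = t w * (c w \<bullet> w)"
proof -
  have "c w \<bullet> (\<Sum>v\<in>W. t v *\<^sub>R v) = (\<Sum>v\<in>W. if v = w then t w * (c w \<bullet> w) else 0)"
    using assms unfolding inner_sum_right simplicial_frame_def
    by (intro sum.cong) auto
  then show ?thesis using assms by (simp add: simplicial_frame_def)
qed

lemma frame_independent:
  assumes "simplicial_frame W c L"
  shows "independent W"
proof -
  have fin: "finite W" using assms by (simp add: simplicial_frame_def)
  have "u w = 0" if "(\<Sum>v\<in>W. u v *\<^sub>R v) = 0" "w \<in> W" for u w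
    using frame_inner_sum[OF assms that(2), of u] that assms
    by (auto simp: simplicial_frame_def)
  then show ?thesis using fin by (auto simp: independent_explicit)
qed

text \<open>Biorthogonality lets one subtract from a point its component along \<open>W\<close>. The remainder satisfies
  the constraints in \<open>J\<close> and is annihilated by all \<open>c w\<close>, so when only \<open>0\<close> does this, the cell is
  spanned by \<open>W\<close>.\<close>

lemma frame_cell_simplex:
  assumes fr: "simplicial_frame W c L" and L: "subspace L"
    and a: "\<forall>w\<in>W. a \<bullet> w = 1" and J: "\<forall>b\<in>J. \<forall>w\<in>W. b \<bullet> w = 0"
    and P: "P = {x\<in>L. a \<bullet> x \<le> 1 \<and> (\<forall>w\<in>W. c w \<bullet> x \<ge> 0) \<and> (\<forall>b\<in>J. b \<bullet> x \<ge> 0)}"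
    and D: "\<And>x. x \<in> L \<Longrightarrow> \<forall>w\<in>W. c w \<bullet> x = 0 \<Longrightarrow> \<forall>b\<in>J. b \<bullet> x \<ge> 0 \<Longrightarrow> x = 0"
    and conv: "convex P"
  shows "P = convex hull (insert 0 W)"
proof
  have fin: "finite W" and WL: "W \<subseteq> L" using fr by (auto simp: simplicial_frame_def)
  show "convex hull insert 0 W \<subseteq> P"
  proof (rule hull_minimal)
    have "c w \<bullet> v \<ge> 0" if "w \<in> W" "v \<in> W" for v w
      using fr that by (cases "v = w") (auto simp: simplicial_frame_def intro: less_imp_le)
    then show "insert 0 W \<subseteq> P"
      using WL a J L by (auto simp: P subspace_0)
    show "convex P" by (rule conv)
  qed
  show "P \<subseteq> convex hull insert 0 W"
  proof
    fix x assume x: "x \<in> P"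
    define t where "t w = (c w \<bullet> x) / (c w \<bullet> w)" for w
    define y where "y = x - (\<Sum>w\<in>W. t w *\<^sub>R w)"
    have t0: "t w \<ge> 0" if "w \<in> W" for w
      using x fr that by (auto simp: t_def P simplicial_frame_def intro!: divide_nonneg_pos)
    have "y = 0"
    proof (rule D)
      show "y \<in> L"
        using x WL L unfolding y_def
        by (intro subspace_diff subspace_sum subspace_mul) (auto simp: P)
      show "\<forall>w\<in>W. c w \<bullet> y = 0"
        using fr by (auto simp: y_def inner_diff_right frame_inner_sum[OF fr] t_def simplicial_frame_def)
      show "\<forall>b\<in>J. b \<bullet> y \<ge> 0"
        using x J by (auto simp: y_def inner_diff_right inner_sum_right P)
    qed
    then have xs: "x = (\<Sum>w\<in>W. t w *\<^sub>R w)" by (simp add: y_def)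
    have "a \<bullet> x = (\<Sum>w\<in>W. t w)"
      using a by (simp add: xs inner_sum_right)
    then have s1: "(\<Sum>w\<in>W. t w) \<le> 1" using x by (simp add: P)
    have "0 \<notin> W" using a by auto
    define t' where "t' = (\<lambda>w. if w = 0 then 1 - sum t W else t w)"
    have sw: "sum t' W = sum t W" "(\<Sum>w\<in>W. t' w *\<^sub>R w) = (\<Sum>w\<in>W. t w *\<^sub>R w)"
      using \<open>0 \<notin> W\<close> by (auto simp: t'_def intro!: sum.cong)
    show "x \<in> convex hull insert 0 W"
      using fin \<open>0 \<notin> W\<close> sw s1 t0 xs
      by (auto simp: convex_hull_finite t'_def intro!: exI[of _ t'])
  qed
qed

text \<open>A cone over a single facet \<open>a \<bullet> x = 1\<close>, of which the edges in \<open>W\<close> have already been split off. Take a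
  further edge \<open>w\<close> of the residual cone. As long as several constraints are positive on \<open>w\<close>, a cut
  that contains \<open>W\<close> and \<open>w\<close> makes one of two of them redundant; once only one is left, it is the facet
  opposite to \<open>w\<close>, and the pair joins the frame. The number of constraints outside the frame drops at
  that step, and also in the piece within a cutting hyperplane, where the subspace \<open>L\<close> shrinks.\<close>

lemma cut_additive_zero_pyramid:
  fixes Z :: "'a::euclidean_space set \<Rightarrow> real"
  assumes Z: "cut_additive Z"
    and simp: "\<And>W. finite W \<Longrightarrow> independent W \<Longrightarrow> Z (convex hull (insert 0 W)) = 0"
  shows "card J = N \<Longrightarrow> finite J \<Longrightarrow> simplicial_frame W c L \<Longrightarrow> subspace L \<Longrightarrow>
      \<forall>w\<in>W. a \<bullet> w = 1 \<Longrightarrow> \<forall>b\<in>J. \<forall>w\<in>W. b \<bullet> w = 0 \<Longrightarrow>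
      P = {x\<in>L. a \<bullet> x \<le> 1 \<and> (\<forall>w\<in>W. c w \<bullet> x \<ge> 0) \<and> (\<forall>b\<in>J. b \<bullet> x \<ge> 0)} \<Longrightarrow>
      P \<in> polytopes_o \<Longrightarrow> Z P = 0"
proof (induction N arbitrary: J W c L P rule: less_induct)
  case (less N J W c L P)
  note fin = \<open>finite J\<close> and fr = \<open>simplicial_frame W c L\<close> and L = \<open>subspace L\<close>
    and aW = \<open>\<forall>w\<in>W. a \<bullet> w = 1\<close> and JW = \<open>\<forall>b\<in>J. \<forall>w\<in>W. b \<bullet> w = 0\<close> and P = less.prems(7)
  have bnd: "bounded P" and conv: "convex P"
    using less.prems(8) by (auto simp: polytopes_o_def polytope_imp_bounded polytope_imp_convex)
  note outer = less.IH[OF _ refl]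
  show ?case
  proof (cases "\<forall>x. x \<in> L \<and> (\<forall>w\<in>W. c w \<bullet> x = 0) \<and> (\<forall>b\<in>J. b \<bullet> x \<ge> 0) \<longrightarrow> x = 0")
    case True
    then have "P = convex hull (insert 0 W)"
      using frame_cell_simplex[OF fr L aW JW P _ conv] by blast
    then show ?thesis
      using simp frame_independent[OF fr] fr by (auto simp: simplicial_frame_def)
  next
    case False
    then obtain w0 where w0: "w0 \<in> L" "\<forall>w\<in>W. c w \<bullet> w0 = 0" "\<forall>b\<in>J. b \<bullet> w0 \<ge> 0" "w0 \<noteq> 0"
      by blast
    have "a \<bullet> w0 > 0"
      using L w0 by (intro bounded_ray_pos[OF bnd]) (auto simp: P subspace_mul)
    define w where "w = (1 / (a \<bullet> w0)) *\<^sub>R w0"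
    have w: "w \<in> L" "\<forall>v\<in>W. c v \<bullet> w = 0" "\<forall>b\<in>J. b \<bullet> w \<ge> 0" "a \<bullet> w = 1"
      using w0 L \<open>a \<bullet> w0 > 0\<close> by (auto simp: w_def subspace_mul)
    have wW: "w \<notin> W" using w(2) fr by (auto simp: simplicial_frame_def)
    have key: "Z Q = 0"
      if "card {b\<in>K. b \<bullet> w > 0} = m" "card K \<le> N" "finite K" "w \<in> M" "\<forall>b\<in>K. b \<bullet> w \<ge> 0"
         "simplicial_frame W c M" "subspace M" "\<forall>b\<in>K. \<forall>w\<in>W. b \<bullet> w = 0"
         "Q = {x\<in>M. a \<bullet> x \<le> 1 \<and> (\<forall>w\<in>W. c w \<bullet> x \<ge> 0) \<and> (\<forall>b\<in>K. b \<bullet> x \<ge> 0)}"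
         "Q \<in> polytopes_o" for K M Q m
      using that
    proof (induction m arbitrary: K M Q rule: less_induct)
      case (less m K M Q)
      note Q = less.prems(9)
      define Kp where "Kp = {b\<in>K. b \<bullet> w > 0}"
      have finKp: "finite Kp" using less.prems by (simp add: Kp_def)
      \<comment> \<open>otherwise the whole line through \<open>w\<close> would lie in the residual cone\<close>
      have "Kp \<noteq> {}"
      proof
        assume "Kp = {}"
        then have z: "b \<bullet> w = 0" if "b \<in> K" for b
          using that less.prems(5) by (force simp: Kp_def)
        have "bounded Q" using less.prems(10) by (simp add: polytopes_o_def polytope_imp_bounded)
        then have "a \<bullet> (- w) > 0"
        proof (rule bounded_ray_pos)
          show "- w \<noteq> 0" using w(4) by auto
        next
          fix t :: real assume "t \<ge> 0" "a \<bullet> (t *\<^sub>R - w) \<le> 1"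
          then show "t *\<^sub>R - w \<in> Q"
            using less.prems(4,7) w(2) z unfolding Q
            by (auto simp: subspace_mul subspace_neg simp flip: scaleR_minus_left)
        qed
        then show False using w(4) by simp
      qed
      then obtain b1 where b1: "b1 \<in> Kp" by blast
      show ?case
      proof (cases "Kp = {b1}")
        case True
        have z: "b \<bullet> w = 0" if "b \<in> K - {b1}" for b
          using that less.prems(5) True by (force simp: Kp_def)
        have b1K: "b1 \<in> K" "b1 \<bullet> w > 0" using b1 by (auto simp: Kp_def)
        define c' where "c' = c(w := b1)"
        have [simp]: "c' w = b1" "\<And>v. v \<in> W \<Longrightarrow> c' v = c v"
          using wW by (auto simp: c'_def)
        have "card (K - {b1}) < N"
          using less.prems(2,3) b1K by (metis card_Diff1_less order_less_le_trans)
        then show ?thesis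
        proof (rule outer)
          show "finite (K - {b1})" using less.prems by simp
          show "simplicial_frame (insert w W) c' M"
            using less.prems(4,6,8) b1K w(2) wW by (auto simp: simplicial_frame_def)
          show "subspace M" by fact
          show "\<forall>v\<in>insert w W. a \<bullet> v = 1" using aW w by auto
          show "\<forall>b\<in>K - {b1}. \<forall>v\<in>insert w W. b \<bullet> v = 0" using z less.prems(8) by auto
          show "Q = {x \<in> M. a \<bullet> x \<le> 1 \<and> (\<forall>v\<in>insert w W. 0 \<le> c' v \<bullet> x) \<and> (\<forall>b\<in>K - {b1}. 0 \<le> b \<bullet> x)}"
            using b1K unfolding Q by auto
        qed fact+
      next
        case False
        then obtain b2 where b2: "b2 \<in> Kp" "b2 \<noteq> b1" using b1 by blast
        \<comment> \<open>where the normalised value of one of two constraints is the larger one, that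
          constraint is redundant\<close>
        have half: "Z (Q \<inter> {x. (e2 /\<^sub>R (e2 \<bullet> w) - e1 /\<^sub>R (e1 \<bullet> w)) \<bullet> x \<ge> 0}) = 0"
          if e: "e1 \<in> Kp" "e2 \<in> Kp" "e1 \<noteq> e2" for e1 e2
        proof -
          define d where "d = e2 /\<^sub>R (e2 \<bullet> w) - e1 /\<^sub>R (e1 \<bullet> w)"
          have e': "e1 \<in> K" "e2 \<in> K" "e1 \<bullet> w > 0" "e2 \<bullet> w > 0" using e by (auto simp: Kp_def)
          define K' where "K' = insert d (K - {e2})"
          have dw: "d \<bullet> w = 0" using e' by (simp add: d_def inner_diff_left)
          have red: "e2 \<bullet> x \<ge> 0" if "e1 \<bullet> x \<ge> 0" "d \<bullet> x \<ge> 0" for x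
          proof -
            have "(e2 \<bullet> x) / (e2 \<bullet> w) \<ge> (e1 \<bullet> x) / (e1 \<bullet> w)"
              using that by (simp add: d_def inner_diff_left divide_inverse_commute)
            moreover have "(e1 \<bullet> x) / (e1 \<bullet> w) \<ge> 0" using that e' by simp
            ultimately show ?thesis using e' by (metis divide_less_0_iff not_le order_trans)
          qed
          have "{b\<in>K'. b \<bullet> w > 0} \<subseteq> Kp - {e2}" using dw by (auto simp: K'_def Kp_def)
          then have "card {b\<in>K'. b \<bullet> w > 0} < card Kp"
            using finKp e(2) by (metis card_mono card_Diff1_less finite_Diff le_less_trans)
          then have 1: "card {b\<in>K'. b \<bullet> w > 0} < m" using less.prems(1) by (simp add: Kp_def)
          have 2: "card K' \<le> N"
            using less.prems(2,3) e'(2) unfolding K'_def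
            by (metis card_insert_disjoint card_insert_if card_Suc_Diff1 finite_Diff le_trans card_Diff1_le)
          have "Z (Q \<inter> {x. d \<bullet> x \<ge> 0}) = 0"
          proof (rule less.IH[OF 1 refl 2])
            show "finite K'" using less.prems by (simp add: K'_def)
            show "\<forall>b\<in>K'. 0 \<le> b \<bullet> w" using less.prems dw by (auto simp: K'_def)
            show "\<forall>b\<in>K'. \<forall>w\<in>W. b \<bullet> w = 0"
              using less.prems(8) e' by (auto simp: K'_def d_def inner_diff_left)
            show "Q \<inter> {x. d \<bullet> x \<ge> 0} = {x \<in> M. a \<bullet> x \<le> 1 \<and> (\<forall>w\<in>W. 0 \<le> c w \<bullet> x) \<and> (\<forall>b\<in>K'. 0 \<le> b \<bullet> x)}"
              using red e(3) e'(1) unfolding Q by (auto simp: K'_def)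
            show "Q \<inter> {x. d \<bullet> x \<ge> 0} \<in> polytopes_o"
              by (rule polytopes_o_Int_halfspaces) fact
          qed fact+
          then show ?thesis by (simp add: d_def)
        qed
        define d where "d = b2 /\<^sub>R (b2 \<bullet> w) - b1 /\<^sub>R (b1 \<bullet> w)"
        have b': "b1 \<in> K" "b2 \<in> K" "b1 \<bullet> w > 0" "b2 \<bullet> w > 0" using b1 b2 by (auto simp: Kp_def)
        show ?thesis
        proof (rule cut_additive_zeroI[OF Z less.prems(10), of d])
          show "Z (Q \<inter> {x. d \<bullet> x \<ge> 0}) = 0" using half[OF b1 b2(1)] b2 by (simp add: d_def)
          have "{x. d \<bullet> x \<le> 0} = {x. (b1 /\<^sub>R (b1 \<bullet> w) - b2 /\<^sub>R (b2 \<bullet> w)) \<bullet> x \<ge> 0}"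
            by (auto simp: d_def inner_diff_left)
          then show "Z (Q \<inter> {x. d \<bullet> x \<le> 0}) = 0" using half[OF b2(1) b1] b2 by simp
          have "card (K - {b2}) < N"
            using less.prems(2,3) b' by (metis card_Diff1_less order_less_le_trans)
          then show "Z (Q \<inter> {x. d \<bullet> x = 0}) = 0"
          proof (rule outer)
            show "finite (K - {b2})" using less.prems by simp
            show "simplicial_frame W c (M \<inter> {x. d \<bullet> x = 0})"
              using less.prems(6,8) b' by (auto simp: simplicial_frame_def d_def inner_diff_left)
            show "subspace (M \<inter> {x. d \<bullet> x = 0})"
              using less.prems(7) by (simp add: subspace_inter subspace_hyperplane)
            show "\<forall>b\<in>K - {b2}. \<forall>w\<in>W. b \<bullet> w = 0" using less.prems(8) by simp
            show "Q \<inter> {x. d \<bullet> x = 0} = {x \<in> M \<inter> {x. d \<bullet> x = 0}. a \<bullet> x \<le> 1 \<and>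
                (\<forall>w\<in>W. 0 \<le> c w \<bullet> x) \<and> (\<forall>b\<in>K - {b2}. 0 \<le> b \<bullet> x)}"
            proof -
              have "b2 \<bullet> x \<ge> 0" if "d \<bullet> x = 0" "\<forall>b\<in>K - {b2}. 0 \<le> b \<bullet> x" for x
              proof -
                have "(b2 \<bullet> x) / (b2 \<bullet> w) = (b1 \<bullet> x) / (b1 \<bullet> w)"
                  using that by (simp add: d_def inner_diff_left divide_inverse_commute)
                moreover have "b1 \<bullet> x \<ge> 0" using that b' b2 by auto
                ultimately have "(b2 \<bullet> x) / (b2 \<bullet> w) \<ge> 0" using b' by simp
                then show ?thesis using b' by (simp add: zero_le_divide_iff)
              qed
              then show ?thesis unfolding Q by auto
            qed
            show "Q \<inter> {x. d \<bullet> x = 0} \<in> polytopes_o"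
              by (rule polytopes_o_Int_halfspaces) fact
          qed fact+
        qed
      qed
    qed
    show ?thesis
      using less.prems w by (intro key[of J _ L]) auto
  qed
qed

text \<open>The hyperplane on which two facet inequalities agree contains the origin, and on each side of it
  one of the two implies the other; this is repeated until a single facet inequality is left.\<close>

lemma cut_additive_zero_polyhedral:
  fixes Z :: "'a::euclidean_space set \<Rightarrow> real"
  assumes Z: "cut_additive Z"
    and simp: "\<And>W. finite W \<Longrightarrow> independent W \<Longrightarrow> Z (convex hull (insert 0 W)) = 0"
  shows "card A = N \<Longrightarrow> finite A \<Longrightarrow> finite J \<Longrightarrow> subspace L \<Longrightarrow>
      P = {x\<in>L. (\<forall>a\<in>A. a \<bullet> x \<le> 1) \<and> (\<forall>b\<in>J. b \<bullet> x \<ge> 0)} \<Longrightarrow>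
      P \<in> polytopes_o \<Longrightarrow> Z P = 0"
proof (induction N arbitrary: A J L P rule: less_induct)
  case (less N A J L P)
  note P = less.prems(5)
  have pyr: "Z P = 0" if "P = {x\<in>L. a \<bullet> x \<le> 1 \<and> (\<forall>b\<in>J. b \<bullet> x \<ge> 0)}" for a
    using cut_additive_zero_pyramid[OF Z simp refl, of J "{}" id L a P] that less.prems
    by (auto simp: simplicial_frame_def)
  consider "A = {}" | a where "A = {a}" | a1 a2 where "a1 \<in> A" "a2 \<in> A" "a1 \<noteq> a2" by blast
  then show ?case
  proof cases
    case 1
    then show ?thesis using pyr[of 0] P by simp
  next
    case 2
    then show ?thesis using pyr P by simp
  next
    case 3
    have half: "Z (P \<inter> {x. (e1 - e2) \<bullet> x \<ge> 0}) = 0" if e: "e1 \<in> A" "e2 \<in> A" "e1 \<noteq> e2" for e1 e2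
    proof -
      have "card (A - {e2}) < N" using less.prems e by (metis card_Diff1_less)
      then show ?thesis
      proof (rule less.IH[OF _ refl])
        show "P \<inter> {x. (e1 - e2) \<bullet> x \<ge> 0} =
            {x\<in>L. (\<forall>a\<in>A - {e2}. a \<bullet> x \<le> 1) \<and> (\<forall>b\<in>insert (e1 - e2) J. b \<bullet> x \<ge> 0)}"
        proof -
          have "e2 \<bullet> x \<le> 1" if "e1 \<bullet> x \<le> 1" "(e1 - e2) \<bullet> x \<ge> 0" for x
            using that by (simp add: inner_diff_left)
          then show ?thesis using e unfolding P by auto
        qed
        show "P \<inter> {x. (e1 - e2) \<bullet> x \<ge> 0} \<in> polytopes_o"
          by (rule polytopes_o_Int_halfspaces) fact
      qed (use less.prems in auto)
    qed
    show ?thesis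
    proof (rule cut_additive_zeroI[OF Z less.prems(6), of "a1 - a2"])
      show "Z (P \<inter> {x. (a1 - a2) \<bullet> x \<ge> 0}) = 0" by (rule half) fact+
      have "{x. (a1 - a2) \<bullet> x \<le> 0} = {x. (a2 - a1) \<bullet> x \<ge> 0}" by (auto simp: inner_diff_left)
      then show "Z (P \<inter> {x. (a1 - a2) \<bullet> x \<le> 0}) = 0" using half[of a2 a1] 3 by simp
      have "card (A - {a2}) < N" using less.prems 3 by (metis card_Diff1_less)
      then show "Z (P \<inter> {x. (a1 - a2) \<bullet> x = 0}) = 0"
      proof (rule less.IH[OF _ refl])
        show "P \<inter> {x. (a1 - a2) \<bullet> x = 0} =
            {x\<in>L \<inter> {x. (a1 - a2) \<bullet> x = 0}. (\<forall>a\<in>A - {a2}. a \<bullet> x \<le> 1) \<and> (\<forall>b\<in>J. b \<bullet> x \<ge> 0)}"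
        proof -
          have "a2 \<bullet> x \<le> 1" if "a1 \<bullet> x \<le> 1" "(a1 - a2) \<bullet> x = 0" for x
            using that by (simp add: inner_diff_left)
          then show ?thesis using 3 unfolding P by auto
        qed
        show "P \<inter> {x. (a1 - a2) \<bullet> x = 0} \<in> polytopes_o"
          by (rule polytopes_o_Int_halfspaces) fact
      qed (use less.prems in \<open>auto simp: subspace_inter subspace_hyperplane\<close>)
    qed
  qed
qed

text \<open>The origin satisfies all inequalities, so right-hand sides are nonnegative and can be scaled to
  \<open>1\<close> or \<open>0\<close>.\<close>

lemma polytopes_o_polyhedral:
  fixes P :: "'a::euclidean_space set"
  assumes "P \<in> polytopes_o"
  obtains A J where "finite A" "finite J" "P = {x. (\<forall>a\<in>A. a \<bullet> x \<le> 1) \<and> (\<forall>b\<in>J. b \<bullet> x \<ge> 0)}"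
proof -
  have "polyhedron P" "0 \<in> P" using assms by (auto simp: polytopes_o_def polytope_imp_polyhedron)
  then obtain F where F: "finite F" "P = \<Inter>F" "\<And>h. h \<in> F \<Longrightarrow> \<exists>a b. a \<noteq> 0 \<and> h = {x. a \<bullet> x \<le> b}"
    unfolding polyhedron_def by metis
  then obtain a b where ab: "\<And>h. h \<in> F \<Longrightarrow> h = {x. a h \<bullet> x \<le> b h}" by metis
  have b0: "b h \<ge> 0" if "h \<in> F" for h
  proof -
    have "0 \<in> h" using that \<open>0 \<in> P\<close> F(2) by blast
    then have "0 \<in> {x. a h \<bullet> x \<le> b h}" using ab[OF that] by blast
    then show ?thesis by simp
  qed
  define A where "A = (\<lambda>h. a h /\<^sub>R b h) ` {h\<in>F. b h > 0}"
  define J where "J = (\<lambda>h. - a h) ` {h\<in>F. b h = 0}"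
  have "x \<in> P \<longleftrightarrow> (\<forall>a\<in>A. a \<bullet> x \<le> 1) \<and> (\<forall>b\<in>J. b \<bullet> x \<ge> 0)" for x
  proof -
    have "x \<in> P \<longleftrightarrow> (\<forall>h\<in>F. a h \<bullet> x \<le> b h)" using F(2) ab by blast
    also have "\<dots> \<longleftrightarrow> (\<forall>h\<in>F. b h > 0 \<longrightarrow> a h \<bullet> x \<le> b h) \<and> (\<forall>h\<in>F. b h = 0 \<longrightarrow> a h \<bullet> x \<le> 0)"
      using b0 by (metis order_le_less)
    also have "\<dots> \<longleftrightarrow> (\<forall>a\<in>A. a \<bullet> x \<le> 1) \<and> (\<forall>b\<in>J. b \<bullet> x \<ge> 0)"
      by (auto simp: A_def J_def field_simps)
    finally show ?thesis .
  qed
  then show ?thesis using F(1) by (intro that[of A J]) (auto simp: A_def J_def)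
qed

text \<open>To be applied to the difference of two valuations that agree on simplices.\<close>

theorem cut_additive_determined_by_simplices:
  fixes Z :: "'a::euclidean_space set \<Rightarrow> real"
  assumes "cut_additive Z"
    and "\<And>W. finite W \<Longrightarrow> independent W \<Longrightarrow> Z (convex hull (insert 0 W)) = 0"
    and P: "P \<in> polytopes_o"
  shows "Z P = 0"
proof -
  obtain A J where "finite A" "finite J" "P = {x. (\<forall>a\<in>A. a \<bullet> x \<le> 1) \<and> (\<forall>b\<in>J. b \<bullet> x \<ge> 0)}"
    using polytopes_o_polyhedral[OF P] .
  then show ?thesis
    using cut_additive_zero_polyhedral[OF assms(1,2) refl, of A J UNIV P] P by simp
qed

section \<open>Facet volumes as volumes of prisms\<close>

text \<open>Linear maps are products of elementary ones, and for these it suffices to compare the volumes of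
  boxes and their images.\<close>

lemma measure_linear_image_finite:
  fixes f :: "real^'n \<Rightarrow> real^'n"
  assumes "linear f" "S \<in> lmeasurable"
  shows "f ` S \<in> lmeasurable \<and> measure lebesgue (f ` S) = \<bar>det (matrix f)\<bar> * measure lebesgue S"
proof -
  let ?Q = "\<lambda>f :: real^'n \<Rightarrow> real^'n. \<lambda>S. f ` S \<in> lmeasurable \<and>
    measure lebesgue (f ` S) = \<bar>det (matrix f)\<bar> * measure lebesgue S"
  have "\<forall>S\<in>lmeasurable. ?Q f S"
  proof (rule induct_linear_elementary[OF assms(1)])
    fix f g :: "real^'n \<Rightarrow> real^'n"
    assume "linear f" "linear g" and fg: "\<forall>S\<in>lmeasurable. ?Q f S" "\<forall>S\<in>lmeasurable. ?Q g S"
    show "\<forall>S\<in>lmeasurable. ?Q (f \<circ> g) S"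
      unfolding image_comp[symmetric] matrix_compose[OF \<open>linear g\<close> \<open>linear f\<close>] det_mul abs_mult
      using fg by simp
  next
    fix f :: "real^'n \<Rightarrow> real^'n" and i assume f: "linear f" and zero: "\<And>x. f x $ i = 0"
    have ninj: "\<not> inj f"
      by (metis f linear_injective_imp_surjective one_neq_zero surjE vec_component zero)
    have "negligible (f ` S)" for S
      using negligible_linear_singular_image[OF f ninj] .
    moreover have "det (matrix f) = 0"
      using ninj det_nz_iff_inj[OF f] by blast
    ultimately show "\<forall>S\<in>lmeasurable. ?Q f S"
      by (simp add: negligible_iff_measure)
  next
    fix c :: "'n \<Rightarrow> real"
    show "\<forall>S\<in>lmeasurable. ?Q (\<lambda>x. \<chi> i. c i * x $ i) S"
      by (simp add: measurable_stretch measure_stretch axis_def matrix_def det_diagonal)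
  next
    fix m n :: 'n assume "m \<noteq> n"
    let ?h = "\<lambda>x :: real^'n. \<chi> i. x $ Transposition.transpose m n i"
    have lin: "linear ?h"
      by (rule linearI) (simp_all add: vec_eq_iff)
    have "?h x \<bullet> ?h y = x \<bullet> y" for x y
      using sum.permute[OF permutes_swap_id[of m UNIV n], of "\<lambda>i. x $ i \<bullet> y $ i"]
      by (simp add: inner_vec_def o_def)
    then have det: "\<bar>det (matrix ?h)\<bar> = 1"
      using lin by (intro orthogonal_transformation_det) (simp add: orthogonal_transformation_def)
    have box1: "measure lebesgue (?h ` cbox a b) = 1 * measure lebesgue (cbox a b)" for a b
    proof (cases "cbox a b = {}")
      case False
      have eq: "?h ` cbox a b = cbox (?h a) (?h b)"
      proof -
        have inv: "?h (?h x) = x" for x by (simp add: vec_eq_iff)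
        have sub: "?h x \<in> cbox (?h c) (?h d)" if "x \<in> cbox c d" for x c d
          using that by (simp add: mem_box_cart)
        show ?thesis
        proof
          show "?h ` cbox a b \<subseteq> cbox (?h a) (?h b)" using sub by blast
          show "cbox (?h a) (?h b) \<subseteq> ?h ` cbox a b"
          proof
            fix x assume "x \<in> cbox (?h a) (?h b)"
            then have "?h x \<in> cbox a b" using sub[of x "?h a" "?h b"] unfolding inv by blast
            then show "x \<in> ?h ` cbox a b" using inv[of x] by (metis imageI)
          qed
        qed

      qed
      with False have "cbox (?h a) (?h b) \<noteq> {}" by blast
      then show ?thesis
        using prod.permute[OF permutes_swap_id[of m UNIV n], of "\<lambda>i. (b - a) $ i"] False
        by (simp add: eq content_cbox_cart o_def)
    qed simp
    show "\<forall>S\<in>lmeasurable. ?Q ?h S"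
    proof
      fix S :: "(real^'n) set" assume "S \<in> lmeasurable"
      from measure_linear_sufficient[OF lin this box1]
      show "?Q ?h S" unfolding det abs_one mult_1 by (elim conjE) (intro conjI, assumption, rule sym)
    qed
  next
    fix m n :: 'n assume mn: "m \<noteq> n"
    let ?h = "\<lambda>x :: real^'n. \<chi> i. if i = m then x $ m + x $ n else x $ i"
    have lin: "linear ?h"
      by (rule linearI) (auto simp: vec_eq_iff algebra_simps)
    have "matrix ?h = (\<chi> k. if k = m then row m (mat 1) + 1 *s row n (mat 1) else row k (mat 1))"
      by (auto simp: matrix_def row_def vec_eq_iff axis_def mat_def)
    then have det: "det (matrix ?h) = 1"
      using det_row_operation[OF mn, of "mat 1 :: real^'n^'n" 1] by simp
    have box1: "measure lebesgue (?h ` cbox a b) = 1 * measure lebesgue (cbox a b)" for a b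
    proof (cases "cbox a b = {}")
      case False
      define v where "v = axis n (a $ n)"
      have box: "cbox a b = (+) v ` cbox (a - v) (b - v)"
        using cbox_translation[of v "a - v" "b - v"] by simp
      have "?h ` cbox a b = (+) (?h v) ` ?h ` cbox (a - v) (b - v)"
        unfolding box image_image by (simp only: linear_add[OF lin])
      then have "measure lebesgue (?h ` cbox a b) = measure lebesgue (?h ` cbox (a - v) (b - v))"
        by (simp only: measure_translation)
      also have "\<dots> = measure lebesgue (cbox (a - v) (b - v))"
        using mn False box by (intro measure_shear_interval) (auto simp: v_def axis_def)
      also have "\<dots> = measure lebesgue (cbox a b)"
        unfolding box by (simp only: measure_translation)
      finally show ?thesis by simp
    qed simp
    show "\<forall>S\<in>lmeasurable. ?Q ?h S"
    proof
      fix S :: "(real^'n) set" assume "S \<in> lmeasurable"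
      from measure_linear_sufficient[OF lin this box1]
      show "?Q ?h S" unfolding det abs_one mult_1 by (elim conjE) (intro conjI, assumption, rule sym)
    qed
  qed
  with assms(2) show ?thesis by blast
qed

text \<open>When \<open>v\<close> is a unit normal of a flat that contains \<open>F\<close>, the Lebesgue measure of the prism is the
  volume of \<open>F\<close> within the flat. This description of the volume involves no coordinates.\<close>

definition prism :: "'a::euclidean_space \<Rightarrow> 'a set \<Rightarrow> 'a set" where
  "prism v F = (\<lambda>(x, t). x + t *\<^sub>R v) ` (F \<times> {0..1})"

lemma prism_iff: "y \<in> prism v F \<longleftrightarrow> (\<exists>x\<in>F. \<exists>t. 0 \<le> t \<and> t \<le> 1 \<and> y = x + t *\<^sub>R v)"
  unfolding prism_def by force

lemma compact_prism: "compact F \<Longrightarrow> compact (prism v F)"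
  unfolding prism_def case_prod_unfold
  by (intro compact_continuous_image continuous_intros compact_Times) auto

lemma prism_Un: "prism v (F \<union> G) = prism v F \<union> prism v G"
  unfolding prism_def by auto

text \<open>The functional \<open>u\<close> recovers the height of a point above the common base plane.\<close>

lemma prism_Int:
  assumes "F \<subseteq> {x. u \<bullet> x = h}" "G \<subseteq> {x. u \<bullet> x = h}" "u \<bullet> v \<noteq> 0"
  shows "prism v (F \<inter> G) = prism v F \<inter> prism v G"
proof -
  have "s = t" if "x \<in> F" "y \<in> G" "x + s *\<^sub>R v = y + t *\<^sub>R v" for x y s t
  proof -
    have "u \<bullet> (x + s *\<^sub>R v) = u \<bullet> (y + t *\<^sub>R v)" using that by simp
    moreover have "u \<bullet> x = h" "u \<bullet> y = h" using that assms by auto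
    ultimately show ?thesis using assms(3) by (simp add: inner_add_right)
  qed
  then show ?thesis by (fastforce simp: set_eq_iff prism_iff)
qed

lemma measure_prism_Un_Int:
  fixes F G :: "'a::euclidean_space set"
  assumes "compact F" "compact G" "F \<subseteq> {x. u \<bullet> x = h}" "G \<subseteq> {x. u \<bullet> x = h}" "u \<noteq> 0"
  shows "measure lebesgue (prism u (F \<union> G)) + measure lebesgue (prism u (F \<inter> G)) =
         measure lebesgue (prism u F) + measure lebesgue (prism u G)"
  using assms measure_Un3[of "prism u F" lebesgue "prism u G"]
  by (simp add: prism_Un prism_Int[OF assms(3,4)] lmeasurable_compact compact_prism)

lemma inner_sum_enumerated_Basis:
  fixes \<beta> :: "nat \<Rightarrow> 'a::euclidean_space"
  assumes \<beta>: "bij_betw \<beta> {..<n} Basis" and "j < n"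
  shows "(\<Sum>i<n. c i *\<^sub>R \<beta> i) \<bullet> \<beta> j = c j"
proof -
  have "(\<Sum>i<n. c i *\<^sub>R \<beta> i) \<bullet> \<beta> j = (\<Sum>i<n. if i = j then c i else 0)"
    unfolding inner_sum_left
  proof (rule sum.cong)
    fix i assume "i \<in> {..<n}"
    then have "\<beta> i = \<beta> j \<longleftrightarrow> i = j" "\<beta> i \<in> Basis" "\<beta> j \<in> Basis"
      using \<beta> \<open>j < n\<close> by (auto simp: bij_betw_def inj_on_def)
    then show "(c i *\<^sub>R \<beta> i) \<bullet> \<beta> j = (if i = j then c i else 0)"
      by (auto simp: inner_Basis)
  qed simp
  then show ?thesis using assms(2) by simp
qed

lemma lborel_eq_distr_PiM_basis:
  fixes \<beta> :: "nat \<Rightarrow> 'a::euclidean_space"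
  assumes \<beta>: "bij_betw \<beta> {..<n} Basis"
  shows "lborel = distr (\<Pi>\<^sub>M i\<in>{..<n}. lborel) borel (\<lambda>c. \<Sum>i<n. c i *\<^sub>R \<beta> i)"
proof (rule lborel_eqI)
  interpret product_sigma_finite "\<lambda>_::nat. lborel :: real measure" ..
  fix l u :: 'a assume lu: "\<And>b. b \<in> Basis \<Longrightarrow> l \<bullet> b \<le> u \<bullet> b"
  let ?G = "\<lambda>c. \<Sum>i<n. c i *\<^sub>R \<beta> i"
  have \<beta>B: "\<beta> i \<in> Basis" if "i < n" for i using \<beta> that by (auto simp: bij_betw_def)
  note inner = inner_sum_enumerated_Basis[OF \<beta>]
  have meas: "?G \<in> (\<Pi>\<^sub>M i\<in>{..<n}. lborel) \<rightarrow>\<^sub>M borel" by measurable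
  have Ball: "(\<forall>b\<in>Basis. Q b) \<longleftrightarrow> (\<forall>i<n. Q (\<beta> i))" for Q
    using \<beta> unfolding bij_betw_def by (metis imageE imageI lessThan_iff)
  have "?G -` box l u \<inter> space (\<Pi>\<^sub>M i\<in>{..<n}. lborel) = (\<Pi>\<^sub>E i\<in>{..<n}. {l \<bullet> \<beta> i<..<u \<bullet> \<beta> i})"
    by (auto simp: space_PiM PiE_def Pi_def mem_box Ball inner)
  then have "emeasure (distr (\<Pi>\<^sub>M i\<in>{..<n}. lborel) borel ?G) (box l u) =
      (\<Prod>i<n. emeasure lborel {l \<bullet> \<beta> i<..<u \<bullet> \<beta> i})"
    by (simp add: emeasure_distr[OF meas] emeasure_PiM)
  also have "\<dots> = (\<Prod>i<n. ennreal ((u - l) \<bullet> \<beta> i))"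
    using lu \<beta>B by (intro prod.cong) (auto simp: inner_diff_left)
  also have "\<dots> = (\<Prod>b\<in>Basis. ennreal ((u - l) \<bullet> b))"
    by (rule prod.reindex_bij_betw[OF \<beta>])
  also have "\<dots> = ennreal (\<Prod>b\<in>Basis. (u - l) \<bullet> b)"
    using lu by (intro prod_ennreal) (auto simp: inner_diff_left)
  finally show "emeasure (distr (\<Pi>\<^sub>M i\<in>{..<n}. lborel) borel ?G) (box l u) =
    ennreal (\<Prod>b\<in>Basis. (u - l) \<bullet> b)" .
qed simp

lemma measure_orthogonal_image_finite:
  fixes f :: "real^'n \<Rightarrow> real^'n"
  assumes "orthogonal_transformation f" "S \<in> lmeasurable"
  shows "measure lebesgue (f ` S) = measure lebesgue S"
  using measure_linear_image_finite[OF orthogonal_transformation_linear[OF assms(1)] assms(2)] assms(1)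
  by simp

text \<open>A chart completed by the unit normal \<open>u\<close> is an isometry of the whole space. In its coordinates the
  prism is the product of the set on the left and a unit interval.\<close>

lemma measure_chart_eq_prism:
  fixes F :: "(real^'n) set"
  assumes F: "compact F" "F \<subseteq> range (flat_chart d a b)" and d: "Suc d = CARD('n)"
    and b: "orthonormal_family d b" and u: "norm u = 1" "\<And>i. i < d \<Longrightarrow> u \<bullet> b i = 0"
  shows "measure (\<Pi>\<^sub>M i\<in>{..<d}. (lborel :: real measure)) {c \<in> {..<d} \<rightarrow>\<^sub>E UNIV. flat_chart d a b c \<in> F} =
    measure lebesgue (prism u F)"
proof -
  interpret product_sigma_finite "\<lambda>_::nat. lborel :: real measure" ..
  define n where "n = Suc d"
  let ?M = "\<Pi>\<^sub>M i\<in>{..<n}. (lborel :: real measure)" and ?N = "\<Pi>\<^sub>M i\<in>{..<d}. (lborel :: real measure)"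
  have "\<exists>\<beta>. bij_betw \<beta> {0..<card (Basis :: (real^'n) set)} (Basis :: (real^'n) set)"
    by (intro ex_bij_betw_nat_finite) simp
  then obtain \<beta> where \<beta>: "bij_betw \<beta> {..<n} (Basis :: (real^'n) set)"
    by (auto simp: n_def d atLeast0LessThan)
  define b' where "b' = b(d := u)"
  have uu: "u \<bullet> u = 1" using u(1) by (simp add: dot_square_norm)
  have b': "b' i \<bullet> b' j = (if i = j then 1 else 0)" if "i < n" "j < n" for i j
    using b u(2) that uu by (auto simp: b'_def n_def orthonormal_family_def less_Suc_eq inner_commute)
  define R where "R x = (\<Sum>i<n. (x \<bullet> \<beta> i) *\<^sub>R b' i)" for x
  have "linear R"
    by (rule linearI) (auto simp: R_def inner_add_left scaleR_left_distrib sum.distrib scaleR_right.sum)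
  moreover have "R x \<bullet> R y = x \<bullet> y" for x y
  proof -
    have "R x \<bullet> R y = (\<Sum>i<n. \<Sum>j<n. (x \<bullet> \<beta> i) * ((y \<bullet> \<beta> j) * (b' i \<bullet> b' j)))"
      unfolding R_def inner_sum_left unfolding inner_sum_right by (simp add: mult.left_commute)
    also have "\<dots> = (\<Sum>i<n. \<Sum>j<n. if i = j then (x \<bullet> \<beta> i) * (y \<bullet> \<beta> j) else 0)"
      by (intro sum.cong refl) (auto simp: b')
    also have "\<dots> = (\<Sum>i<n. (x \<bullet> \<beta> i) * (y \<bullet> \<beta> i))" by simp
    also have "\<dots> = (\<Sum>b\<in>Basis. (x \<bullet> b) * (y \<bullet> b))"
      by (rule sum.reindex_bij_betw[OF \<beta>])
    finally show ?thesis using euclidean_inner[of x y] by simp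
  qed
  ultimately have R: "orthogonal_transformation R" by (simp add: orthogonal_transformation_def)
  define S where "S = {x. a + R x \<in> prism u F}"
  have contR: "continuous_on UNIV (\<lambda>x. a + R x)"
    using \<open>linear R\<close> by (intro continuous_intros linear_continuous_on) (simp add: linear_linear)
  have "closed S"
    using continuous_closed_vimage[of "prism u F" "\<lambda>x. a + R x"] contR compact_prism[OF F(1)]
    by (simp add: S_def vimage_def compact_imp_closed continuous_on_eq_continuous_at)
  have surj: "surj R" by (rule orthogonal_transformation_surj[OF R])
  have img: "prism u F = (+) a ` R ` S"
  proof -
    have "y \<in> (+) a ` R ` S" if "y \<in> prism u F" for y
    proof -
      obtain x where "R x = y - a" using surj by (metis surjD)
      then show ?thesis using that by (intro image_eqI[of _ _ "R x"] imageI) (simp_all add: S_def)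
    qed
    then show ?thesis by (auto simp: S_def)
  qed
  have "bounded S"
  proof -
    obtain B where B: "\<And>y. y \<in> prism u F \<Longrightarrow> norm y \<le> B"
      using compact_prism[OF F(1)] compact_imp_bounded bounded_iff by metis
    have "norm x \<le> B + norm a" if "x \<in> S" for x
    proof -
      have "norm x = norm (R x)" using R by (simp add: orthogonal_transformation_norm)
      also have "\<dots> \<le> norm (a + R x) + norm a" by (metis add.commute add_diff_cancel_left' norm_triangle_ineq4)
      finally show ?thesis using B[of "a + R x"] that by (simp add: S_def)
    qed
    then show ?thesis by (auto simp: bounded_iff)
  qed
  with \<open>closed S\<close> have S: "compact S" by (simp add: compact_eq_bounded_closed)
  have "measure lebesgue (prism u F) = measure lebesgue S"
    unfolding img measure_translation
    by (rule measure_orthogonal_image_finite[OF R lmeasurable_compact[OF S]])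
  also have "\<dots> = measure lborel S"
    using S by (simp add: measure_completion compact_imp_closed)
  also have "\<dots> = measure ?M ((\<lambda>c. \<Sum>i<n. c i *\<^sub>R \<beta> i) -` S \<inter> space ?M)"
    using \<open>closed S\<close> by (subst lborel_eq_distr_PiM_basis[OF \<beta>]) (simp add: measure_distr)
  also have "\<dots> = measure ?N {c \<in> {..<d} \<rightarrow>\<^sub>E UNIV. flat_chart d a b c \<in> F}"
  proof -
    define C where "C = (\<lambda>c. \<Sum>i<n. c i *\<^sub>R \<beta> i) -` S \<inter> space ?M"
    define B where "B = {c \<in> {..<d} \<rightarrow>\<^sub>E UNIV. flat_chart d a b c \<in> F}"
    have C: "C \<in> sets ?M"
      using \<open>closed S\<close> unfolding C_def by (intro measurable_sets[of _ _ borel]) auto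
    have "(\<lambda>c. flat_chart d a b c) \<in> ?N \<rightarrow>\<^sub>M borel"
      unfolding flat_chart_def by measurable
    moreover have "B = (\<lambda>c. flat_chart d a b c) -` F \<inter> space ?N"
      by (auto simp: B_def space_PiM)
    ultimately have B: "B \<in> sets ?N"
      using F(1) by (auto simp: borel_compact intro!: measurable_sets[of _ _ borel])
    have mem: "x(d := y) \<in> C \<longleftrightarrow> x \<in> B \<and> y \<in> {0..1}" if x: "x \<in> space ?N" for x y
    proof -
      have 1: "x(d := y) \<in> space ?M"
        using x by (auto simp: space_PiM PiE_def Pi_def n_def extensional_def)
      have "a + R (\<Sum>i<n. (x(d := y)) i *\<^sub>R \<beta> i) = flat_chart d a b x + y *\<^sub>R u"
      proof -
        have "R (\<Sum>i<n. (x(d := y)) i *\<^sub>R \<beta> i) = (\<Sum>i<n. (x(d := y)) i *\<^sub>R b' i)"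
          unfolding R_def by (intro sum.cong) (auto simp: inner_sum_enumerated_Basis[OF \<beta>])
        also have "\<dots> = (\<Sum>i<d. x i *\<^sub>R b i) + y *\<^sub>R u"
          by (simp add: n_def b'_def)
        finally show ?thesis by (simp add: flat_chart_def add.assoc)
      qed
      then have "x(d := y) \<in> C \<longleftrightarrow> flat_chart d a b x + y *\<^sub>R u \<in> prism u F"
        using 1 by (simp add: C_def S_def)
      also have "\<dots> \<longleftrightarrow> flat_chart d a b x \<in> F \<and> y \<in> {0..1}"
      proof
        assume "flat_chart d a b x + y *\<^sub>R u \<in> prism u F"
        then obtain z t where z: "z \<in> F" "0 \<le> t" "t \<le> 1" "flat_chart d a b x + y *\<^sub>R u = z + t *\<^sub>R u"
          unfolding prism_iff by blast
        have uc: "u \<bullet> flat_chart d a b c = u \<bullet> a" for c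
          using u(2) by (simp add: flat_chart_def inner_add_right inner_sum_right)
        then have "u \<bullet> z = u \<bullet> a" using z(1) F(2) by auto
        moreover have "u \<bullet> (flat_chart d a b x + y *\<^sub>R u) = u \<bullet> (z + t *\<^sub>R u)" using z(4) by simp
        ultimately have "y = t" using u(1) uc by (simp add: inner_add_right dot_square_norm)
        with z show "flat_chart d a b x \<in> F \<and> y \<in> {0..1}" by simp
      qed (auto simp: prism_iff)
      also have "\<dots> \<longleftrightarrow> x \<in> B \<and> y \<in> {0..1}"
        using x by (auto simp: B_def space_PiM)
      finally show ?thesis .
    qed
    have "emeasure ?M C = (\<integral>\<^sup>+ c. indicator C c \<partial>?M)" using C by simp
    also have "\<dots> = (\<integral>\<^sup>+ x. (\<integral>\<^sup>+ y. indicator C (x(d := y)) \<partial>lborel) \<partial>?N)"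
      using C product_nn_integral_insert[of "{..<d}" d "indicator C"] 
      by (simp add: n_def lessThan_Suc)
    also have "\<dots> = (\<integral>\<^sup>+ x. (\<integral>\<^sup>+ y. indicator B x * indicator {0..1::real} y \<partial>lborel) \<partial>?N)"
      by (intro nn_integral_cong) (auto simp: mem indicator_def)
    also have "\<dots> = (\<integral>\<^sup>+ x. indicator B x \<partial>?N)"
      by (intro nn_integral_cong) (simp add: nn_integral_cmult)
    also have "\<dots> = emeasure ?N B" using B by simp
    finally show ?thesis by (simp add: measure_def C_def B_def)
  qed
  finally show ?thesis by simp
qed

lemma aff_dim_range_flat_chart_le: "aff_dim (range (flat_chart d a b)) \<le> int d"
proof -
  have "range (flat_chart d a b) \<subseteq> (+) a ` span (b ` {..<d})"
    unfolding flat_chart_def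
    by (force intro: imageI[of _ _ "(+) a"] span_sum span_scale span_base)
  then have "aff_dim (range (flat_chart d a b)) \<le> aff_dim ((+) a ` span (b ` {..<d}))"
    by (rule aff_dim_subset)
  also have "\<dots> = int (dim (b ` {..<d}))"
    by (simp add: aff_dim_translation_eq aff_dim_subspace)
  also have "\<dots> \<le> int d"
    using dim_le_card'[of "b ` {..<d}"] card_image_le[of "{..<d}" b] by simp
  finally show ?thesis .
qed

lemma affine_range_flat_chart: "affine (range (flat_chart d a b))"
  unfolding affine_def
proof (intro ballI allI impI)
  fix x y and s t :: real
  assume xy: "x \<in> range (flat_chart d a b)" "y \<in> range (flat_chart d a b)" "s + t = 1"
  then obtain c c' where x: "x = flat_chart d a b c" "y = flat_chart d a b c'" by blast
  have "a = s *\<^sub>R a + t *\<^sub>R a" using xy(3) by (metis scaleR_add_left scaleR_one)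
  then have "s *\<^sub>R x + t *\<^sub>R y = flat_chart d a b (\<lambda>i. s * c i + t * c' i)"
    by (simp add: x flat_chart_def scaleR_sum_right sum.distrib scaleR_left_distrib scaleR_right_distrib)
  then show "s *\<^sub>R x + t *\<^sub>R y \<in> range (flat_chart d a b)" by blast
qed

lemma hyperplane_has_chart:
  fixes u :: "'a::euclidean_space"
  assumes u: "norm u = 1"
  obtains a b where "orthonormal_family (DIM('a) - 1) b"
    "{x. u \<bullet> x = h} \<subseteq> range (flat_chart (DIM('a) - 1) a b)"
proof -
  have "u \<noteq> 0" using u by auto
  obtain B where B: "B \<subseteq> {x. u \<bullet> x = 0}" "pairwise orthogonal B" "\<And>x. x \<in> B \<Longrightarrow> norm x = 1"
    "independent B" "card B = dim {x. u \<bullet> x = 0}" "span B = {x. u \<bullet> x = 0}"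
    using orthonormal_basis_subspace[OF subspace_hyperplane[of u]] by blast
  define d where "d = DIM('a) - 1"
  have card: "card B = d" using B(5) \<open>u \<noteq> 0\<close> by (simp add: dim_hyperplane d_def)
  have finB: "finite B" using B(4) independent_imp_finite by blast
  then obtain b where b: "bij_betw b {..<d} B"
    using ex_bij_betw_nat_finite[OF finB] card by (auto simp: atLeast0LessThan)
  have orth: "orthonormal_family d b"
    unfolding orthonormal_family_def
  proof (intro allI impI)
    fix i j assume ij: "i < d" "j < d"
    then have "b i \<in> B" "b j \<in> B" "b i = b j \<longleftrightarrow> i = j"
      using b by (auto simp: bij_betw_def inj_on_def)
    then show "b i \<bullet> b j = (if i = j then 1 else 0)"
      using B(2,3) by (auto simp: pairwise_def orthogonal_def dot_square_norm)
  qed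
  have "{x. u \<bullet> x = h} \<subseteq> range (flat_chart d (h *\<^sub>R u) b)"
  proof
    fix x assume x: "x \<in> {x. u \<bullet> x = h}"
    then have "u \<bullet> (x - h *\<^sub>R u) = 0" using u by (simp add: inner_diff_right dot_square_norm)
    then have "x - h *\<^sub>R u \<in> span B" using B(6) by blast
    then obtain t where "x - h *\<^sub>R u = (\<Sum>v\<in>B. t v *\<^sub>R v)"
      unfolding span_finite[OF finB] by blast
    also have "\<dots> = (\<Sum>i<d. t (b i) *\<^sub>R b i)"
      by (rule sum.reindex_bij_betw[OF b, symmetric])
    finally have "x = flat_chart d (h *\<^sub>R u) b (\<lambda>i. t (b i))"
      by (simp add: flat_chart_def algebra_simps)
    then show "x \<in> range (flat_chart d (h *\<^sub>R u) b)" by blast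
  qed
  with orth show ?thesis by (intro that) (auto simp: d_def)
qed

text \<open>A set of full dimension in a hyperplane spans it, so the chart picked by the definition of the
  volume, whichever it is, parametrizes that hyperplane and has directions orthogonal to \<open>u\<close>.\<close>

lemma flat_volume_eq_prism:
  fixes F :: "(real^'n) set"
  assumes F: "compact F" "F \<subseteq> {x. u \<bullet> x = h}" "aff_dim F = int CARD('n) - 1" and u: "norm u = 1"
  shows "flat_volume (CARD('n) - 1) F = measure lebesgue (prism u F)"
proof -
  let ?d = "CARD('n) - 1"
  let ?\<Phi> = "\<lambda>(a, b). orthonormal_family ?d b \<and> F \<subseteq> range (flat_chart ?d a (b :: nat \<Rightarrow> real^'n))"
  have "u \<noteq> 0" using u by auto
  obtain a0 and b0 :: "nat \<Rightarrow> real^'n" where "?\<Phi> (a0, b0)"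
  proof -
    obtain a0 b0 where "orthonormal_family ?d (b0 :: nat \<Rightarrow> real^'n)"
      "{x. u \<bullet> x = h} \<subseteq> range (flat_chart ?d a0 b0)"
      using hyperplane_has_chart[OF u, of h, simplified] by auto metis
    then show ?thesis using F(2) by (intro that[of a0 b0]) auto
  qed
  then have "?\<Phi> (Eps ?\<Phi>)" by (rule someI[of ?\<Phi>])
  then obtain a b where ab: "Eps ?\<Phi> = (a, b)" "orthonormal_family ?d b" "F \<subseteq> range (flat_chart ?d a b)"
    by (cases "Eps ?\<Phi>") auto
  have hull: "affine hull F = {x. u \<bullet> x = h}"
  proof (rule affine_dim_equal)
    show "affine hull F \<subseteq> {x. u \<bullet> x = h}"
      by (rule hull_minimal) (use F affine_hyperplane in auto)
    have "aff_dim F \<ge> 0" using F(3) by (simp add: Suc_leI)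
    then show "affine hull F \<noteq> {}" by auto
  qed (use F \<open>u \<noteq> 0\<close> in \<open>simp_all add: affine_hyperplane aff_dim_hyperplane\<close>)
  have "{x. u \<bullet> x = h} = range (flat_chart ?d a b)"
  proof (rule affine_dim_equal)
    show sub: "{x. u \<bullet> x = h} \<subseteq> range (flat_chart ?d a b)"
      unfolding hull[symmetric] using ab(3) affine_range_flat_chart by (rule hull_minimal)
    have "aff_dim (range (flat_chart ?d a b)) \<le> aff_dim {x. u \<bullet> x = h}"
      using aff_dim_range_flat_chart_le[of ?d a b] \<open>u \<noteq> 0\<close> by (simp add: aff_dim_hyperplane of_nat_diff Suc_leI)
    then show "aff_dim {x. u \<bullet> x = h} = aff_dim (range (flat_chart ?d a b))"
      using aff_dim_subset[OF sub] by simp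
    show "{x. u \<bullet> x = h} \<noteq> {}"
      using u by (auto simp: dot_square_norm intro!: exI[of _ "h *\<^sub>R u"])
  qed (simp_all add: affine_hyperplane affine_range_flat_chart)
  then have in_plane: "u \<bullet> flat_chart ?d a b c = h" for c by blast
  have "u \<bullet> b i = 0" if "i < ?d" for i
  proof -
    have "flat_chart ?d a b (\<lambda>j. if j = i then 1 else 0) = a + b i"
      using that by (simp add: flat_chart_def if_distrib[of "\<lambda>t. t *\<^sub>R _"] cong: if_cong)
    moreover have "flat_chart ?d a b (\<lambda>j. 0) = a" by (simp add: flat_chart_def)
    ultimately have "u \<bullet> (a + b i) = u \<bullet> a" using in_plane by metis
    then show ?thesis by (simp add: inner_add_right)
  qed
  then show ?thesis
    using measure_chart_eq_prism[OF F(1) ab(3) _ ab(2) u] ab(1)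
    by (simp add: flat_volume_def)
qed

text \<open>The prism lies in the affine hull of its base and one more point.\<close>

lemma negligible_prism_lowdim:
  fixes F :: "'a::euclidean_space set"
  assumes "aff_dim F < int DIM('a) - 1"
  shows "negligible (prism v F)"
proof (cases "F = {}")
  case False
  then obtain x0 where x0: "x0 \<in> F" by blast
  have "aff_dim (insert (x0 + v) F) < int DIM('a)"
    using assms by (simp add: aff_dim_insert)
  then obtain a b where ab: "a \<noteq> 0" "insert (x0 + v) F \<subseteq> {x. a \<bullet> x = b}"
    by (rule aff_lowdim_subset_hyperplane)
  then have "a \<bullet> v = 0" using x0 by (auto simp: inner_add_right)
  then have "prism v F \<subseteq> {x. a \<bullet> x = b}"
    using ab(2) by (auto simp: prism_iff inner_add_right subset_iff)
  then show ?thesis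
    using ab(1) negligible_hyperplane negligible_subset by blast
qed (simp add: prism_def)

section \<open>Point masses of the surface area measure\<close>

context
  fixes P :: "'a::euclidean_space set"
  assumes P: "P \<in> polytopes_o"
begin

lemma compact_polytopes_o: "compact P" using P by (simp add: polytopes_o_def polytope_imp_compact)

lemma support_face_subset_hyperplane: "support_face P u \<subseteq> {x. u \<bullet> x = support_function P u}"
  by (auto simp: support_face_def)

lemma compact_support_face: "compact (support_face P u)"
proof -
  have "support_face P u = P \<inter> {x. u \<bullet> x = support_function P u}" by (auto simp: support_face_def)
  then show ?thesis using compact_polytopes_o by (simp add: compact_Int_closed closed_hyperplane)
qed

lemma support_face_nonempty: "support_face P u \<noteq> {}"
proof -
  have "P \<noteq> {}" using P by (auto simp: polytopes_o_def)
  then obtain x where x: "x \<in> P" "\<And>y. y \<in> P \<Longrightarrow> u \<bullet> y \<le> u \<bullet> x"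
    using continuous_attains_sup[OF compact_polytopes_o _ continuous_on_inner[OF continuous_on_const continuous_on_id], of u]
    by auto
  then have "support_function P u \<le> u \<bullet> x"
    unfolding support_function_def using \<open>P \<noteq> {}\<close> by (intro cSUP_least)
  then have "u \<bullet> x = support_function P u" using le_support_function[OF P x(1), of u] by simp
  then show ?thesis using x(1) by (auto simp: support_face_def)
qed

lemma support_function_eqI:
  assumes "x \<in> P" "\<And>y. y \<in> P \<Longrightarrow> u \<bullet> y \<le> u \<bullet> x"
  shows "support_function P u = u \<bullet> x"
proof (rule antisym)
  show "support_function P u \<le> u \<bullet> x"
    unfolding support_function_def using assms by (intro cSUP_least) auto
qed (rule le_support_function[OF P assms(1)])

end

text \<open>The mass of the \<open>L\<^sub>p\<close> surface area measure at the direction \<open>u\<close>, written so that it makes sense and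
  vanishes when \<open>u\<close> is not the normal of a facet off the origin. Sums over facet normals can then be
  extended to any larger finite set of directions.\<close>

definition facet_weight :: "real \<Rightarrow> 'a::euclidean_space set \<Rightarrow> 'a \<Rightarrow> real" where
  "facet_weight p P u = (if support_function P u > 0
     then support_function P u powr (1 - p) * measure lebesgue (prism u (support_face P u)) else 0)"

lemma facet_weight_nonneg: "facet_weight p P u \<ge> 0"
  by (simp add: facet_weight_def)

lemma facet_weight_on_facet_normals:
  fixes P :: "(real^'n) set"
  assumes P: "P \<in> polytopes_o" and u: "u \<in> facet_normals_off_origin P"
  shows "facet_weight p P u =
    support_function P u powr (1 - p) * flat_volume (CARD('n) - 1) (support_face P u)"
  using u support_function_pos[OF P u]
    flat_volume_eq_prism[OF compact_support_face[OF P] support_face_subset_hyperplane[OF P]]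
  by (simp add: facet_weight_def facet_normals_off_origin_def)

text \<open>If the support value is positive, the face avoids the origin, so its dimension must be too small.\<close>

lemma facet_weight_off_facet_normals:
  fixes P :: "(real^'n) set"
  assumes P: "P \<in> polytopes_o" and u: "norm u = 1" "u \<notin> facet_normals_off_origin P"
  shows "facet_weight p P u = 0"
proof (cases "support_function P u > 0")
  case True
  then have "0 \<notin> support_face P u" by (auto simp: support_face_def)
  then have "aff_dim (support_face P u) \<noteq> int CARD('n) - 1"
    using u by (simp add: facet_normals_off_origin_def)
  moreover have "u \<noteq> 0" using u by auto
  then have "aff_dim (support_face P u) \<le> int CARD('n) - 1"
    using aff_dim_subset[OF support_face_subset_hyperplane[OF P, of u]] by (simp add: aff_dim_hyperplane)
  ultimately show ?thesis
    using negligible_prism_lowdim[of "support_face P u" u]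
    by (simp add: facet_weight_def negligible_imp_measure0)
qed (simp add: facet_weight_def)

lemma measure_Lp_surface_area_measure:
  fixes P :: "(real^'n) set"
  assumes P: "P \<in> polytopes_o" and A: "A \<in> sets sphere_borel"
    and U: "finite U" "facet_normals_off_origin P \<subseteq> U" "U \<subseteq> sphere 0 1"
  shows "measure (Lp_surface_area_measure p P) A = (\<Sum>u\<in>U \<inter> A. facet_weight p P u)"
proof -
  have "emeasure (Lp_surface_area_measure p P) A =
      (\<Sum>u\<in>facet_normals_off_origin P. ennreal (facet_weight p P u) * indicator A u)"
    unfolding emeasure_Lp_surface_area_measure[OF A]
    by (intro sum.cong refl) (simp add: facet_weight_on_facet_normals[OF P])
  also have "\<dots> = (\<Sum>u\<in>U. ennreal (facet_weight p P u) * indicator A u)"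
    using U facet_weight_off_facet_normals[OF P] by (intro sum.mono_neutral_left) auto
  also have "\<dots> = (\<Sum>u\<in>U \<inter> A. ennreal (facet_weight p P u))"
    using U(1) by (simp add: indicator_def sum.inter_restrict if_distrib cong: if_cong)
  also have "\<dots> = ennreal (\<Sum>u\<in>U \<inter> A. facet_weight p P u)"
    by (simp add: facet_weight_nonneg sum_ennreal)
  finally show ?thesis
    by (simp add: measure_def facet_weight_nonneg sum_nonneg)
qed

lemma facet_normals_subset_sphere: "facet_normals_off_origin P \<subseteq> sphere 0 1"
  by (auto simp: facet_normals_off_origin_def)

section \<open>The valuation property of the surface area measure\<close>

text \<open>Join a point \<open>y\<close> of the lower face to a point \<open>x\<close> of the higher one. The segment stays in the convex
  union, and beyond \<open>y\<close> it is too high for \<open>Q\<close>, so it runs in \<open>P\<close>; since \<open>P\<close> is closed, \<open>y\<close> belongs to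
  \<open>P\<close> as well. Thus the intersection contains the whole lower face.\<close>

lemma support_face_Un_Int_strict:
  assumes P: "P \<in> polytopes_o" and Q: "Q \<in> polytopes_o"
    and PQ: "P \<union> Q \<in> polytopes_o" "P \<inter> Q \<in> polytopes_o"
    and less: "support_function Q u < support_function P u"
  shows "support_function (P \<union> Q) u = support_function P u" "support_face (P \<union> Q) u = support_face P u"
    "support_function (P \<inter> Q) u = support_function Q u" "support_face (P \<inter> Q) u = support_face Q u"
proof -
  let ?h = "support_function"
  obtain x where x: "x \<in> P" "u \<bullet> x = ?h P u"
    using support_face_nonempty[OF P, of u] by (auto simp: support_face_def)
  have leP: "u \<bullet> y \<le> ?h P u" if "y \<in> P" for y using le_support_function[OF P that] .
  have leQ: "u \<bullet> y \<le> ?h Q u" if "y \<in> Q" for y using le_support_function[OF Q that] .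
  have hU: "?h (P \<union> Q) u = u \<bullet> x"
    using x leP leQ less by (intro support_function_eqI[OF PQ(1)]) force+
  then show "?h (P \<union> Q) u = ?h P u" using x by simp
  show "support_face (P \<union> Q) u = support_face P u"
    using hU x leQ less by (force simp: support_face_def)
  have QP: "y \<in> P" if y: "y \<in> support_face Q u" for y
  proof -
    have y': "y \<in> Q" "u \<bullet> y = ?h Q u" using y by (auto simp: support_face_def)
    \<comment> \<open>points of the segment from \<open>y\<close> to \<open>x\<close> that tend to \<open>y\<close>\<close>
    define z where "z k = (1 - inverse (real (Suc k))) *\<^sub>R y + inverse (real (Suc k)) *\<^sub>R x" for k
    have "z k \<in> P" for k
    proof -
      have k: "0 < inverse (real (Suc k))" "inverse (real (Suc k)) \<le> 1"
        by (simp_all add: inverse_le_1_iff)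
      have "convex (P \<union> Q)" using PQ(1) by (simp add: polytopes_o_def polytope_imp_convex)
      then have "z k \<in> P \<union> Q"
        unfolding z_def using k x y' by (intro convexD) auto
      moreover have "u \<bullet> z k > ?h Q u"
      proof -
        have "u \<bullet> z k = ?h Q u + inverse (real (Suc k)) * (?h P u - ?h Q u)"
          by (simp add: z_def inner_add_right x y' algebra_simps)
        moreover have "inverse (real (Suc k)) * (?h P u - ?h Q u) > 0" using k less by simp
        ultimately show ?thesis by simp
      qed
      ultimately show ?thesis using leQ[of "z k"] by force
    qed
    moreover have "z \<longlonglongrightarrow> (1 - 0) *\<^sub>R y + 0 *\<^sub>R x"
      unfolding z_def by (intro tendsto_intros LIMSEQ_inverse_real_of_nat)
    ultimately show ?thesis
      using closed_sequentially[of P z y] compact_polytopes_o[OF P] by (simp add: compact_imp_closed)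
  qed
  obtain y where y: "y \<in> support_face Q u" using support_face_nonempty[OF Q] by blast
  have hI: "?h (P \<inter> Q) u = u \<bullet> y"
    using y QP[OF y] leQ by (intro support_function_eqI[OF PQ(2)]) (auto simp: support_face_def)
  then show hI': "?h (P \<inter> Q) u = ?h Q u" using y by (simp add: support_face_def)
  show "support_face (P \<inter> Q) u = support_face Q u"
    using QP hI' by (auto simp: support_face_def)
qed

text \<open>The face of the union is convex, hence connected, and it is covered by the closed faces of \<open>P\<close> and
  \<open>Q\<close>. So these meet, and the intersection reaches the common support value.\<close>

lemma support_face_Un_Int_equal:
  fixes P Q :: "'a::euclidean_space set"
  assumes P: "P \<in> polytopes_o" and Q: "Q \<in> polytopes_o"
    and PQ: "P \<union> Q \<in> polytopes_o" "P \<inter> Q \<in> polytopes_o"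
    and eq: "support_function Q u = support_function P u"
  shows "support_function (P \<union> Q) u = support_function P u"
    "support_face (P \<union> Q) u = support_face P u \<union> support_face Q u"
    "support_function (P \<inter> Q) u = support_function P u"
    "support_face (P \<inter> Q) u = support_face P u \<inter> support_face Q u"
proof -
  let ?h = "support_function"
  obtain x where x: "x \<in> P" "u \<bullet> x = ?h P u"
    using support_face_nonempty[OF P, of u] by (auto simp: support_face_def)
  have leP: "u \<bullet> y \<le> ?h P u" if "y \<in> P" for y using le_support_function[OF P that] .
  have leQ: "u \<bullet> y \<le> ?h P u" if "y \<in> Q" for y using le_support_function[OF Q that, of u] eq by simp
  have hU: "?h (P \<union> Q) u = u \<bullet> x"
    using x leP leQ by (intro support_function_eqI[OF PQ(1)]) force+
  then show hU': "?h (P \<union> Q) u = ?h P u" using x by simp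
  show fU: "support_face (P \<union> Q) u = support_face P u \<union> support_face Q u"
    using hU' eq by (auto simp: support_face_def)
  have "convex (support_face (P \<union> Q) u)"
    using support_face_face_of[OF PQ(1)] face_of_imp_convex by blast
  then have con: "connected (support_face P u \<union> support_face Q u)"
    using fU convex_connected by metis
  have closed: "closed (support_face P u)" "closed (support_face Q u)"
    using compact_support_face P Q compact_imp_closed by blast+
  have disj: "\<not> connected (A \<union> B)" if "closed A" "closed B" "A \<noteq> {}" "B \<noteq> {}" "A \<inter> B = {}" for A B :: "'a set"
    unfolding connected_closed not_not by (intro exI[of _ A] exI[of _ B] conjI that) (use that in auto)
  have "support_face P u \<inter> support_face Q u \<noteq> {}"
    using disj[OF closed support_face_nonempty[OF P] support_face_nonempty[OF Q]] con by blast
  then obtain y where y: "y \<in> support_face P u" "y \<in> support_face Q u" by blast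
  have hI: "?h (P \<inter> Q) u = u \<bullet> y"
    using y leP eq by (intro support_function_eqI[OF PQ(2)]) (auto simp: support_face_def)
  then show hI': "?h (P \<inter> Q) u = ?h P u" using y by (simp add: support_face_def)
  show "support_face (P \<inter> Q) u = support_face P u \<inter> support_face Q u"
    using hI' eq by (auto simp: support_face_def)
qed

lemma facet_weight_Un_Int:
  assumes P: "P \<in> polytopes_o" and Q: "Q \<in> polytopes_o"
    and PQ: "P \<union> Q \<in> polytopes_o" "P \<inter> Q \<in> polytopes_o" and u: "u \<noteq> 0"
  shows "facet_weight p (P \<union> Q) u + facet_weight p (P \<inter> Q) u = facet_weight p P u + facet_weight p Q u"
proof -
  consider "support_function Q u < support_function P u" | "support_function P u < support_function Q u"
    | "support_function Q u = support_function P u" by linarith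
  then show ?thesis
  proof cases
    case 1
    then show ?thesis using support_face_Un_Int_strict[OF P Q PQ] by (simp add: facet_weight_def)
  next
    case 2
    then show ?thesis
      using support_face_Un_Int_strict[OF Q P] PQ by (simp add: facet_weight_def Un_commute Int_commute)
  next
    case 3
    have "measure lebesgue (prism u (support_face P u \<union> support_face Q u)) +
        measure lebesgue (prism u (support_face P u \<inter> support_face Q u)) =
        measure lebesgue (prism u (support_face P u)) + measure lebesgue (prism u (support_face Q u))"
      using support_face_subset_hyperplane[OF P, of u] support_face_subset_hyperplane[OF Q, of u] u 3
      by (intro measure_prism_Un_Int compact_support_face P Q) auto
    then show ?thesis
      using support_face_Un_Int_equal[OF P Q PQ 3] 3
      by (simp add: facet_weight_def distrib_left[symmetric])
  qed
qed

lemma measure_valuation_Lp_surface_area_measure: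
  "measure_valuation (Lp_surface_area_measure p :: (real^'n) set \<Rightarrow> _)"
  unfolding measure_valuation_def
proof (intro allI impI ballI, elim conjE)
  fix P Q A :: "(real^'n) set"
  assume P: "P \<in> polytopes_o" and Q: "Q \<in> polytopes_o" and PQ: "P \<union> Q \<in> polytopes_o" "P \<inter> Q \<in> polytopes_o"
    and A: "A \<in> sets sphere_borel"
  define U where "U = (\<Union>R\<in>{P, Q, P \<union> Q, P \<inter> Q}. facet_normals_off_origin R)"
  have U: "finite U" "U \<subseteq> sphere 0 1"
    unfolding U_def using P Q PQ facet_normals_subset_sphere by (auto intro: finite_facet_normals_off_origin)
  have eq: "measure (Lp_surface_area_measure p R) A = (\<Sum>u\<in>U \<inter> A. facet_weight p R u)"
    if "R \<in> {P, Q, P \<union> Q, P \<inter> Q}" for R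
    using that P Q PQ by (intro measure_Lp_surface_area_measure A U) (auto simp: U_def)
  show "measure (Lp_surface_area_measure p (P \<union> Q)) A + measure (Lp_surface_area_measure p (P \<inter> Q)) A =
    measure (Lp_surface_area_measure p P) A + measure (Lp_surface_area_measure p Q) A"
    unfolding eq[of P, simplified] eq[of Q, simplified] eq[of "P \<union> Q", simplified]
      eq[of "P \<inter> Q", simplified] sum.distrib[symmetric]
    using U(2) by (intro sum.cong refl facet_weight_Un_Int P Q PQ) auto
qed

section \<open>Integrals of finitely supported measures\<close>

lemma sphere_borel_subset: "A \<in> sets sphere_borel \<Longrightarrow> A \<subseteq> sphere 0 1"
  using sets.sets_into_space[of A "sphere_borel :: 'a::euclidean_space measure"] by simp

lemma sphere_measures_space: "M \<in> sphere_measures \<Longrightarrow> space M = sphere 0 1"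
  using sets_eq_imp_space_eq[of M sphere_borel] by (auto simp: sphere_measures_def)

lemma finite_in_sphere_borel:
  fixes U :: "'a::euclidean_space set"
  assumes "finite U" "U \<subseteq> sphere 0 1"
  shows "U \<in> sets sphere_borel"
proof -
  have "U = sphere 0 1 \<inter> U" using assms by auto
  moreover have "U \<in> sets borel" using assms by (simp add: borel_closed finite_imp_closed)
  ultimately show ?thesis unfolding sphere_borel_def sets_restrict_space by (metis image_eqI)
qed

lemma borel_measurable_sphere:
  fixes f :: "'a::euclidean_space \<Rightarrow> real"
  assumes "M \<in> sphere_measures" "continuous_on (- {0}) f"
  shows "f \<in> borel_measurable M"
proof -
  have "continuous_on (sphere 0 1) f" using assms(2) by (rule continuous_on_subset) auto
  then have "f \<in> borel_measurable (restrict_space borel (sphere 0 1))"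
    by (rule borel_measurable_continuous_on_restrict)
  then show ?thesis
    using assms(1) by (simp add: sphere_measures_def sphere_borel_def cong: measurable_cong_sets)
qed

lemma integral_finitely_supported:
  fixes f :: "'a::euclidean_space \<Rightarrow> real"
  assumes M: "M \<in> sphere_measures" and U: "finite U" "U \<subseteq> sphere 0 1"
    and w: "\<And>A. A \<in> sets sphere_borel \<Longrightarrow> measure M A = (\<Sum>u\<in>U \<inter> A. w u)"
    and f: "continuous_on (- {0}) f"
  shows "(LINT u|M. f u) = (\<Sum>u\<in>U. w u * f u)"
proof -
  interpret finite_measure M using M by (simp add: sphere_measures_def)
  have sets: "sets M = sets sphere_borel" using M by (simp add: sphere_measures_def)
  have single: "{u} \<in> sets M" if "u \<in> U" for u
    using U that by (auto simp: sets intro: finite_in_sphere_borel)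
  have "sphere 0 1 - U \<in> sets M"
    using sets.compl_sets[of U M] finite_in_sphere_borel[OF U] by (simp add: sets sphere_measures_space[OF M])
  moreover have "measure M (sphere 0 1 - U) = 0" using w[of "sphere 0 1 - U"] calculation sets by simp
  ultimately have "sphere 0 1 - U \<in> null_sets M"
    by (auto intro: null_setsI simp: emeasure_eq_measure)
  then have ae: "AE u in M. u \<in> U"
    by (rule AE_I') (auto simp: sphere_measures_space[OF M])
  have "(LINT u|M. f u) = (LINT u|M. (\<Sum>v\<in>U. f v * indicator {v} u))"
  proof (rule integral_cong_AE)
    show "f \<in> borel_measurable M" by (rule borel_measurable_sphere[OF M f])
    show "(\<lambda>u. \<Sum>v\<in>U. f v * indicator {v} u) \<in> borel_measurable M" using single by simp
    show "AE u in M. f u = (\<Sum>v\<in>U. f v * indicator {v} u)"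
      using ae
    proof eventually_elim
      case (elim u)
      have "(\<Sum>v\<in>U. f v * indicator {v} u) = (\<Sum>v\<in>U. if v = u then f v else 0)"
        by (intro sum.cong) (auto simp: indicator_def)
      then show ?case using elim U(1) by simp
    qed
  qed
  also have "\<dots> = (\<Sum>v\<in>U. f v * measure M {v})"
    using single by (subst Bochner_Integration.integral_sum) (auto simp: less_top[symmetric])
  also have "\<dots> = (\<Sum>v\<in>U. w v * f v)"
    using w single U by (intro sum.cong) (auto simp: sets)
  finally show ?thesis .
qed

lemma integral_Lp_surface_area_measure:
  fixes f :: "real^'n \<Rightarrow> real"
  assumes "P \<in> polytopes_o" "finite U" "facet_normals_off_origin P \<subseteq> U" "U \<subseteq> sphere 0 1"
    and "continuous_on (- {0}) f"
  shows "(LINT u|Lp_surface_area_measure p P. f u) = (\<Sum>u\<in>U. facet_weight p P u * f u)"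
  using assms
  by (intro integral_finitely_supported Lp_surface_area_measure_in_sphere_measures
      measure_Lp_surface_area_measure) auto

section \<open>Contravariance of the surface area measure\<close>

text \<open>After a rotation that takes a coordinate vector to \<open>u\<close>, only one column differs from the identity
  matrix, and Cramer's rule gives the determinant.\<close>

lemma det_id_plus_rank_one:
  fixes u w :: "real^'n"
  assumes u: "norm u = 1"
  shows "det (matrix (\<lambda>x. x + (u \<bullet> x) *\<^sub>R w)) = 1 + u \<bullet> w"
proof -
  define k :: 'n where "k = undefined"
  obtain R where R: "orthogonal_transformation R" and Rk: "R (axis k (1 :: real)) = u"
    using orthogonal_transformation_exists_1[OF norm_axis_1[of k] u] by blast
  define R' where "R' = inv R"
  have R': "orthogonal_transformation R'" unfolding R'_def using R by (rule orthogonal_transformation_inv)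
  have RR': "R (R' x) = x" for x
    unfolding R'_def using orthogonal_transformation_surj[OF R] by (rule surj_f_inv_f)
  have lin: "linear R" "linear R'" using R R' by (simp_all add: orthogonal_transformation_linear)
  have inner: "R x \<bullet> R y = x \<bullet> y" for x y using R by (simp add: orthogonal_transformation_def)
  define w' where "w' = R' w"
  define S where "S x = x + (x $ k) *\<^sub>R w'" for x
  have linS: "linear S" by (rule linearI) (simp_all add: S_def algebra_simps)
  have "matrix S = (\<chi> i j. if j = k then (mat 1 *v (axis k 1 + w')) $ i else mat 1 $ i $ j)"
    unfolding matrix_vector_mul_lid by (auto simp: S_def matrix_def vec_eq_iff axis_def mat_def)
  then have "det (matrix S) = (axis k 1 + w') $ k * det (mat 1 :: real^'n^'n)"
    by (simp only: cramer_lemma)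
  also have "\<dots> = 1 + w' \<bullet> axis k 1" by (simp add: inner_axis)
  also have "w' \<bullet> axis k 1 = w \<bullet> u"
    using inner[of w' "axis k 1"] by (simp add: w'_def RR' Rk)
  finally have detS: "det (matrix S) = 1 + u \<bullet> w" by (simp add: inner_commute)
  have "(\<lambda>x. x + (u \<bullet> x) *\<^sub>R w) = R \<circ> (S \<circ> R')"
  proof
    fix x
    have "R' x $ k = u \<bullet> x"
      using inner[of "R' x" "axis k 1"] by (simp add: RR' Rk inner_axis inner_commute)
    then show "x + (u \<bullet> x) *\<^sub>R w = (R \<circ> (S \<circ> R')) x"
      by (simp add: S_def w'_def linear_add[OF lin(1)] linear_cmul[OF lin(1)] RR')
  qed
  then have "det (matrix (\<lambda>x. x + (u \<bullet> x) *\<^sub>R w)) = det (matrix R) * (det (matrix S) * det (matrix R'))"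
    using lin linS by (simp add: matrix_compose linear_compose det_mul)
  moreover have "det (matrix R) * det (matrix R') = 1"
  proof -
    have id1: "matrix (id :: real^'n \<Rightarrow> _) = mat 1"
      by (simp add: matrix_def mat_def axis_def vec_eq_iff)
    have "R \<circ> R' = id" by (auto simp: RR')
    then have "matrix R ** matrix R' = mat 1" using matrix_compose[OF lin(2,1)] id1 by simp
    then show ?thesis by (metis det_I det_mul)
  qed
  ultimately show ?thesis using detS by (simp add: mult.left_commute)
qed

text \<open>The map that sends \<open>u\<close> to \<open>v\<close> and fixes the hyperplane orthogonal to \<open>u\<close> takes the straight prism to
  a translate of the slanted one; its determinant is \<open>u \<bullet> v\<close>.\<close>

lemma measure_prism_direction:
  fixes G :: "(real^'n) set"
  assumes G: "compact G" "G \<subseteq> {x. u \<bullet> x = h}" and u: "norm u = 1" and v: "u \<bullet> v > 0"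
  shows "measure lebesgue (prism v G) = (u \<bullet> v) * measure lebesgue (prism u G)"
proof -
  define L where "L x = x + (u \<bullet> x) *\<^sub>R (v - u)" for x
  have lin: "linear L" by (rule linearI) (simp_all add: L_def algebra_simps inner_add_right)
  have uu: "u \<bullet> u = 1" using u by (simp add: dot_square_norm)
  have det: "det (matrix L) = u \<bullet> v"
    unfolding L_def det_id_plus_rank_one[OF u] by (simp add: inner_diff_right uu)
  have L: "L (x + t *\<^sub>R u) = h *\<^sub>R (v - u) + (x + t *\<^sub>R v)" if "x \<in> G" for x t
    using that G(2) uu by (auto simp: L_def inner_add_right algebra_simps)
  have "L ` prism u G = (+) (h *\<^sub>R (v - u)) ` prism v G"
    unfolding prism_def image_image by (rule image_cong) (auto simp: L)
  then have "measure lebesgue (prism v G) = measure lebesgue (L ` prism u G)"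
    by (simp add: measure_translation)
  also have "\<dots> = (u \<bullet> v) * measure lebesgue (prism u G)"
    using measure_linear_image_finite[OF lin lmeasurable_compact[OF compact_prism[OF G(1)]], of u] det v
    by simp
  finally show ?thesis .
qed

lemma matrix_inv_mult:
  assumes "det (A :: real^'n^'n) \<noteq> 0"
  shows "matrix_inv A ** A = mat 1" "A ** matrix_inv A = mat 1"
  using assms someI_ex[of "\<lambda>A'. A ** A' = mat 1 \<and> A' ** A = mat 1"]
  by (auto simp: invertible_det_nz[symmetric] invertible_def matrix_inv_def)

lemma inner_contragredient:
  assumes "det (\<phi> :: real^'n^'n) \<noteq> 0"
  shows "(transpose (matrix_inv \<phi>) *v u) \<bullet> (\<phi> *v x) = u \<bullet> x"
  using matrix_inv_mult[OF assms]
  by (simp add: transpose_matrix_vector dot_lmul_matrix matrix_vector_mul_assoc)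

lemma transpose_contragredient:
  assumes "det (\<phi> :: real^'n^'n) \<noteq> 0"
  shows "transpose \<phi> *v (transpose (matrix_inv \<phi>) *v u) = u"
    "transpose (matrix_inv \<phi>) *v (transpose \<phi> *v u) = u"
  unfolding matrix_vector_mul_assoc matrix_transpose_mul[symmetric] matrix_inv_mult[OF assms]
  by (simp_all add: transpose_mat)

lemma contragredient_eqI:
  assumes "det (\<phi> :: real^'n^'n) \<noteq> 0" "transpose \<phi> *v w = u"
  shows "transpose (matrix_inv \<phi>) *v u = w"
  using transpose_contragredient(2)[OF assms(1), of w] assms(2) by simp

lemma polytopes_o_image:
  "P \<in> polytopes_o \<Longrightarrow> linear f \<Longrightarrow> f ` P \<in> polytopes_o"
  by (auto simp: polytopes_o_def polytope_linear_image linear_0 intro: image_eqI[of _ f 0])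

text \<open>The image of the prism over the face of \<open>P\<close> is a prism in direction \<open>\<phi> *v u\<close> over the face of the
  image. Straightening it contributes a factor \<open>norm w\<close>, and the support value, which is divided by
  \<open>norm w\<close>, contributes \<open>norm w powr (p - 1)\<close>.\<close>

lemma facet_weight_linear_image:
  fixes \<phi> :: "real^'n^'n"
  assumes P: "P \<in> polytopes_o" and \<phi>: "det \<phi> = 1" and u: "norm u = 1"
  defines "w \<equiv> transpose (matrix_inv \<phi>) *v u"
  shows "facet_weight p ((*v) \<phi> ` P) (w /\<^sub>R norm w) = norm w powr p * facet_weight p P u"
proof -
  have \<phi>0: "det \<phi> \<noteq> 0" using \<phi> by simp
  have \<phi>P: "(*v) \<phi> ` P \<in> polytopes_o" using P by (simp add: polytopes_o_image)
  have inner: "w \<bullet> (\<phi> *v x) = u \<bullet> x" for x unfolding w_def by (rule inner_contragredient[OF \<phi>0])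
  have "w \<noteq> 0" using inner[of u] u by auto
  then have nw: "norm w > 0" by simp
  let ?h = "support_function P u" and ?F = "support_face P u" and ?u = "w /\<^sub>R norm w"
  obtain x where x: "x \<in> P" "u \<bullet> x = ?h" using support_face_nonempty[OF P, of u] by (auto simp: support_face_def)
  have inner': "?u \<bullet> (\<phi> *v y) = (u \<bullet> y) / norm w" for y by (simp add: inner divide_inverse_commute)
  have h: "support_function ((*v) \<phi> ` P) ?u = ?h / norm w"
  proof -
    have "support_function ((*v) \<phi> ` P) ?u = ?u \<bullet> (\<phi> *v x)"
    proof (rule support_function_eqI[OF \<phi>P])
      fix y assume "y \<in> (*v) \<phi> ` P"
      then obtain z where z: "z \<in> P" "y = \<phi> *v z" by blast
      show "?u \<bullet> y \<le> ?u \<bullet> (\<phi> *v x)"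
        using le_support_function[OF P z(1), of u] nw unfolding z(2) inner' x(2) by (simp add: divide_right_mono)
    qed (use x in blast)
    also have "\<dots> = ?h / norm w" unfolding inner' x(2) ..
    finally show ?thesis .
  qed
  have F: "support_face ((*v) \<phi> ` P) ?u = (*v) \<phi> ` ?F"
    using nw unfolding support_face_def h by (auto simp: inner field_simps)
  have u0: "norm ?u = 1" using nw by simp
  have a: "?u \<bullet> (\<phi> *v u) = 1 / norm w" using u by (simp add: inner' dot_square_norm del: inner_scaleR_left)
  have "(*v) \<phi> ` prism u ?F = prism (\<phi> *v u) ((*v) \<phi> ` ?F)"
    unfolding prism_def image_image
    by (auto simp: image_iff matrix_vector_right_distrib scaleR_matrix_vector_assoc
       matrix_vector_mult_scaleR intro!: bexI)
  then have "measure lebesgue (prism u ?F) = measure lebesgue (prism (\<phi> *v u) ((*v) \<phi> ` ?F))"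
    using measure_linear_image_finite[OF matrix_vector_mul_linear lmeasurable_compact[OF compact_prism[OF compact_support_face[OF P]]], of \<phi> u u] \<phi>
    by simp
  also have "\<dots> = (1 / norm w) * measure lebesgue (prism ?u ((*v) \<phi> ` ?F))"
    unfolding a[symmetric]
  proof (rule measure_prism_direction[OF _ _ u0])
    show "compact ((*v) \<phi> ` ?F)" unfolding F[symmetric] by (rule compact_support_face[OF \<phi>P])
    show "(*v) \<phi> ` ?F \<subseteq> {x. ?u \<bullet> x = ?h / norm w}"
      unfolding F[symmetric] h[symmetric] by (rule support_face_subset_hyperplane[OF \<phi>P])
    show "0 < ?u \<bullet> (\<phi> *v u)" unfolding a using nw by simp
  qed
  finally have V: "measure lebesgue (prism ?u ((*v) \<phi> ` ?F)) = norm w * measure lebesgue (prism u ?F)"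
    using nw by (simp add: field_simps)
  show ?thesis
  proof (cases "?h > 0")
    case True
    have "(?h / norm w) powr (1 - p) * norm w = norm w powr p * ?h powr (1 - p)"
    proof -
      have "(?h / norm w) powr (1 - p) = ?h powr (1 - p) * norm w powr (p - 1)"
        using True nw by (simp add: powr_divide powr_diff field_simps)
      moreover have "norm w powr (p - 1) * norm w = norm w powr p"
        using nw by (simp add: powr_diff)
      ultimately show ?thesis by (simp add: mult.assoc)
    qed
    then show ?thesis using True nw V by (simp add: facet_weight_def h F mult.assoc[symmetric])
  next
    case False
    then show ?thesis using nw by (simp add: facet_weight_def h zero_less_divide_iff)
  qed
qed

lemma contragredient_nonzero:
  assumes "det (\<phi> :: real^'n^'n) \<noteq> 0" "u \<noteq> 0"
  shows "transpose (matrix_inv \<phi>) *v u \<noteq> 0"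
  using transpose_contragredient(1)[OF assms(1), of u] assms(2) by auto

lemma continuous_on_comp_contragredient:
  fixes f :: "real^'n \<Rightarrow> real"
  assumes f: "continuous_on (- {0}) f" and \<phi>: "det \<phi> \<noteq> 0"
  shows "continuous_on (- {0}) (\<lambda>u. f (transpose (matrix_inv \<phi>) *v u))"
proof -
  let ?T = "\<lambda>u. transpose (matrix_inv \<phi>) *v u"
  have "continuous_on (- {0}) ?T" by (intro linear_continuous_on matrix_vector_mul_bounded_linear)
  moreover have "?T ` (- {0}) \<subseteq> - {0}"
  proof (rule image_subsetI)
    fix u :: "real^'n" assume "u \<in> - {0}"
    then have "?T u \<noteq> 0" by (intro contragredient_nonzero[OF \<phi>]) simp
    then show "?T u \<in> - {0}" unfolding Compl_iff singleton_iff .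
  qed
  ultimately show ?thesis by (rule continuous_on_compose2[OF f])
qed

text \<open>The normalized contragredient map \<open>\<theta>\<close> permutes the sphere and matches the facet normals of \<open>P\<close>
  with those of its image.\<close>

lemma SL_contravariant_Lp_surface_area_measure:
  "SL_contravariant p (Lp_surface_area_measure p :: (real^'n) set \<Rightarrow> _)"
  unfolding SL_contravariant_def
proof (intro allI impI ballI, elim conjE)
  fix \<phi> :: "real^'n^'n" and P :: "(real^'n) set" and f :: "real^'n \<Rightarrow> real"
  assume \<phi>: "det \<phi> = 1" and P: "P \<in> polytopes_o" and f: "continuous_on (- {0}) f"
    and hom: "\<forall>t>0. \<forall>x. x \<noteq> 0 \<longrightarrow> f (t *\<^sub>R x) = t powr p * f x"
  have \<phi>0: "det \<phi> \<noteq> 0" using \<phi> by simp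
  have \<phi>P: "(*v) \<phi> ` P \<in> polytopes_o" using P by (simp add: polytopes_o_image)
  let ?T = "\<lambda>u. transpose (matrix_inv \<phi>) *v u"
  have T0: "?T u \<noteq> 0" if "u \<noteq> 0" for u
    by (rule contragredient_nonzero[OF \<phi>0 that])
  define \<theta> where "\<theta> u = ?T u /\<^sub>R norm (?T u)" for u
  have unique: "u = (transpose \<phi> *v \<theta> u) /\<^sub>R norm (transpose \<phi> *v \<theta> u)" if "norm u = 1" for u
  proof -
    have "u \<noteq> 0" using that by auto
    then have "?T u \<noteq> 0" by (rule T0)
    moreover have "transpose \<phi> *v \<theta> u = u /\<^sub>R norm (?T u)"
      by (simp add: \<theta>_def matrix_vector_mult_scaleR transpose_contragredient[OF \<phi>0]
          del: transpose_matrix_vector)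
    ultimately show ?thesis using that by simp
  qed
  have inj: "inj_on \<theta> (sphere 0 1)"
    by (rule inj_onI) (metis unique mem_sphere_0)
  have surj: "\<exists>u\<in>sphere 0 1. \<theta> u = w" if "w \<in> sphere 0 1" for w
  proof
    let ?v = "transpose \<phi> *v w"
    have "?v \<noteq> 0" using that transpose_contragredient(2)[OF \<phi>0, of w] by auto
    then show "?v /\<^sub>R norm ?v \<in> sphere 0 1" by simp
    show "\<theta> (?v /\<^sub>R norm ?v) = w"
      using that \<open>?v \<noteq> 0\<close> by (simp add: \<theta>_def matrix_vector_mult_scaleR transpose_contragredient[OF \<phi>0]
          del: transpose_matrix_vector)
  qed
  define U where "U = facet_normals_off_origin P \<union> (\<theta> -` facet_normals_off_origin ((*v) \<phi> ` P) \<inter> sphere 0 1)"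
  have U: "finite U" "facet_normals_off_origin P \<subseteq> U" "U \<subseteq> sphere 0 1"
    unfolding U_def using finite_facet_normals_off_origin[OF P] finite_facet_normals_off_origin[OF \<phi>P] inj
      facet_normals_subset_sphere by (auto intro!: finite_vimage_IntI)
  have U': "finite (\<theta> ` U)" "facet_normals_off_origin ((*v) \<phi> ` P) \<subseteq> \<theta> ` U" "\<theta> ` U \<subseteq> sphere 0 1"
  proof -
    show "facet_normals_off_origin ((*v) \<phi> ` P) \<subseteq> \<theta> ` U"
    proof
      fix w assume w: "w \<in> facet_normals_off_origin ((*v) \<phi> ` P)"
      then obtain u where "u \<in> sphere 0 1" "\<theta> u = w" using surj facet_normals_subset_sphere by blast
      then show "w \<in> \<theta> ` U" using w by (auto simp: U_def)
    qed
    have "norm (\<theta> u) = 1" if "u \<in> sphere 0 1" for u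
    proof -
      have "u \<noteq> 0" using that by auto
      then have "?T u \<noteq> 0" by (rule T0)
      then show ?thesis by (simp add: \<theta>_def)
    qed
    then show "\<theta> ` U \<subseteq> sphere 0 1" using U(3) by auto
  qed (simp add: U)
  have cT: "continuous_on (- {0}) (\<lambda>u. f (?T u))"
    by (rule continuous_on_comp_contragredient[OF f \<phi>0])
  have "(LINT u|Lp_surface_area_measure p ((*v) \<phi> ` P). f u) =
      (\<Sum>w\<in>\<theta> ` U. facet_weight p ((*v) \<phi> ` P) w * f w)"
    by (rule integral_Lp_surface_area_measure[OF \<phi>P U' f])
  also have "\<dots> = (\<Sum>u\<in>U. facet_weight p ((*v) \<phi> ` P) (\<theta> u) * f (\<theta> u))"
    using inj_on_subset[OF inj U(3)] by (simp add: sum.reindex)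
  also have "\<dots> = (\<Sum>u\<in>U. facet_weight p P u * f (?T u))"
  proof (rule sum.cong)
    fix u assume "u \<in> U"
    then have u: "norm u = 1" using U(3) by auto
    then have "u \<noteq> 0" by auto
    then have T: "?T u \<noteq> 0" by (rule T0)
    have \<theta>: "norm (?T u) *\<^sub>R \<theta> u = ?T u" "\<theta> u \<noteq> 0" using T unfolding \<theta>_def by (simp_all del: transpose_matrix_vector)
    have "f (?T u) = f (norm (?T u) *\<^sub>R \<theta> u)" unfolding \<theta>(1) ..
    also have "\<dots> = norm (?T u) powr p * f (\<theta> u)"
      using hom[rule_format, of "norm (?T u)" "\<theta> u"] T \<theta>(2) by (simp del: transpose_matrix_vector)
    finally show "facet_weight p ((*v) \<phi> ` P) (\<theta> u) * f (\<theta> u) = facet_weight p P u * f (?T u)"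
      using facet_weight_linear_image[OF P \<phi> u, of p] unfolding \<theta>_def[symmetric] by simp
  qed simp
  also have "\<dots> = (LINT u|Lp_surface_area_measure p P. f (?T u))"
    by (rule integral_Lp_surface_area_measure[OF P U cT, symmetric])
  finally show "(LINT u|Lp_surface_area_measure p ((*v) \<phi> ` P). f u) = (LINT u|Lp_surface_area_measure p P. f (?T u))" .
qed

lemma polytopes_o_uminus: "P \<in> polytopes_o \<Longrightarrow> uminus ` P \<in> polytopes_o"
  by (rule polytopes_o_image) (auto simp: linear_iff)

lemma measure_valuation_reflected:
  assumes "measure_valuation \<mu>" shows "measure_valuation (\<lambda>P. \<mu> (uminus ` P))"
  unfolding measure_valuation_def
proof (intro allI impI ballI, elim conjE)
  fix P Q A :: "'a set"
  assume P: "P \<in> polytopes_o" and Q: "Q \<in> polytopes_o" and PQ: "P \<union> Q \<in> polytopes_o" "P \<inter> Q \<in> polytopes_o"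
    and A: "A \<in> sets sphere_borel"
  have eq: "uminus ` (P \<union> Q) = uminus ` P \<union> uminus ` Q" "uminus ` (P \<inter> Q) = uminus ` P \<inter> uminus ` Q"
    by auto
  show "measure (\<mu> (uminus ` (P \<union> Q))) A + measure (\<mu> (uminus ` (P \<inter> Q))) A =
      measure (\<mu> (uminus ` P)) A + measure (\<mu> (uminus ` Q)) A"
    using assms A polytopes_o_uminus[OF P] polytopes_o_uminus[OF Q]
      polytopes_o_uminus[OF PQ(1)] polytopes_o_uminus[OF PQ(2)]
    unfolding measure_valuation_def eq by blast
qed

lemma SL_contravariant_reflected:
  fixes \<mu> :: "(real^'n) set \<Rightarrow> (real^'n) measure"
  assumes "SL_contravariant p \<mu>" shows "SL_contravariant p (\<lambda>P. \<mu> (uminus ` P))"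
proof -
  have "uminus ` (*v) \<phi> ` P = (*v) \<phi> ` uminus ` P" for \<phi> :: "real^'n^'n" and P :: "(real^'n) set"
    by (simp add: image_image linear_neg[OF matrix_vector_mul_linear])
  then show ?thesis
    using assms unfolding SL_contravariant_def by (simp add: polytopes_o_uminus)
qed

lemma facet_weight_reflected:
  fixes P :: "(real^'n) set"
  assumes P: "P \<in> polytopes_o"
  shows "facet_weight p (uminus ` P) u = facet_weight p P (- u)"
proof -
  have h: "support_function (uminus ` P) u = support_function P (- u)"
    by (simp add: support_function_def image_image)
  have F: "support_face (uminus ` P) u = uminus ` support_face P (- u)"
    unfolding support_face_def h by auto
  have "prism u (uminus ` S) = uminus ` prism (- u) S" for S :: "(real^'n) set"
    unfolding prism_def by (force simp: image_iff)
  moreover have "orthogonal_transformation (uminus :: real^'n \<Rightarrow> _)"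
    by (simp add: orthogonal_transformation_def linear_iff)
  ultimately have "measure lebesgue (prism u (support_face (uminus ` P) u)) =
      measure lebesgue (prism (- u) (support_face P (- u)))"
    unfolding F using measure_orthogonal_image_finite lmeasurable_compact[OF compact_prism[OF compact_support_face[OF P]]]
    by metis
  then show ?thesis by (simp add: facet_weight_def h)
qed

section \<open>Additive functions and sums of measures\<close>

text \<open>Nonnegativity makes the additive function monotone, and comparing \<open>n * x\<close> with its integer part
  gives an error of at most \<open>f 1 / n\<close>. The equation is stated in the form in which cutting an edge
  produces it.\<close>

lemma additive_nonneg_imp_linear:
  fixes f :: "real \<Rightarrow> real"
  assumes nonneg: "\<And>x. x > 0 \<Longrightarrow> f x \<ge> 0"
    and add: "\<And>x l. x > 0 \<Longrightarrow> 0 < l \<Longrightarrow> l < 1 \<Longrightarrow> f x = f ((1 - l) * x) + f (l * x)"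
    and x: "x > 0"
  shows "f x = x * f 1"
proof -
  have add': "f (x + y) = f x + f y" if "x > 0" "y > 0" for x y
  proof -
    have "f (x + y) = f ((1 - y / (x + y)) * (x + y)) + f (y / (x + y) * (x + y))"
      using that by (intro add) (auto simp: field_simps)
    moreover have "(1 - y / (x + y)) * (x + y) = x" "y / (x + y) * (x + y) = y"
      using that by (auto simp: field_simps)
    ultimately show ?thesis by simp
  qed
  have mult: "f (real (Suc n) * y) = real (Suc n) * f y" if "y > 0" for n y
  proof (induction n)
    case (Suc n)
    have "f (real (Suc (Suc n)) * y) = f (real (Suc n) * y + y)" by (simp add: algebra_simps)
    also have "\<dots> = f (real (Suc n) * y) + f y" using that by (intro add') auto
    finally show ?case using Suc by (simp add: algebra_simps)
  qed simp
  have mono: "f y \<le> f z" if "0 < y" "y \<le> z" for y z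
  proof (cases "y = z")
    case False
    then have "f z = f y + f (z - y)" using add'[of y "z - y"] that by simp
    then show ?thesis using nonneg[of "z - y"] that False by simp
  qed simp
  have bound: "\<bar>f x - x * f 1\<bar> \<le> f 1 / real (Suc n)" if n: "real (Suc n) * x \<ge> 1" for n
  proof -
    define m where "m = nat \<lfloor>real (Suc n) * x\<rfloor>"
    have "\<lfloor>real (Suc n) * x\<rfloor> \<ge> 1" using n by simp
    then have m: "m \<ge> 1" "real m \<le> real (Suc n) * x" "real (Suc n) * x \<le> real (Suc m)"
      unfolding m_def by (simp add: nat_le_iff le_nat_iff, linarith+)
    obtain m' where m': "m = Suc m'" using m(1) by (cases m) auto
    have "f (real m) \<le> f (real (Suc n) * x)" using m by (intro mono) auto
    moreover have "f (real (Suc n) * x) \<le> f (real (Suc m))" using m x by (intro mono) auto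
    moreover have "f (real m) = real m * f 1" "f (real (Suc m)) = real (Suc m) * f 1"
      using mult[of 1 m'] mult[of 1 m] by (auto simp: m')
    moreover have "f (real (Suc n) * x) = real (Suc n) * f x" by (rule mult[OF x])
    moreover have f1: "f 1 \<ge> 0" by (rule nonneg) simp
    moreover have "real m * f 1 \<le> real (Suc n) * x * f 1" "real (Suc n) * x * f 1 \<le> real (Suc m) * f 1"
      using m f1 by (auto intro: mult_right_mono)
    ultimately have "\<bar>real (Suc n) * f x - real (Suc n) * x * f 1\<bar> \<le> f 1"
      by (simp add: algebra_simps abs_le_iff)
    moreover have "real (Suc n) * f x - real (Suc n) * x * f 1 = real (Suc n) * (f x - x * f 1)"
      by (simp add: algebra_simps)
    ultimately show ?thesis by (simp add: abs_mult pos_le_divide_eq mult.commute)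
  qed
  have "(\<lambda>n. f 1 / real (Suc n)) \<longlonglongrightarrow> 0"
    by (rule LIMSEQ_Suc) (rule lim_const_over_n)
  moreover have "eventually (\<lambda>n. real (Suc n) * x \<ge> 1) sequentially"
  proof -
    obtain N where "real N > 1 / x" using reals_Archimedean2 by blast
    then have N: "real N * x > 1" using x by (simp add: field_simps)
    have "real (Suc n) * x \<ge> 1" if "n \<ge> N" for n
    proof -
      have "real N * x \<le> real (Suc n) * x" using that x by (intro mult_right_mono) auto
      then show ?thesis using N by simp
    qed
    then show ?thesis by (auto simp: eventually_sequentially)
  qed
  then have "eventually (\<lambda>n. \<bar>f x - x * f 1\<bar> \<le> f 1 / real (Suc n)) sequentially"
    by eventually_elim (rule bound)
  ultimately have "\<bar>f x - x * f 1\<bar> \<le> 0"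
    by (rule tendsto_lowerbound) simp
  then show ?thesis by simp
qed

lemma nn_integral_sum_cong:
  fixes f :: "'a \<Rightarrow> ennreal"
  assumes sets: "sets M2 = sets M1" "sets M3 = sets M1" "sets M4 = sets M1"
    and eq: "\<And>A. A \<in> sets M1 \<Longrightarrow> emeasure M1 A + emeasure M2 A = emeasure M3 A + emeasure M4 A"
    and f: "f \<in> borel_measurable M1"
  shows "(\<integral>\<^sup>+ x. f x \<partial>M1) + (\<integral>\<^sup>+ x. f x \<partial>M2) = (\<integral>\<^sup>+ x. f x \<partial>M3) + (\<integral>\<^sup>+ x. f x \<partial>M4)"
  using f
proof (induction rule: borel_measurable_induct)
  have space: "space M2 = space M1" "space M3 = space M1" "space M4 = space M1"
    using sets by (auto dest: sets_eq_imp_space_eq)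
  have meas: "g \<in> borel_measurable M"
    if g: "g \<in> borel_measurable M1" and M: "M \<in> {M1, M2, M3, M4}" for g :: "'a \<Rightarrow> ennreal" and M
  proof -
    have "sets M = sets M1" using M sets by auto
    then have "borel_measurable M = (borel_measurable M1 :: ('a \<Rightarrow> ennreal) set)"
      by (rule measurable_cong_sets) simp
    then show ?thesis using g by simp
  qed
  let ?\<M> = "{M1, M2, M3, M4}"
  {
    case (cong f g)
    have "integral\<^sup>N M f = integral\<^sup>N M g" if "space M = space M1" for M
      using cong that by (intro nn_integral_cong) auto
    with cong space show ?case by simp
  next
    case (set A)
    then show ?case using eq sets by simp
  next
    case (mult u c)
    have "integral\<^sup>N M (\<lambda>x. c * u x) = c * integral\<^sup>N M u" if "M \<in> ?\<M>" for M
      by (rule nn_integral_cmult[OF meas[OF \<open>u \<in> borel_measurable M1\<close> that]])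
    from this[of M1] this[of M2] this[of M3] this[of M4] mult.IH
    show ?case by (simp only: insert_iff simp_thms distrib_left[symmetric])
  next
    case (add u v)
    have "integral\<^sup>N M (\<lambda>x. v x + u x) = integral\<^sup>N M v + integral\<^sup>N M u" if "M \<in> ?\<M>" for M
      by (rule nn_integral_add[OF meas[OF \<open>v \<in> borel_measurable M1\<close> that] meas[OF \<open>u \<in> borel_measurable M1\<close> that]])
    then have split: "integral\<^sup>N M (\<lambda>x. v x + u x) + integral\<^sup>N M' (\<lambda>x. v x + u x) =
        (integral\<^sup>N M v + integral\<^sup>N M' v) + (integral\<^sup>N M u + integral\<^sup>N M' u)"
      if "M \<in> ?\<M>" "M' \<in> ?\<M>" for M M'
      using that by (simp only: ac_simps)
    show ?case using split[of M1 M2] split[of M3 M4] add.IH by (simp only: insert_iff simp_thms)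
  next
    case (seq U)
    have inc: "incseq (\<lambda>i. integral\<^sup>N M (U i))" for M :: "'a measure"
      using \<open>incseq U\<close> by (intro incseq_SucI nn_integral_mono) (simp add: incseq_Suc_iff le_fun_def)
    have sup: "integral\<^sup>N M (SUP i. U i) + integral\<^sup>N M' (SUP i. U i) =
        (SUP i. integral\<^sup>N M (U i) + integral\<^sup>N M' (U i))" if "M \<in> ?\<M>" "M' \<in> ?\<M>" for M M'
    proof -
      have "integral\<^sup>N N (SUP i. U i) = (SUP i. integral\<^sup>N N (U i))" if "N \<in> ?\<M>" for N
        unfolding SUP_apply[abs_def]
        using meas[OF seq(1) that] by (intro nn_integral_monotone_convergence_SUP \<open>incseq U\<close>)
      then show ?thesis using that ennreal_SUP_add[OF inc inc, of M M'] by (simp only: )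
    qed
    show ?case using sup[of M1 M2] sup[of M3 M4] seq.IH by (simp only: insert_iff simp_thms)
  }
qed

section \<open>Standard simplices and edge cuts\<close>

text \<open>The simplex with vertices \<open>0\<close> and \<open>e\<^sub>i\<close> for \<open>i \<in> S\<close>; it is degenerate when \<open>S\<close> is not everything.\<close>

definition std_simplex :: "'n set \<Rightarrow> (real^'n) set" where
  "std_simplex S = {x. (\<forall>i. 0 \<le> x $ i) \<and> (\<forall>i. i \<notin> S \<longrightarrow> x $ i = 0) \<and> (\<Sum>i\<in>UNIV. x $ i) \<le> 1}"

lemma std_simplex_eq_hull:
  "std_simplex S = convex hull (insert 0 ((\<lambda>i. axis i 1) ` S) :: (real^'n) set)"
proof -
  have sub: "(\<lambda>i. axis i (1::real)) ` S \<subseteq> (Basis :: (real^'n) set)"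
    by (auto simp: Basis_vec_def)
  have inj: "inj_on (\<lambda>i::'n. axis i (1::real)) S" by (auto simp: inj_on_def axis_eq_axis)
  have "(\<Sum>b\<in>(\<lambda>i. axis i (1::real)) ` S. x \<bullet> b) = (\<Sum>i\<in>UNIV. x $ i)"
    if "\<forall>i. i \<notin> S \<longrightarrow> x $ i = 0" for x :: "real^'n"
    using that by (simp add: sum.reindex[OF inj] inner_axis) (rule sum.mono_neutral_left, auto)
  moreover have "(\<forall>b\<in>(Basis :: (real^'n) set). b \<notin> (\<lambda>i. axis i (1::real)) ` S \<longrightarrow> x \<bullet> b = 0) \<longleftrightarrow>
      (\<forall>i. i \<notin> S \<longrightarrow> x $ i = 0)" for x :: "real^'n"
    by (auto simp: Basis_vec_def inner_axis image_iff axis_eq_axis)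
  moreover have "(\<forall>b\<in>(Basis :: (real^'n) set). 0 \<le> x \<bullet> b) \<longleftrightarrow> (\<forall>i. 0 \<le> x $ i)" for x :: "real^'n"
    by (auto simp: Basis_vec_def inner_axis)
  ultimately show ?thesis
    unfolding substd_simplex[OF sub] std_simplex_def by auto
qed

lemma std_simplex_in_polytopes_o [simp]: "(std_simplex S :: (real^'n) set) \<in> polytopes_o"
  unfolding polytopes_o_def std_simplex_eq_hull
  by (auto simp: hull_inc intro!: polytope_convex_hull)

definition rank_one_update :: "real^'n \<Rightarrow> real^'n \<Rightarrow> real^'n^'n" where
  "rank_one_update u w = matrix (\<lambda>x. x + (u \<bullet> x) *\<^sub>R w)"

lemma rank_one_update_apply [simp]: "rank_one_update u w *v x = x + (u \<bullet> x) *\<^sub>R w"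
proof -
  have "linear (\<lambda>x. x + (u \<bullet> x) *\<^sub>R w)" by (rule linearI) (simp_all add: inner_add_right algebra_simps)
  then show ?thesis unfolding rank_one_update_def by (simp add: matrix_works)
qed

lemma det_rank_one_update: "norm u = 1 \<Longrightarrow> det (rank_one_update u w) = 1 + u \<bullet> w"
  unfolding rank_one_update_def by (rule det_id_plus_rank_one)

text \<open>Moves the vertex \<open>e\<^sub>j\<close> to the point \<open>l e\<^sub>i + (1 - l) e\<^sub>j\<close> of an edge and fixes the other vertices.\<close>

definition edge_split :: "'n \<Rightarrow> 'n \<Rightarrow> real \<Rightarrow> real^'n^'n" where
  "edge_split i j l = rank_one_update (axis j 1) (l *\<^sub>R (axis i 1 - axis j 1))"

lemma edge_split_apply: "edge_split i j l *v x = x + (l * x $ j) *\<^sub>R (axis i 1 - axis j 1)"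
  by (simp add: edge_split_def inner_axis' mult.commute)

lemma det_edge_split: "i \<noteq> j \<Longrightarrow> det (edge_split i j l) = 1 - l"
  unfolding edge_split_def
  by (subst det_rank_one_update) (simp_all add: inner_axis' inner_diff_right, simp_all add: axis_def)

lemma edge_split_nth:
  "i \<noteq> j \<Longrightarrow> (edge_split i j l *v x) $ m = x $ m + (if m = i then l * x $ j else if m = j then - l * x $ j else 0)"
  by (auto simp: edge_split_apply axis_def)

lemma sum_edge_split: "i \<noteq> j \<Longrightarrow> (\<Sum>m\<in>UNIV. (edge_split i j l *v x) $ m) = (\<Sum>m\<in>UNIV. x $ m)"
  by (simp add: edge_split_apply sum.distrib sum_distrib_left[symmetric] sum_subtractf axis_def)

lemma edge_split_std_simplex:
  fixes i j :: "'n::finite"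
  assumes ij: "i \<noteq> j" "i \<in> S" "j \<in> S" and l: "0 < l" "l < 1"
  shows "(*v) (edge_split i j l) ` std_simplex S = {y \<in> std_simplex S. l * y $ j \<le> (1 - l) * y $ i}"
proof
  show "(*v) (edge_split i j l) ` std_simplex S \<subseteq> {y \<in> std_simplex S. l * y $ j \<le> (1 - l) * y $ i}"
  proof clarify
    fix x assume x: "x \<in> std_simplex S"
    have nn: "0 \<le> x $ m" for m using x by (simp add: std_simplex_def)
    have "0 \<le> (edge_split i j l *v x) $ m" for m
    proof -
      have "l * x $ j \<le> 1 * x $ j" using nn l by (intro mult_right_mono) auto
      moreover have "0 \<le> l * x $ j" using nn l by simp
      ultimately show ?thesis using nn[of m] nn[of i] l ij by (simp add: edge_split_nth)
    qed
    moreover have "(edge_split i j l *v x) $ m = 0" if "m \<notin> S" for m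
      using that ij x by (auto simp: edge_split_nth std_simplex_def)
    moreover have "l * (edge_split i j l *v x) $ j \<le> (1 - l) * (edge_split i j l *v x) $ i"
      using nn[of i] l ij mult_right_mono[of l 1 "x $ i"] by (simp add: edge_split_nth algebra_simps)
    ultimately show "edge_split i j l *v x \<in> std_simplex S \<and>
        l * (edge_split i j l *v x) $ j \<le> (1 - l) * (edge_split i j l *v x) $ i"
      using x ij by (simp add: std_simplex_def sum_edge_split)
  qed
  show "{y \<in> std_simplex S. l * y $ j \<le> (1 - l) * y $ i} \<subseteq> (*v) (edge_split i j l) ` std_simplex S"
  proof clarify
    fix y assume y: "y \<in> std_simplex S" and le: "l * y $ j \<le> (1 - l) * y $ i"
    define x where "x = y - (l * y $ j / (1 - l)) *\<^sub>R (axis i 1 - axis j 1)"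
    have nn: "0 \<le> y $ m" for m using y by (simp add: std_simplex_def)
    have xm: "x $ m = y $ m - (if m = i then l * y $ j / (1 - l) else if m = j then - (l * y $ j / (1 - l)) else 0)" for m
      using ij by (auto simp: x_def axis_def)
    have xj: "x $ j = y $ j / (1 - l)" using ij l by (simp add: xm field_simps)
    have "edge_split i j l *v x = y" by (simp add: edge_split_apply xj) (simp add: x_def)
    moreover have "x \<in> std_simplex S"
    proof -
      have "0 \<le> x $ m" for m
        using nn[of m] nn[of j] l le by (auto simp: xm field_simps)
      moreover have "x $ m = 0" if "m \<notin> S" for m using that ij y by (auto simp: xm std_simplex_def)
      moreover have "(\<Sum>m\<in>UNIV. x $ m) = (\<Sum>m\<in>UNIV. y $ m)"
        using ij sum_edge_split[of i j l x] calculation(1) \<open>edge_split i j l *v x = y\<close> by simp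
      ultimately show ?thesis using y by (simp add: std_simplex_def)
    qed
    ultimately show "y \<in> (*v) (edge_split i j l) ` std_simplex S" by blast
  qed
qed

lemma edge_split_std_simplex_facet:
  fixes i j :: "'n::finite"
  assumes ij: "i \<noteq> j" "i \<in> S" "j \<in> S" and l: "0 < l" "l < 1"
  shows "(*v) (edge_split i j l) ` std_simplex (S - {i}) = {y \<in> std_simplex S. l * y $ j = (1 - l) * y $ i}"
proof -
  have "std_simplex (S - {i}) = {x \<in> std_simplex S. x $ i = 0}"
    using ij by (auto simp: std_simplex_def)
  moreover have "l * (edge_split i j l *v x) $ j = (1 - l) * (edge_split i j l *v x) $ i \<longleftrightarrow> x $ i = 0" for x
    using ij l by (auto simp: edge_split_nth algebra_simps)
  ultimately have "(*v) (edge_split i j l) ` std_simplex (S - {i}) =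
      {y \<in> (*v) (edge_split i j l) ` std_simplex S. l * y $ j = (1 - l) * y $ i}"
    by auto
  then show ?thesis using edge_split_std_simplex[OF assms] by auto
qed

text \<open>The hyperplane spanned by the dividing point of the edge and the vertices off that edge cuts the
  simplex into two linear images of itself, which share a degenerate simplex.\<close>

lemma std_simplex_edge_cut:
  fixes i j :: "'n::finite"
  assumes ij: "i \<noteq> j" "i \<in> S" "j \<in> S" and l: "0 < l" "l < 1"
  shows "std_simplex S = (*v) (edge_split i j l) ` std_simplex S \<union> (*v) (edge_split j i (1 - l)) ` std_simplex S"
    "(*v) (edge_split i j l) ` std_simplex S \<inter> (*v) (edge_split j i (1 - l)) ` std_simplex S =
      (*v) (edge_split i j l) ` std_simplex (S - {i})"
  using edge_split_std_simplex[OF assms] edge_split_std_simplex_facet[OF assms]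
    edge_split_std_simplex[of j i S "1 - l"] assms by auto

lemma image_matrix_mult: "(*v) (A ** B) ` P = (*v) A ` (*v) B ` P"
  by (simp add: image_image matrix_vector_mul_assoc)

lemma image_std_simplex_in_polytopes_o [simp]: "(*v) \<phi> ` std_simplex S \<in> polytopes_o"
  by (intro polytopes_o_image std_simplex_in_polytopes_o) simp

text \<open>A section of the determinant: every invertible map factors through a stretch and a map of
  determinant one.\<close>

definition coordinate_stretch :: "'n \<Rightarrow> real \<Rightarrow> real^'n^'n" where
  "coordinate_stretch k c = rank_one_update (axis k 1) ((c - 1) *\<^sub>R axis k 1)"

lemma det_coordinate_stretch [simp]: "det (coordinate_stretch k c) = c"
  unfolding coordinate_stretch_def by (subst det_rank_one_update) (simp_all add: inner_axis')

lemma coordinate_stretch_apply: "coordinate_stretch k c *v x = x + ((c - 1) * x $ k) *\<^sub>R axis k 1"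
  by (simp add: coordinate_stretch_def inner_axis' mult.commute)

lemma coordinate_stretch_inverse:
  "c \<noteq> 0 \<Longrightarrow> coordinate_stretch k (1 / c) *v (coordinate_stretch k c *v x) = x"
  unfolding coordinate_stretch_apply by (simp add: vec_eq_iff axis_def field_simps)

lemma coordinate_stretch_std_simplex:
  assumes "k \<notin> S"
  shows "(*v) (coordinate_stretch k c) ` std_simplex S = std_simplex S"
proof -
  have "coordinate_stretch k c *v x = x" if "x \<in> std_simplex S" for x
    using that assms unfolding coordinate_stretch_apply by (auto simp: std_simplex_def)
  then have "(*v) (coordinate_stretch k c) ` std_simplex S = (\<lambda>x. x) ` std_simplex S"
    by (rule image_cong[OF refl])
  then show ?thesis by (simp only: image_ident)
qed

section \<open>Moments of measures on the sphere\<close>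

text \<open>The integrand is continuous and \<open>p\<close>-homogeneous in \<open>u\<close>, and in contrast to \<open>\<bar>l \<bullet> u\<bar>\<^sup>p\<close> it tells \<open>u\<close>
  from \<open>- u\<close>.\<close>

definition pos_moment :: "real \<Rightarrow> (real^'n) measure \<Rightarrow> real^'n \<Rightarrow> real" where
  "pos_moment p M l = (LINT u|M. max 0 (l \<bullet> u) powr p)"

lemma continuous_on_pos_part_powr:
  fixes l :: "'a::euclidean_space"
  assumes "p > 0"
  shows "continuous_on S (\<lambda>u. max 0 (l \<bullet> u) powr p)"
  using assms by (intro continuous_on_powr' continuous_intros) auto

lemma integrable_pos_part_powr:
  fixes l :: "real^'n"
  assumes M: "M \<in> sphere_measures" and p: "p > 0"
  shows "integrable M (\<lambda>u. max 0 (l \<bullet> u) powr p)"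
proof -
  interpret finite_measure M using M by (simp add: sphere_measures_def)
  have "max 0 (l \<bullet> u) powr p \<le> norm l powr p" if "u \<in> space M" for u
  proof -
    have "norm u = 1" using that sphere_measures_space[OF M] by simp
    then have "max 0 (l \<bullet> u) \<le> norm l" using norm_cauchy_schwarz[of l u] by simp
    then show ?thesis using p by (intro powr_mono2) auto
  qed
  then show ?thesis
    using borel_measurable_sphere[OF M continuous_on_pos_part_powr[OF p]]
    by (intro integrable_const_bound[of _ "norm l powr p"]) auto
qed

lemma pos_moment_nonneg: "pos_moment p M l \<ge> 0"
  unfolding pos_moment_def by (intro integral_nonneg_AE) auto

lemma pos_moment_scaleR:
  assumes "c > 0"
  shows "pos_moment p M (c *\<^sub>R l) = c powr p * pos_moment p M l"
proof -
  have "max 0 ((c *\<^sub>R l) \<bullet> u) powr p = c powr p * max 0 (l \<bullet> u) powr p" for u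
  proof -
    have "max 0 ((c *\<^sub>R l) \<bullet> u) = c * max 0 (l \<bullet> u)"
      using assms by (auto simp: max_def zero_le_mult_iff not_le mult_le_0_iff)
    then show ?thesis using assms by (simp add: powr_mult)
  qed
  then show ?thesis by (simp add: pos_moment_def)
qed

text \<open>A sum is at most twice its larger summand, which gives the constant for every \<open>p > 0\<close>, whether or
  not the power function is convex.\<close>

lemma pos_moment_add_le:
  assumes M: "M \<in> sphere_measures" and p: "p > 0"
  shows "pos_moment p M (k + l) \<le> 2 powr p * (pos_moment p M k + pos_moment p M l)"
proof -
  have le: "max 0 ((k + l) \<bullet> u) powr p \<le> 2 powr p * (max 0 (k \<bullet> u) powr p + max 0 (l \<bullet> u) powr p)" for u
  proof -
    define m where "m = max (max 0 (k \<bullet> u)) (max 0 (l \<bullet> u))"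
    have "max 0 ((k + l) \<bullet> u) \<le> 2 * m" by (simp add: m_def inner_add_left)
    then have "max 0 ((k + l) \<bullet> u) powr p \<le> (2 * m) powr p" using p by (intro powr_mono2) auto
    also have "\<dots> = 2 powr p * m powr p" by (simp add: m_def powr_mult)
    also have "m powr p \<le> max 0 (k \<bullet> u) powr p + max 0 (l \<bullet> u) powr p"
    proof -
      have "max a b powr p \<le> a powr p + b powr p" for a b :: real by (simp add: max_def)
      then show ?thesis unfolding m_def .
    qed
    finally show ?thesis by simp
  qed
  have "pos_moment p M (k + l) \<le> (LINT u|M. 2 powr p * (max 0 (k \<bullet> u) powr p + max 0 (l \<bullet> u) powr p))"
    unfolding pos_moment_def using le integrable_pos_part_powr[OF M p]
    by (intro integral_mono integrable_mult_right integrable_add) auto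
  also have "\<dots> = 2 powr p * (pos_moment p M k + pos_moment p M l)"
    unfolding pos_moment_def using integrable_pos_part_powr[OF M p]
    by (simp add: integral_mult_right_zero)
  finally show ?thesis .
qed

lemma pos_moment_zero_imp_AE:
  assumes M: "M \<in> sphere_measures" and p: "p > 0" and 0: "pos_moment p M l = 0"
  shows "AE u in M. l \<bullet> u \<le> 0"
proof -
  have "AE u in M. max 0 (l \<bullet> u) powr p = 0"
    using 0 integral_nonneg_eq_0_iff_AE[OF integrable_pos_part_powr[OF M p]]
    by (simp add: pos_moment_def)
  then show ?thesis by eventually_elim (auto simp: max_def split: if_splits)
qed

lemma pos_moment_additive:
  assumes M: "M1 \<in> sphere_measures" "M2 \<in> sphere_measures" "M3 \<in> sphere_measures" "M4 \<in> sphere_measures"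
    and p: "p > 0"
    and eq: "\<And>A. A \<in> sets sphere_borel \<Longrightarrow> measure M1 A + measure M2 A = measure M3 A + measure M4 A"
  shows "pos_moment p M1 l + pos_moment p M2 l = pos_moment p M3 l + pos_moment p M4 l"
proof -
  have sets: "sets M = sets sphere_borel" and fin: "finite_measure M"
    if "M \<in> sphere_measures" for M :: "(real^'n) measure" using that by (auto simp: sphere_measures_def)
  have eq': "emeasure M1 A + emeasure M2 A = emeasure M3 A + emeasure M4 A" if "A \<in> sets M1" for A
    using eq[of A] that sets[OF M(1)] fin[OF M(1)] fin[OF M(2)] fin[OF M(3)] fin[OF M(4)]
    by (simp add: finite_measure.emeasure_eq_measure flip: ennreal_plus)
  let ?f = "\<lambda>u. max 0 (l \<bullet> u) powr p"
  have nn: "(\<integral>\<^sup>+ u. ennreal (?f u) \<partial>M) = ennreal (pos_moment p M l)" if "M \<in> sphere_measures" for M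
    unfolding pos_moment_def using integrable_pos_part_powr[OF that p] by (intro nn_integral_eq_integral) auto
  have "(\<lambda>u. ennreal (?f u)) \<in> borel_measurable M1"
    using borel_measurable_sphere[OF M(1) continuous_on_pos_part_powr[OF p]] by simp
  from nn_integral_sum_cong[OF _ _ _ eq' this] M
  have "ennreal (pos_moment p M1 l) + ennreal (pos_moment p M2 l) =
      ennreal (pos_moment p M3 l) + ennreal (pos_moment p M4 l)"
    by (simp add: nn sets)
  then show ?thesis
    by (simp add: pos_moment_nonneg ennreal_inj flip: ennreal_plus)
qed

text \<open>No unit vector has a nonpositive product with all \<open>e\<^sub>i\<close> and all \<open>- e\<^sub>i\<close>.\<close>

lemma sphere_measure_zero_iff_moments:
  assumes M: "M \<in> sphere_measures" and p: "p > 0"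
  shows "measure M (sphere 0 1) = 0 \<longleftrightarrow> (\<forall>i. pos_moment p M (axis i 1) = 0 \<and> pos_moment p M (- axis i 1) = 0)"
    (is "?L \<longleftrightarrow> ?R")
proof
  interpret finite_measure M using M by (simp add: sphere_measures_def)
  have space: "space M = sphere 0 1" by (rule sphere_measures_space[OF M])
  {
    assume ?L
    then have "emeasure M (space M) = 0" by (simp add: emeasure_eq_measure space)
    then have "AE u in M. False" by (intro AE_I[of _ _ "space M"]) auto
    then have "(LINT u|M. f u) = 0" for f :: "_ \<Rightarrow> real"
      by (intro integral_eq_zero_AE) (auto elim: eventually_mono)
    then show ?R by (simp add: pos_moment_def)
  next
    assume R: ?R
    have "AE u in M. \<forall>i\<in>UNIV. axis i 1 \<bullet> u \<le> 0 \<and> - axis i 1 \<bullet> u \<le> 0"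
      using R by (intro AE_finite_allI AE_conjI pos_moment_zero_imp_AE[OF M p]) simp_all
    then have "AE u in M. u = 0"
      by eventually_elim (auto simp: inner_axis' vec_eq_iff intro: antisym)
    moreover have "AE u in M. norm u = 1" using space by (intro AE_I2) simp
    ultimately have "AE u in M. False" by eventually_elim auto
    then have "emeasure M (space M) = 0" by (simp add: AE_iff_measurable[OF sets.top])
    then show ?L by (simp add: measure_def space)
  }
qed

lemma pos_moment_of_null:
  assumes M: "M \<in> sphere_measures" and "measure M (sphere 0 1) = 0"
  shows "pos_moment p M l = 0"
proof -
  interpret finite_measure M using M by (simp add: sphere_measures_def)
  have space: "space M = sphere 0 1" by (rule sphere_measures_space[OF M])
  have "emeasure M (space M) = 0" using assms(2) by (simp add: emeasure_eq_measure space)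
  then have "AE u in M. False" by (intro AE_I[of _ _ "space M"]) auto
  then show ?thesis
    unfolding pos_moment_def by (intro integral_eq_zero_AE) (auto elim: eventually_mono)
qed

section \<open>Degenerate simplices\<close>

lemma unit_vector_neq_minus: "norm u = 1 \<Longrightarrow> u \<noteq> - u" for u :: "'a::real_normed_vector"
proof
  assume "norm u = 1" "u = - u"
  then have "2 *\<^sub>R u = 0" by (metis scaleR_2 add.right_inverse)
  then show False using \<open>norm u = 1\<close> by auto
qed

lemma powr_mult_bounded_imp_zero:
  fixes a C p :: real
  assumes p: "p > 0" and a: "a \<ge> 0" and bound: "\<And>t. t > 0 \<Longrightarrow> t powr p * a \<le> C"
  shows "a = 0"
proof (rule ccontr)
  assume "a \<noteq> 0"
  then have pos: "a > 0" using a by simp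
  have "C \<ge> 0" using bound[of 1] a by simp
  define X where "X = (C + 1) / a"
  have X: "X > 0" using pos \<open>C \<ge> 0\<close> by (simp add: X_def)
  have "(X powr (1 / p)) powr p * a \<le> C" using X by (intro bound) simp
  then show False using X p pos by (simp add: powr_powr) (simp add: X_def)
qed

locale contravariant_valuation =
  fixes \<mu> :: "(real^'n) set \<Rightarrow> (real^'n) measure" and p :: real
  assumes p: "p > 0" "p \<noteq> 1" and dim: "CARD('n) \<ge> 3"
    and in_sphere_measures: "P \<in> polytopes_o \<Longrightarrow> \<mu> P \<in> sphere_measures"
    and val: "measure_valuation \<mu>" and sl: "SL_contravariant p \<mu>"
begin

abbreviation moment :: "(real^'n) set \<Rightarrow> real^'n \<Rightarrow> real" where "moment P \<equiv> pos_moment p (\<mu> P)"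

text \<open>The transported direction \<open>\<phi> *v l\<close> compensates for the contragredient action on \<open>u\<close>.\<close>

lemma moment_SL:
  assumes P: "P \<in> polytopes_o" and \<phi>: "det \<phi> = 1"
  shows "moment ((*v) \<phi> ` P) (\<phi> *v l) = moment P l"
proof -
  let ?f = "\<lambda>u. max 0 ((\<phi> *v l) \<bullet> u) powr p"
  have "?f (t *\<^sub>R x) = t powr p * ?f x" if "t > 0" for t x
  proof -
    have "max 0 ((\<phi> *v l) \<bullet> (t *\<^sub>R x)) = t * max 0 ((\<phi> *v l) \<bullet> x)"
      using that by (auto simp: max_def zero_le_mult_iff not_le mult_le_0_iff)
    then show ?thesis using that by (simp add: powr_mult)
  qed
  then have "(LINT u|\<mu> ((*v) \<phi> ` P). ?f u) = (LINT u|\<mu> P. ?f (transpose (matrix_inv \<phi>) *v u))"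
    using sl P \<phi> continuous_on_pos_part_powr[OF p(1)] unfolding SL_contravariant_def by blast
  also have "\<dots> = (LINT u|\<mu> P. max 0 (l \<bullet> u) powr p)"
    using inner_contragredient[of \<phi>] \<phi> by (simp add: inner_commute del: transpose_matrix_vector)
  finally show ?thesis by (simp add: pos_moment_def)
qed

lemma moment_valuation:
  assumes "P \<in> polytopes_o" "Q \<in> polytopes_o" "P \<union> Q \<in> polytopes_o" "P \<inter> Q \<in> polytopes_o"
  shows "moment (P \<union> Q) l + moment (P \<inter> Q) l = moment P l + moment Q l"
  using assms val unfolding measure_valuation_def
  by (intro pos_moment_additive in_sphere_measures p) blast+

definition null :: "(real^'n) set \<Rightarrow> bool" where
  "null P \<longleftrightarrow> measure (\<mu> P) (sphere 0 1) = 0"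

lemma null_iff_moments_zero:
  "P \<in> polytopes_o \<Longrightarrow> null P \<longleftrightarrow> (\<forall>i. moment P (axis i 1) = 0 \<and> moment P (- axis i 1) = 0)"
  unfolding null_def by (rule sphere_measure_zero_iff_moments[OF in_sphere_measures p(1)])

lemma moment_of_null: "P \<in> polytopes_o \<Longrightarrow> null P \<Longrightarrow> moment P l = 0"
  unfolding null_def by (rule pos_moment_of_null[OF in_sphere_measures])

text \<open>The shears that send \<open>e\<^sub>k\<close> to \<open>e\<^sub>k + r e\<^sub>i\<close> fix \<open>P\<close> pointwise, so the moment in direction \<open>e\<^sub>k + r e\<^sub>i\<close>
  is independent of \<open>r\<close>. Subtracting \<open>e\<^sub>k\<close>, the moment in direction \<open>r e\<^sub>i\<close> stays bounded as \<open>r\<close> grows,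
  although it is proportional to \<open>\<bar>r\<bar>\<^sup>p\<close>.\<close>

lemma moment_of_subset_hyperplane:
  assumes P: "P \<in> polytopes_o" "P \<subseteq> {x. x $ k = 0}" and i: "i \<noteq> k" and s: "s \<noteq> 0"
  shows "moment P (s *\<^sub>R axis i 1) = 0"
proof -
  let ?C = "2 powr p * (moment P (axis k 1) + moment P (- axis k 1))"
  have bound: "t powr p * moment P (s *\<^sub>R axis i 1) \<le> ?C" if t: "t > 0" for t
  proof -
    let ?\<phi> = "rank_one_update (axis k 1) ((t * s) *\<^sub>R axis i (1 :: real))"
    have det: "det ?\<phi> = 1" using i by (subst det_rank_one_update) (simp_all add: inner_axis', simp add: axis_def)
    have "(*v) ?\<phi> ` P = P"
    proof -
      have "?\<phi> *v x = x" if "x \<in> P" for x using that P(2) by (auto simp: inner_axis')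
      then have "(*v) ?\<phi> ` P = (\<lambda>x. x) ` P" by (rule image_cong[OF refl])
      then show ?thesis by (simp only: image_ident)
    qed
    moreover have "?\<phi> *v axis k 1 = axis k 1 + (t * s) *\<^sub>R axis i 1"
      by (simp add: inner_axis')
    ultimately have eq: "moment P (axis k 1 + (t * s) *\<^sub>R axis i 1) = moment P (axis k 1)"
      using moment_SL[OF P(1) det, of "axis k 1"] by simp
    have "t powr p * moment P (s *\<^sub>R axis i 1) = moment P (t *\<^sub>R s *\<^sub>R axis i 1)"
      by (simp only: pos_moment_scaleR[OF t])
    also have "\<dots> = moment P ((axis k 1 + (t * s) *\<^sub>R axis i 1) + - axis k 1)" by simp
    also have "\<dots> \<le> 2 powr p * (moment P (axis k 1 + (t * s) *\<^sub>R axis i 1) + moment P (- axis k 1))"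
      by (rule pos_moment_add_le[OF in_sphere_measures[OF P(1)] p(1)])
    finally show ?thesis by (simp add: eq)
  qed
  show ?thesis
    by (rule powr_mult_bounded_imp_zero[OF p(1) pos_moment_nonneg bound])
qed

lemma moment_edge_cut:
  fixes i j :: 'n
  assumes ij: "i \<noteq> j" "i \<in> S" "j \<in> S" and t: "0 < t" "t < 1" and inj: "inj ((*v) \<phi>)"
  shows "moment ((*v) \<phi> ` std_simplex S) l + moment ((*v) (\<phi> ** edge_split i j t) ` std_simplex (S - {i})) l =
    moment ((*v) (\<phi> ** edge_split i j t) ` std_simplex S) l + moment ((*v) (\<phi> ** edge_split j i (1 - t)) ` std_simplex S) l"
proof -
  note cut = std_simplex_edge_cut[OF ij t]
  have U: "(*v) \<phi> ` std_simplex S = (*v) (\<phi> ** edge_split i j t) ` std_simplex S \<union> (*v) (\<phi> ** edge_split j i (1 - t)) ` std_simplex S"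
    unfolding image_matrix_mult image_Un[symmetric] cut(1)[symmetric] ..
  have I: "(*v) (\<phi> ** edge_split i j t) ` std_simplex (S - {i}) =
      (*v) (\<phi> ** edge_split i j t) ` std_simplex S \<inter> (*v) (\<phi> ** edge_split j i (1 - t)) ` std_simplex S"
    unfolding image_matrix_mult image_Int[OF inj, symmetric] cut(2) ..
  show ?thesis
    unfolding I unfolding U
    by (intro moment_valuation) (simp_all add: U[symmetric] I[symmetric])
qed

lemma std_simplex_moment_zero:
  assumes "m \<notin> S" "i \<noteq> m"
  shows "moment (std_simplex S) (axis i 1) = 0" "moment (std_simplex S) (- axis i 1) = 0"
proof -
  have sub: "std_simplex S \<subseteq> {x. x $ m = 0}" using assms by (auto simp: std_simplex_def)
  show "moment (std_simplex S) (axis i 1) = 0" "moment (std_simplex S) (- axis i 1) = 0"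
    using moment_of_subset_hyperplane[OF std_simplex_in_polytopes_o sub assms(2), of 1] moment_of_subset_hyperplane[OF std_simplex_in_polytopes_o sub assms(2), of "-1"] by simp_all
qed

text \<open>The simplex lies in two coordinate hyperplanes. One of them leaves only the moments in the two
  directions normal to it, and the other one disposes of these.\<close>

lemma null_std_simplex_codim2:
  assumes "k \<notin> S" "k' \<notin> S" "k' \<noteq> k"
  shows "null (std_simplex S)"
proof -
  have "moment (std_simplex S) (axis i 1) = 0 \<and> moment (std_simplex S) (- axis i 1) = 0" for i
    using std_simplex_moment_zero[OF assms(1), of i] std_simplex_moment_zero[OF assms(2), of i] assms(3)
    by (cases "i = k") auto
  then show ?thesis by (simp add: null_iff_moments_zero)
qed

text \<open>Stretching a coordinate outside \<open>S\<close> does not move the simplex, so the determinant of the map can be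
  adjusted to one.\<close>

lemma null_image_std_simplex:
  assumes null: "null (std_simplex S)" and S: "S \<noteq> UNIV" and \<phi>: "det \<phi> \<noteq> 0"
  shows "null ((*v) \<phi> ` std_simplex S)"
proof -
  obtain k where k: "k \<notin> S" using S by blast
  let ?\<psi> = "\<phi> ** coordinate_stretch k (1 / det \<phi>)"
  have det: "det ?\<psi> = 1" using \<phi> by (simp only: det_mul det_coordinate_stretch) simp
  have img: "(*v) ?\<psi> ` std_simplex S = (*v) \<phi> ` std_simplex S"
    unfolding image_matrix_mult coordinate_stretch_std_simplex[OF k] ..
  have zero: "moment ((*v) \<phi> ` std_simplex S) l = 0" for l
  proof -
    have "?\<psi> *v (matrix_inv ?\<psi> *v l) = l"
      using matrix_inv_mult[of ?\<psi>] det by (simp only: matrix_vector_mul_assoc) simp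
    then have "moment ((*v) \<phi> ` std_simplex S) l = moment (std_simplex S) (matrix_inv ?\<psi> *v l)"
      using moment_SL[OF std_simplex_in_polytopes_o det, of S "matrix_inv ?\<psi> *v l"] img by simp
    then show ?thesis using moment_of_null[OF std_simplex_in_polytopes_o null] by simp
  qed
  then show ?thesis by (simp add: null_iff_moments_zero)
qed

text \<open>In codimension one the moments along the simplex vanish. For the normal direction \<open>e\<^sub>k\<close>, halve an
  edge: each half is the image of the simplex under a map of determinant one that doubles \<open>e\<^sub>k\<close>, and so
  has \<open>2\<^sup>-\<^sup>p\<close> times the moment of the whole. As \<open>2 * 2\<^sup>-\<^sup>p \<noteq> 1\<close>, the moment is zero.\<close>

lemma null_std_simplex:
  assumes "S \<noteq> UNIV"
  shows "null (std_simplex S)"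
proof -
  obtain k where k: "k \<notin> S" using assms by blast
  show ?thesis
  proof (cases "\<exists>k'. k' \<notin> S \<and> k' \<noteq> k")
    case True
    then show ?thesis using null_std_simplex_codim2 k by blast
  next
    case False
    then have S: "S = UNIV - {k}" using k by blast
    then have "card S \<ge> 2" using dim by (simp add: card_Diff_singleton)
    then obtain i j where ij: "i \<in> S" "j \<in> S" "i \<noteq> j"
      by (metis card_le_Suc0_iff_eq finite not_less_eq_eq numeral_2_eq_2)
    have ik: "i \<noteq> k" "j \<noteq> k" using ij k by auto
    have small: "moment ((*v) (edge_split i j (1/2)) ` std_simplex (S - {i})) l = 0" for l
    proof (rule moment_of_null[OF image_std_simplex_in_polytopes_o null_image_std_simplex])
      show "null (std_simplex (S - {i}))" using null_std_simplex_codim2[of k "S - {i}" i] k ij by auto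
      show "det (edge_split i j (1/2)) \<noteq> 0" using ij by (simp add: det_edge_split)
    qed auto
    have half: "moment ((*v) (edge_split a b (1/2)) ` std_simplex S) (s *\<^sub>R axis k 1) = 2 powr (-p) * moment (std_simplex S) (s *\<^sub>R axis k 1)"
      if ab: "a \<noteq> b" "a \<noteq> k" "b \<noteq> k" for a b s
    proof -
      \<comment> \<open>doubling the coordinate in which the simplex is flat restores determinant one\<close>
      let ?D = "coordinate_stretch k 2"
      let ?\<phi> = "edge_split a b (1/2) ** ?D"
      have det: "det ?\<phi> = 1" using ab by (simp add: det_mul det_edge_split)
      have img: "(*v) ?\<phi> ` std_simplex S = (*v) (edge_split a b (1/2)) ` std_simplex S"
        unfolding image_matrix_mult coordinate_stretch_std_simplex[OF k] ..
      have "?\<phi> *v (s *\<^sub>R axis k 1) = 2 *\<^sub>R s *\<^sub>R axis k 1"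
        using ab unfolding matrix_vector_mul_assoc[symmetric] coordinate_stretch_apply edge_split_apply vec_eq_iff
        by (auto simp: axis_def)
      then have "moment (std_simplex S) (s *\<^sub>R axis k 1) =
          moment ((*v) (edge_split a b (1/2)) ` std_simplex S) (2 *\<^sub>R s *\<^sub>R axis k 1)"
        using moment_SL[OF std_simplex_in_polytopes_o det, of S "s *\<^sub>R axis k 1"] img by simp
      also have "\<dots> = 2 powr p * moment ((*v) (edge_split a b (1/2)) ` std_simplex S) (s *\<^sub>R axis k 1)"
        by (rule pos_moment_scaleR) simp
      finally show ?thesis by (simp add: powr_minus field_simps)
    qed
    have zero: "moment (std_simplex S) (s *\<^sub>R axis k 1) = 0" for s
    proof -
      have "inj ((*v) (mat 1 :: real^'n^'n))" by (simp add: inj_def)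
      then have "moment (std_simplex S) (s *\<^sub>R axis k 1) = 2 * 2 powr (-p) * moment (std_simplex S) (s *\<^sub>R axis k 1)"
        using moment_edge_cut[of i j S "1/2" "mat 1" "s *\<^sub>R axis k 1"] ij small half[OF ij(3) ik] half[OF ij(3)[symmetric] ik(2,1)]
        by simp
      moreover have "2 * 2 powr (-p) \<noteq> (1::real)"
      proof
        assume "2 * 2 powr (-p) = (1::real)"
        then have "(2::real) powr (1 - p) = 2 powr 0" by (simp add: powr_diff powr_minus field_simps)
        then show False using p(2) by (simp only: powr_inj)
      qed
      ultimately show ?thesis by simp
    qed
    have "moment (std_simplex S) (axis m 1) = 0 \<and> moment (std_simplex S) (- axis m 1) = 0" for m
      using std_simplex_moment_zero[OF k, of m] zero[of 1] zero[of "-1"] by (cases "m = k") auto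
    then show ?thesis by (simp add: null_iff_moments_zero)
  qed
qed

end

section \<open>Full-dimensional simplices\<close>

context contravariant_valuation
begin

abbreviation stretch :: "real \<Rightarrow> real^'n^'n" where "stretch \<equiv> coordinate_stretch undefined"

text \<open>The moment of a simplex of determinant \<open>t\<close> in a transported direction; by the next lemma every map of
  determinant \<open>t\<close> could take the place of the stretch.\<close>

definition simplex_moment :: "real^'n \<Rightarrow> real \<Rightarrow> real" where
  "simplex_moment l t = moment ((*v) (stretch t) ` std_simplex UNIV) (stretch t *v l)"

lemma moment_image_std_simplex:
  assumes "det \<phi> = t" "t > 0"
  shows "moment ((*v) \<phi> ` std_simplex UNIV) (\<phi> *v l) = simplex_moment l t"
proof -
  let ?\<psi> = "\<phi> ** stretch (1 / t)"
  have det: "det ?\<psi> = 1" using assms by (simp add: det_mul)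
  have appl: "?\<psi> *v (stretch t *v x) = \<phi> *v x" for x
    using coordinate_stretch_inverse[of t undefined x] assms(2) by (simp only: matrix_vector_mul_assoc[symmetric])
  have "moment ((*v) ?\<psi> ` (*v) (stretch t) ` std_simplex UNIV) (?\<psi> *v (stretch t *v l)) = simplex_moment l t"
    unfolding simplex_moment_def by (rule moment_SL[OF image_std_simplex_in_polytopes_o det])
  then show ?thesis by (simp only: image_image appl)
qed

lemma simplex_moment_nonneg: "simplex_moment l t \<ge> 0" unfolding simplex_moment_def by (rule pos_moment_nonneg)

lemma simplex_moment_scaleR: "c > 0 \<Longrightarrow> simplex_moment (c *\<^sub>R l) t = c powr p * simplex_moment l t"
  unfolding simplex_moment_def matrix_vector_mult_scaleR by (rule pos_moment_scaleR)

lemma simplex_moment_add_le: "simplex_moment (k + l) t \<le> 2 powr p * (simplex_moment k t + simplex_moment l t)"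
  unfolding simplex_moment_def matrix_vector_right_distrib by (rule pos_moment_add_le[OF in_sphere_measures[OF image_std_simplex_in_polytopes_o] p(1)])

text \<open>The two pieces of an edge cut have determinants \<open>(1 - t) * s\<close> and \<open>t * s\<close>, and \<open>l1\<close> and \<open>l2\<close> are the
  coordinates of the direction \<open>l\<close> relative to them. Their intersection is degenerate and contributes
  nothing.\<close>

lemma simplex_moment_cut:
  assumes ij: "i \<noteq> j" and t: "0 < t" "t < 1" and s: "s > 0"
    and l: "edge_split i j t *v l1 = l" "edge_split j i (1 - t) *v l2 = l"
  shows "simplex_moment l s = simplex_moment l1 ((1 - t) * s) + simplex_moment l2 (t * s)"
proof -
  let ?A = "stretch s ** edge_split i j t" and ?B = "stretch s ** edge_split j i (1 - t)"
  have det: "det ?A = (1 - t) * s" "det ?B = t * s"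
    using ij by (simp_all add: det_mul det_edge_split)
  have "inj ((*v) (stretch s))"
    using s by (intro inj_on_inverseI[of _ "(*v) (stretch (1 / s))"] coordinate_stretch_inverse) simp
  note cut = moment_edge_cut[OF ij UNIV_I UNIV_I t this, of "stretch s *v l"]
  have null: "moment ((*v) ?A ` std_simplex (UNIV - {i})) (stretch s *v l) = 0"
    using det s t by (intro moment_of_null[OF image_std_simplex_in_polytopes_o null_image_std_simplex] null_std_simplex) auto
  have "?A *v l1 = stretch s *v l" "?B *v l2 = stretch s *v l"
    by (simp_all only: l matrix_vector_mul_assoc[symmetric])
  then have "moment ((*v) ?A ` std_simplex UNIV) (stretch s *v l) = simplex_moment l1 ((1 - t) * s)"
    "moment ((*v) ?B ` std_simplex UNIV) (stretch s *v l) = simplex_moment l2 (t * s)"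
    using moment_image_std_simplex[OF det(1), of l1] moment_image_std_simplex[OF det(2), of l2] s t by simp_all
  with cut null show ?thesis by (simp add: simplex_moment_def)
qed

text \<open>With at least three coordinates there is an edge between two vertices other than \<open>e\<^sub>k\<close>, and the maps
  that cut this edge fix \<open>e\<^sub>k\<close>.\<close>

lemma simplex_moment_axis:
  assumes "t > 0"
  shows "simplex_moment (c *\<^sub>R axis k 1) t = t * simplex_moment (c *\<^sub>R axis k 1) 1"
proof (rule additive_nonneg_imp_linear[OF simplex_moment_nonneg _ assms])
  fix s l :: real assume *: "s > 0" "0 < l" "l < 1"
  have "card (UNIV - {k}) \<ge> 2" using dim by (simp add: card_Diff_singleton)
  then obtain i j where "i \<in> UNIV - {k}" "j \<in> UNIV - {k}" "i \<noteq> j"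
    by (metis card_le_Suc0_iff_eq finite not_less_eq_eq numeral_2_eq_2)
  then have ij: "i \<noteq> k" "j \<noteq> k" "i \<noteq> j" by auto
  have "edge_split i j l *v (c *\<^sub>R axis k 1) = c *\<^sub>R axis k 1"
    "edge_split j i (1 - l) *v (c *\<^sub>R axis k 1) = c *\<^sub>R axis k 1"
    using ij by (simp_all add: edge_split_apply axis_def)
  then show "simplex_moment (c *\<^sub>R axis k 1) s = simplex_moment (c *\<^sub>R axis k 1) ((1 - l) * s) + simplex_moment (c *\<^sub>R axis k 1) (l * s)"
    by (rule simplex_moment_cut[OF ij(3) *(2,3,1)])
qed

text \<open>Cutting the edge itself shortens it by the factors \<open>1 - l\<close> and \<open>l\<close> in the two pieces. This makes
  \<open>t powr (- p)\<close> times the moment additive, so the moment is a multiple of \<open>t powr (p + 1)\<close>. But it is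
  bounded by moments in coordinate directions, which are only linear in \<open>t\<close>.\<close>

lemma simplex_moment_diff:
  assumes ij: "i \<noteq> j" and t: "t > 0"
  shows "simplex_moment (axis i 1 - axis j 1) t = 0"
proof -
  let ?d = "axis i 1 - axis j 1 :: real^'n"
  define f where "f s = s powr (- p) * simplex_moment ?d s" for s
  have f: "f s = s * f 1" if "s > 0" for s
  proof (rule additive_nonneg_imp_linear[OF _ _ that])
    fix x l :: real assume *: "x > 0" "0 < l" "l < 1"
    have d: "?d $ j = - 1" "?d $ i = 1" using ij by (simp_all add: axis_def)
    have "edge_split i j l *v (c *\<^sub>R ?d) = (c - l * c) *\<^sub>R ?d" for c
      unfolding edge_split_apply vector_scaleR_component d by (simp add: algebra_simps)
    from this[of "1 / (1 - l)"] have e1: "edge_split i j l *v ((1 / (1 - l)) *\<^sub>R ?d) = ?d"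
      using * by (simp add: diff_divide_distrib[symmetric])
    have "edge_split j i (1 - l) *v (c *\<^sub>R ?d) = (l * c) *\<^sub>R ?d" for c
      unfolding edge_split_apply vector_scaleR_component d by (simp add: algebra_simps)
    from this[of "1 / l"] have e2: "edge_split j i (1 - l) *v ((1 / l) *\<^sub>R ?d) = ?d"
      using * by simp
    from simplex_moment_cut[OF ij *(2,3,1) e1 e2]
    have "simplex_moment ?d x = (1 / (1 - l)) powr p * simplex_moment ?d ((1 - l) * x) + (1 / l) powr p * simplex_moment ?d (l * x)"
      using * by (simp only: simplex_moment_scaleR zero_less_divide_1_iff diff_gt_0_iff_gt)
    moreover have "x powr (- p) * (1 / c) powr p = (c * x) powr (- p)" if "c > 0" for c
      using that * by (simp add: powr_minus powr_divide powr_mult field_simps)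
    ultimately show "f x = f ((1 - l) * x) + f (l * x)"
      using * by (simp add: f_def distrib_left mult.assoc[symmetric])
  qed (simp add: f_def simplex_moment_nonneg)
  define C where "C = 2 powr p * (simplex_moment (axis i 1) 1 + simplex_moment (- axis j 1) 1)"
  have C: "s powr p * simplex_moment ?d 1 \<le> C" if s: "s > 0" for s
  proof -
    have "s * (s powr p * simplex_moment ?d 1) = simplex_moment ?d s"
      using f[OF s] s by (simp add: f_def powr_minus field_simps)
    also have "\<dots> \<le> 2 powr p * (simplex_moment (axis i 1) s + simplex_moment (- axis j 1) s)"
      using simplex_moment_add_le[of "axis i 1" "- axis j 1" s] by simp
    also have "\<dots> = s * C"
      using simplex_moment_axis[OF s, of 1 i] simplex_moment_axis[OF s, of "-1" j] by (simp add: C_def algebra_simps)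
    finally show ?thesis using s by simp
  qed
  have "simplex_moment ?d 1 = 0"
    by (rule powr_mult_bounded_imp_zero[OF p(1) simplex_moment_nonneg C])
  then show ?thesis using f[OF t] t by (simp add: f_def)
qed

text \<open>The masses of the standard simplex at the two unit normals of the facet opposite to the origin, up
  to a common factor. Any coordinate could
  be used, since the coordinates of the normal \<open>(1, \<dots>, 1)\<close> are equal.\<close>

definition front_mass :: real where "front_mass = simplex_moment (axis undefined 1) 1"
definition back_mass :: real where "back_mass = simplex_moment (- axis undefined 1) 1"

text \<open>The vanishing moments in the directions \<open>\<phi> (e\<^sub>i - e\<^sub>j)\<close> show that almost every \<open>u\<close> is orthogonal to
  these vectors, that is, to the facet opposite to the origin; this leaves the points \<open>v / \<bar>v\<bar>\<close> and
  \<open>- v / \<bar>v\<bar>\<close>. The moments in directions \<open>\<phi> e\<^sub>k\<close> and \<open>- \<phi> e\<^sub>k\<close> see one of the points each and give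
  their masses.\<close>

lemma measure_image_std_simplex:
  assumes \<phi>: "det \<phi> > 0" and A: "A \<in> sets sphere_borel"
  defines "v \<equiv> transpose (matrix_inv \<phi>) *v 1"
  shows "measure (\<mu> ((*v) \<phi> ` std_simplex UNIV)) A =
    norm v powr p * det \<phi> * (front_mass * indicator A (v /\<^sub>R norm v) + back_mass * indicator A (- (v /\<^sub>R norm v)))"
proof -
  define M where "M = \<mu> ((*v) \<phi> ` std_simplex UNIV)"
  have M: "M \<in> sphere_measures" unfolding M_def by (rule in_sphere_measures[OF image_std_simplex_in_polytopes_o])
  interpret finite_measure M using M by (simp add: sphere_measures_def)
  have sets: "sets M = sets sphere_borel" using M by (simp add: sphere_measures_def)
  have space: "space M = sphere 0 1" by (rule sphere_measures_space[OF M])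
  have \<phi>0: "det \<phi> \<noteq> 0" using \<phi> by simp
  have one: "(1 :: real^'n) \<bullet> axis i 1 = 1" for i by (simp add: inner_axis)
  have inner: "(\<phi> *v l) \<bullet> v = 1 \<bullet> l" for l
    unfolding v_def using inner_contragredient[OF \<phi>0, of 1 l] by (simp only: inner_commute)
  have "v \<noteq> 0" using inner[of "axis undefined 1"] one by auto
  then have nv: "norm v > 0" by simp
  define u0 where "u0 = v /\<^sub>R norm v"
  have nu0: "norm u0 = 1" using nv by (simp add: u0_def)
  note u0 = nu0 unit_vector_neq_minus[OF nu0]
  have inner0: "(\<phi> *v l) \<bullet> u0 = (1 \<bullet> l) / norm v" for l
    unfolding u0_def inner_scaleR_right inner by (simp add: divide_inverse)
  have eqAE: "AE u in M. \<forall>i\<in>UNIV. \<forall>j\<in>UNIV. (\<phi> *v (axis i 1 - axis j 1)) \<bullet> u \<le> 0"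
  proof (intro AE_finite_allI)
    fix i j :: 'n
    show "AE u in M. (\<phi> *v (axis i 1 - axis j 1)) \<bullet> u \<le> 0"
    proof (cases "i = j")
      case False
      then show ?thesis
        using moment_image_std_simplex[OF refl \<phi>, of "axis i 1 - axis j 1"] simplex_moment_diff[OF False \<phi>]
        by (intro pos_moment_zero_imp_AE[OF M p(1)]) (simp add: M_def)
    qed simp
  qed auto
  have ae: "AE u in M. u = u0 \<or> u = - u0"
    using eqAE AE_space
  proof eventually_elim
    case (elim u)
    have "(\<phi> *v axis i 1) \<bullet> u = (\<phi> *v axis j 1) \<bullet> u" for i j
      using elim(1)[rule_format, of i j] elim(1)[rule_format, of j i]
      by (simp add: matrix_vector_mult_diff_distrib inner_diff_left)
    then obtain c where c: "\<And>i. (\<phi> *v axis i 1) \<bullet> u = c" by metis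
    have "(\<phi> *v l) \<bullet> (u - c *\<^sub>R v) = 0" for l
    proof -
      have "l = (\<Sum>i\<in>UNIV. (l $ i) *\<^sub>R axis i 1)"
        using basis_expansion[of l] by (simp add: scalar_mult_eq_scaleR)
      then have "\<phi> *v l = (\<Sum>i\<in>UNIV. (l $ i) *\<^sub>R (\<phi> *v axis i 1))"
        by (metis (mono_tags, lifting) linear_sum[OF matrix_vector_mul_linear] matrix_vector_mult_scaleR sum.cong)
      then have "(\<phi> *v l) \<bullet> u = (\<Sum>i\<in>UNIV. l $ i * c)"
        by (simp add: inner_sum_left c)
      moreover have "1 \<bullet> l = (\<Sum>i\<in>UNIV. l $ i)" by (simp add: inner_vec_def)
      ultimately show ?thesis by (simp add: inner_diff_right inner sum_distrib_left mult.commute)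
    qed
    from this[of "matrix_inv \<phi> *v (u - c *\<^sub>R v)"] have "u = c *\<^sub>R v"
      using matrix_inv_mult[OF \<phi>0] by (simp add: matrix_vector_mul_assoc)
    moreover have "norm u = 1" using elim(2) by (simp add: space)
    ultimately have "\<bar>c\<bar> * norm v = 1" by simp
    then have "c = inverse (norm v) \<or> c = - inverse (norm v)"
      using nv by (auto simp: abs_if field_simps split: if_splits)
    then show ?case using \<open>u = c *\<^sub>R v\<close> by (auto simp: u0_def)
  qed
  have single: "{u0} \<in> sets M" "{- u0} \<in> sets M"
    using u0 by (auto simp: sets intro!: finite_in_sphere_borel)
  have npw: "(1 / norm v) powr p = norm v powr (- p)"
    using nv powr_divide[of 1 "norm v" p] by (simp add: powr_minus_divide)
  have mom: "simplex_moment (s *\<^sub>R axis undefined 1) (det \<phi>) = norm v powr (- p) * measure M {s *\<^sub>R u0}"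
    if s: "s = 1 \<or> s = - 1" for s
  proof -
    have sing: "{s *\<^sub>R u0} \<in> sets M" using single s by auto
    have "simplex_moment (s *\<^sub>R axis undefined 1) (det \<phi>) = pos_moment p M (\<phi> *v (s *\<^sub>R axis undefined 1))"
      unfolding M_def by (rule moment_image_std_simplex[OF refl \<phi>, symmetric])
    also have "\<dots> = (LINT u|M. norm v powr (- p) * indicator {s *\<^sub>R u0} u)"
      unfolding pos_moment_def
    proof (rule integral_cong_AE)
      show "AE u in M. max 0 ((\<phi> *v (s *\<^sub>R axis undefined 1)) \<bullet> u) powr p =
          norm v powr (- p) * indicator {s *\<^sub>R u0} u"
        using ae
      proof eventually_elim
        case (elim u)
        have val: "(\<phi> *v (s *\<^sub>R axis undefined 1)) \<bullet> u0 = s / norm v"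
          unfolding inner0 by (simp add: one)
        from elim s show ?case
        proof (elim disjE)
          assume "u = u0" "s = 1"
          then show ?thesis using val nv npw by simp
        next
          assume "u = u0" "s = - 1"
          then show ?thesis using val nv u0(2) by (simp add: max_def)
        next
          assume "u = - u0" "s = 1"
          then show ?thesis using val nv u0(2) by (simp add: max_def)
        next
          assume "u = - u0" "s = - 1"
          then show ?thesis using val nv npw by simp
        qed
      qed
    qed (use sing borel_measurable_sphere[OF M continuous_on_pos_part_powr[OF p(1)]] in auto)
    finally show ?thesis using sing by simp
  qed
  have mass: "measure M {u0} = norm v powr p * det \<phi> * front_mass"
    "measure M {- u0} = norm v powr p * det \<phi> * back_mass"
    using mom[of 1] mom[of "-1"] simplex_moment_axis[OF \<phi>, of 1 undefined] simplex_moment_axis[OF \<phi>, of "-1" undefined] nv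
    by (simp_all add: front_mass_def back_mass_def powr_minus field_simps)
  have AM: "A \<in> sets M" using A sets by simp
  have parts: "A \<inter> {u0} \<in> sets M" "A \<inter> {- u0} \<in> sets M"
    by (rule sets.Int[OF AM single(1)], rule sets.Int[OF AM single(2)])
  have "measure M A = measure M ((A \<inter> {u0}) \<union> (A \<inter> {- u0}))"
    using AM sets.Un[OF parts] ae by (intro measure_eq_AE) (auto elim!: eventually_mono)
  also have "\<dots> = measure M (A \<inter> {u0}) + measure M (A \<inter> {- u0})"
    using u0(2) by (intro finite_measure_Union parts) auto
  also have "\<dots> = measure M {u0} * indicator A u0 + measure M {- u0} * indicator A (- u0)"
    by (auto simp: indicator_def)
  finally show ?thesis unfolding M_def[symmetric] u0_def[symmetric] by (simp add: mass algebra_simps)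
qed

end

section \<open>Valuations with proportional masses\<close>

lemma independent_hull_eq_image_std_simplex:
  fixes W :: "(real^'n) set"
  assumes W: "finite W" "independent W"
  obtains \<phi> :: "real^'n^'n" and S where "det \<phi> \<noteq> 0"
    "convex hull (insert 0 W) = (*v) \<phi> ` std_simplex S"
proof -
  obtain B where B: "W \<subseteq> B" "independent B" "span B = UNIV"
    using maximal_independent_subset_extend[OF subset_UNIV W(2)] by (metis UNIV_I UNIV_eq_I subset_UNIV top.extremum_unique)
  have finB: "finite B" and cardB: "card B = CARD('n)"
    using B(2) independent_imp_finite basis_card_eq_dim[of B UNIV] B(3) by (auto simp: dim_UNIV)
  obtain g where g: "bij_betw g (UNIV :: 'n set) B"
    using finite_same_card_bij[OF finite finB] cardB by metis
  define \<phi> where "\<phi> = (\<chi> i j. g j $ i)"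
  have col: "\<phi> *v axis j 1 = g j" for j
    by (simp add: matrix_vector_mul_component vec_eq_iff \<phi>_def matrix_vector_mult_basis column_def)
  have "surj ((*v) \<phi>)"
  proof -
    have "B \<subseteq> range ((*v) \<phi>)" using g col by (metis bij_betw_imp_surj_on image_subset_iff rangeI)
    then have "span B \<subseteq> range ((*v) \<phi>)"
      by (intro span_minimal linear_subspace_image[OF matrix_vector_mul_linear]) auto
    then show ?thesis using B(3) by blast
  qed
  then have "inj ((*v) \<phi>)"
    using linear_surjective_imp_injective[OF matrix_vector_mul_linear] by blast
  then have det: "det \<phi> \<noteq> 0"
    using det_nz_iff_inj[OF matrix_vector_mul_linear, of \<phi>] by simp
  define S where "S = g -` W"
  have "(*v) \<phi> ` insert 0 ((\<lambda>i. axis i 1) ` S) = insert 0 W"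
  proof -
    have "g ` S = W" using g B(1) unfolding S_def bij_betw_def by (metis image_vimage_eq inf.absorb1)
    then show ?thesis by (simp add: image_image col)
  qed
  then have "convex hull (insert 0 W) = (*v) \<phi> ` std_simplex S"
    unfolding std_simplex_eq_hull by (metis convex_hull_linear_image matrix_vector_mul_linear)
  with det show ?thesis by (rule that)
qed

text \<open>Exchanging two vertices; this reduces maps of negative determinant to those of positive one.\<close>

lemma std_simplex_reflection:
  fixes i j :: "'n::finite"
  assumes "i \<noteq> j"
  obtains \<rho> :: "real^'n^'n" where "det \<rho> = - 1" "(*v) \<rho> ` std_simplex UNIV = std_simplex UNIV"
proof -
  define u :: "real^'n" where "u = (1 / sqrt 2) *\<^sub>R (axis i 1 - axis j 1)"
  have uu: "u \<bullet> u = 1"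
    using assms by (simp add: u_def inner_diff_left inner_diff_right inner_axis_axis)
  then have nu: "norm u = 1" by (simp add: norm_eq_1)
  define \<rho> where "\<rho> = rank_one_update u (- 2 *\<^sub>R u)"
  have \<rho>: "\<rho> *v x = x - (x $ i - x $ j) *\<^sub>R (axis i 1 - axis j 1)" for x
  proof -
    define e :: "real^'n" where "e = axis i 1 - axis j 1"
    have "e \<bullet> x = x $ i - x $ j" by (simp add: e_def inner_diff_left inner_axis')
    moreover have "\<rho> *v x = x - (2 * (1 / sqrt 2) * (1 / sqrt 2) * (e \<bullet> x)) *\<^sub>R e"
      unfolding \<rho>_def rank_one_update_apply u_def e_def[symmetric] by (simp add: ac_simps)
    ultimately show ?thesis by (simp add: e_def)
  qed
  have nth: "(\<rho> *v x) $ m = (if m = i then x $ j else if m = j then x $ i else x $ m)" for x m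
    using assms by (simp add: \<rho> axis_def)
  have "det \<rho> = - 1" using uu by (simp add: \<rho>_def det_rank_one_update[OF nu])
  moreover have "(*v) \<rho> ` std_simplex UNIV = std_simplex UNIV"
  proof -
    have sum: "(\<Sum>m\<in>UNIV. (\<rho> *v x) $ m) = (\<Sum>m\<in>UNIV. x $ m)" for x
      by (simp add: \<rho> sum_subtractf sum_distrib_left[symmetric] axis_def)
    have sub: "\<rho> *v x \<in> std_simplex UNIV" if "x \<in> std_simplex UNIV" for x
      using that unfolding std_simplex_def by (simp add: sum) (simp add: nth)
    have "\<rho> *v (\<rho> *v x) = x" for x using assms by (simp add: vec_eq_iff nth)
    then show ?thesis using sub by (metis image_subset_iff subsetI subset_antisym image_eqI)
  qed
  ultimately show ?thesis by (rule that)
qed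

text \<open>If the prism were null, it would lie in a hyperplane \<open>a \<bullet> x = b\<close>. All \<open>e\<^sub>i\<close> lie in its base, so \<open>a\<close>
  would be a multiple of \<open>u\<close>, and it would also be orthogonal to \<open>u\<close>. In the direction \<open>- u\<close> the
  simplex has support value \<open>0\<close>.\<close>

lemma facet_weight_std_simplex:
  fixes u :: "real^'n"
  defines "u \<equiv> 1 /\<^sub>R norm (1 :: real^'n)"
  shows "facet_weight p (std_simplex UNIV) u > 0" "facet_weight p (std_simplex UNIV) (- u) = 0"
proof -
  let ?T = "std_simplex UNIV :: (real^'n) set"
  have T: "?T \<in> polytopes_o" by (rule std_simplex_in_polytopes_o)
  have n0: "norm (1 :: real^'n) > 0" by simp
  have ip: "u \<bullet> x = (\<Sum>i\<in>UNIV. x $ i) / norm (1 :: real^'n)" for x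
    by (simp add: u_def inner_vec_def divide_inverse mult.commute sum_distrib_left)
  have ax: "axis i 1 \<in> ?T" for i by (simp add: std_simplex_def axis_def)
  have h: "support_function ?T u = 1 / norm (1 :: real^'n)"
  proof -
    have "support_function ?T u = u \<bullet> axis undefined 1"
    proof (rule support_function_eqI[OF T ax])
      fix y assume "y \<in> ?T"
      then show "u \<bullet> y \<le> u \<bullet> axis undefined 1"
        using n0 unfolding ip by (intro divide_right_mono) (auto simp: std_simplex_def axis_def)
    qed
    then show ?thesis unfolding ip by (simp add: axis_def)
  qed
  define F where "F = support_face ?T u"
  have axF: "axis i 1 \<in> F" for i
    using ax h by (simp add: F_def support_face_def ip) (simp add: axis_def)
  have convF: "convex F"
    using face_of_imp_convex[OF support_face_face_of[OF T]] unfolding F_def .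
  have conv: "convex (prism u F)"
  proof -
    have "linear (\<lambda>(x, t). x + t *\<^sub>R u)"
      by (rule linearI) (auto simp: algebra_simps)
    then show ?thesis unfolding prism_def by (intro convex_linear_image convex_Times convF) auto
  qed
  have "interior (prism u F) \<noteq> {}"
  proof
    assume "interior (prism u F) = {}"
    then obtain a b where ab: "a \<noteq> 0" "prism u F \<subseteq> {x. a \<bullet> x = b}"
      using empty_interior_subset_hyperplane[OF conv] by metis
    have inF: "axis i 1 \<in> prism u F" "axis i 1 + u \<in> prism u F" for i
      using axF[of i] unfolding prism_iff
      by (intro bexI[of _ "axis i 1"] exI[of _ 0], simp_all, intro bexI[of _ "axis i 1"] exI[of _ 1], simp_all)
    have ai: "a $ i = b" for i using inF(1)[of i] ab(2) by (auto simp: inner_axis)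
    have "a \<bullet> axis undefined 1 = b" "a \<bullet> (axis undefined 1 + u) = b"
      using inF[of undefined] ab(2) by blast+
    then have "a \<bullet> u = 0" by (simp add: inner_add_right)
    then have "(\<Sum>i\<in>UNIV. a $ i) = 0" using ip[of a] n0 by (simp add: inner_commute)
    then have "b = 0" by (simp add: ai)
    then show False using ab(1) ai by (simp add: vec_eq_iff)
  qed
  then have "\<not> negligible (prism u F)" using negligible_convex_interior[OF conv] by simp
  then have "measure lebesgue (prism u F) > 0"
    using lmeasurable_compact[OF compact_prism[OF compact_support_face[OF T]], of u u]
    by (metis F_def measure_nonneg negligible_iff_measure order_le_less)
  then show "facet_weight p ?T u > 0" using h n0 by (simp add: facet_weight_def F_def)
  have "support_function ?T (- u) = - u \<bullet> 0"
  proof (rule support_function_eqI[OF T])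
    show "0 \<in> ?T" by (simp add: std_simplex_def)
    fix y assume "y \<in> ?T"
    then show "- u \<bullet> y \<le> - u \<bullet> 0" using n0 by (auto simp: ip std_simplex_def intro!: divide_nonneg_pos sum_nonneg)
  qed
  then show "facet_weight p ?T (- u) = 0" by (simp add: facet_weight_def)
qed

text \<open>Values on simplices are linear in the two masses, so the difference of both sides vanishes on
  simplices, and the dissection extends this to all polytopes.\<close>

lemma contravariant_valuation_determined:
  fixes \<mu> \<nu>1 \<nu>2 :: "(real^'n) set \<Rightarrow> (real^'n) measure"
  assumes "contravariant_valuation \<mu> p" "contravariant_valuation \<nu>1 p" "contravariant_valuation \<nu>2 p"
    and front_eq: "contravariant_valuation.front_mass \<mu> p =
      c1 * contravariant_valuation.front_mass \<nu>1 p + c2 * contravariant_valuation.front_mass \<nu>2 p"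
    and back_eq: "contravariant_valuation.back_mass \<mu> p =
      c1 * contravariant_valuation.back_mass \<nu>1 p + c2 * contravariant_valuation.back_mass \<nu>2 p"
    and P: "P \<in> polytopes_o" and A: "A \<in> sets sphere_borel"
  shows "measure (\<mu> P) A = c1 * measure (\<nu>1 P) A + c2 * measure (\<nu>2 P) A"
proof -
  interpret m: contravariant_valuation \<mu> p by fact
  interpret n1: contravariant_valuation \<nu>1 p by fact
  interpret n2: contravariant_valuation \<nu>2 p by fact
  define Z where "Z P = measure (\<mu> P) A - c1 * measure (\<nu>1 P) A - c2 * measure (\<nu>2 P) A" for P
  have cut: "measure (\<kappa> P) A + measure (\<kappa> (P \<inter> {x. b \<bullet> x = 0})) A =
      measure (\<kappa> (P \<inter> {x. b \<bullet> x \<ge> 0})) A + measure (\<kappa> (P \<inter> {x. b \<bullet> x \<le> 0})) A"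
    if "measure_valuation \<kappa>" "P \<in> polytopes_o" for \<kappa> :: "(real^'n) set \<Rightarrow> (real^'n) measure" and P b
  proof -
    have "(P \<inter> {x. b \<bullet> x \<ge> 0}) \<union> (P \<inter> {x. b \<bullet> x \<le> 0}) = P"
      "(P \<inter> {x. b \<bullet> x \<ge> 0}) \<inter> (P \<inter> {x. b \<bullet> x \<le> 0}) = P \<inter> {x. b \<bullet> x = 0}" by auto
    then show ?thesis
      using that A polytopes_o_Int_halfspaces[OF that(2), of b] unfolding measure_valuation_def by metis
  qed
  have "cut_additive Z"
    unfolding cut_additive_def Z_def
  proof (intro ballI allI)
    fix P :: "(real^'n) set" and b assume "P \<in> polytopes_o"
    from cut[OF m.val this, of b] cut[OF n1.val this, of b] cut[OF n2.val this, of b]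
    show "measure (\<mu> P) A - c1 * measure (\<nu>1 P) A - c2 * measure (\<nu>2 P) A +
       (measure (\<mu> (P \<inter> {x. b \<bullet> x = 0})) A - c1 * measure (\<nu>1 (P \<inter> {x. b \<bullet> x = 0})) A
         - c2 * measure (\<nu>2 (P \<inter> {x. b \<bullet> x = 0})) A) =
       measure (\<mu> (P \<inter> {x. 0 \<le> b \<bullet> x})) A - c1 * measure (\<nu>1 (P \<inter> {x. 0 \<le> b \<bullet> x})) A
         - c2 * measure (\<nu>2 (P \<inter> {x. 0 \<le> b \<bullet> x})) A +
       (measure (\<mu> (P \<inter> {x. b \<bullet> x \<le> 0})) A - c1 * measure (\<nu>1 (P \<inter> {x. b \<bullet> x \<le> 0})) A
         - c2 * measure (\<nu>2 (P \<inter> {x. b \<bullet> x \<le> 0})) A)"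
      by algebra
  qed
  moreover have "Z (convex hull (insert 0 W)) = 0" if W: "finite W" "independent W" for W
  proof -
    obtain \<phi> S where \<phi>: "det \<phi> \<noteq> 0" "convex hull (insert 0 W) = (*v) \<phi> ` std_simplex S"
      using independent_hull_eq_image_std_simplex[OF W] .
    show ?thesis
    proof (cases "S = UNIV")
      case False
      have "measure (\<kappa> ((*v) \<phi> ` std_simplex S)) A = 0" if "contravariant_valuation \<kappa> p" for \<kappa>
      proof -
        interpret contravariant_valuation \<kappa> p by fact
        have fin: "finite_measure (\<kappa> ((*v) \<phi> ` std_simplex S))"
          and sets: "sets (\<kappa> ((*v) \<phi> ` std_simplex S)) = sets sphere_borel"
          using in_sphere_measures[OF image_std_simplex_in_polytopes_o, of \<phi> S] by (auto simp: sphere_measures_def)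
        have "measure (\<kappa> ((*v) \<phi> ` std_simplex S)) A \<le> measure (\<kappa> ((*v) \<phi> ` std_simplex S)) (sphere 0 1)"
          using A sets.top[of "sphere_borel :: (real^'n) measure"] sphere_borel_subset[OF A]
          by (intro finite_measure.finite_measure_mono[OF fin]) (simp_all add: sets)
        then show ?thesis
          using null_image_std_simplex[OF null_std_simplex[OF False] False \<phi>(1)]
          by (simp add: null_def measure_le_0_iff)
      qed
      then show ?thesis using assms(1-3) by (simp add: Z_def \<phi>(2))
    next
      case True
      have pos: "Z ((*v) \<psi> ` std_simplex UNIV) = 0" if "det \<psi> > 0" for \<psi>
        unfolding Z_def m.measure_image_std_simplex[OF that A] n1.measure_image_std_simplex[OF that A]
          n2.measure_image_std_simplex[OF that A] front_eq back_eq
        by (simp add: algebra_simps)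
      show ?thesis
      proof (cases "det \<phi> > 0")
        case True
        then show ?thesis using pos[of \<phi>] \<phi>(2) \<open>S = UNIV\<close> by simp
      next
        case False
        have "CARD('n) \<ge> 2" using m.dim by simp
        then obtain i j :: 'n where "i \<noteq> j"
          by (metis card_le_Suc0_iff_eq finite not_less_eq_eq numeral_2_eq_2)
        then obtain \<rho> :: "real^'n^'n" where \<rho>: "det \<rho> = - 1" "(*v) \<rho> ` std_simplex UNIV = std_simplex UNIV"
          by (rule std_simplex_reflection)
        have "det (\<phi> ** \<rho>) > 0" using \<rho> \<phi>(1) False by (simp add: det_mul)
        moreover have "(*v) (\<phi> ** \<rho>) ` std_simplex UNIV = (*v) \<phi> ` std_simplex UNIV"
          unfolding image_matrix_mult \<rho>(2) ..
        ultimately show ?thesis using pos[of "\<phi> ** \<rho>"] \<phi>(2) \<open>S = UNIV\<close> by simp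
      qed
    qed
  qed
  ultimately have "Z P = 0" using P by (rule cut_additive_determined_by_simplices)
  then show ?thesis by (simp add: Z_def)
qed

section \<open>The characterization\<close>

lemma contravariant_valuation_Lp_surface_area_measure:
  assumes "p > 0" "p \<noteq> 1" "CARD('n) \<ge> 3"
  shows "contravariant_valuation (Lp_surface_area_measure p :: (real^'n) set \<Rightarrow> _) p"
    "contravariant_valuation (\<lambda>P :: (real^'n) set. Lp_surface_area_measure p (uminus ` P)) p"
  using assms
  by (unfold_locales; simp add: Lp_surface_area_measure_in_sphere_measures polytopes_o_uminus
      measure_valuation_Lp_surface_area_measure SL_contravariant_Lp_surface_area_measure
      measure_valuation_reflected SL_contravariant_reflected)+

lemma masses_of_std_simplex:
  fixes \<mu> :: "(real^'n) set \<Rightarrow> (real^'n) measure"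
  assumes "contravariant_valuation \<mu> p"
  defines "u \<equiv> 1 /\<^sub>R norm (1 :: real^'n)" and "r \<equiv> norm (1 :: real^'n) powr p"
  shows "measure (\<mu> (std_simplex UNIV)) {u} = r * contravariant_valuation.front_mass \<mu> p"
    "measure (\<mu> (std_simplex UNIV)) {- u} = r * contravariant_valuation.back_mass \<mu> p"
proof -
  interpret contravariant_valuation \<mu> p by fact
  have nu: "norm u = 1" by (simp add: u_def)
  have "transpose (matrix_inv (mat 1 :: real^'n^'n)) *v 1 = 1"
    by (rule contragredient_eqI) (simp_all add: transpose_mat)
  then have *: "measure (\<mu> (std_simplex UNIV)) A = r * (front_mass * indicator A u + back_mass * indicator A (- u))"
    if "A \<in> sets sphere_borel" for A
    using measure_image_std_simplex[of "mat 1", OF _ that] by (simp add: u_def r_def del: transpose_matrix_vector)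
  show "measure (\<mu> (std_simplex UNIV)) {u} = r * front_mass"
    "measure (\<mu> (std_simplex UNIV)) {- u} = r * back_mass"
    using *[of "{u}"] *[of "{- u}"] unit_vector_neq_minus[OF nu] nu finite_in_sphere_borel[of "{u}"] finite_in_sphere_borel[of "{- u}"]
    by (auto simp: indicator_def)
qed

lemma measure_Lp_surface_area_measure_singleton:
  fixes P :: "(real^'n) set"
  assumes P: "P \<in> polytopes_o" and u: "norm u = 1"
  shows "measure (Lp_surface_area_measure p P) {u} = facet_weight p P u"
proof -
  have "measure (Lp_surface_area_measure p P) {u} =
      (\<Sum>v\<in>insert u (facet_normals_off_origin P) \<inter> {u}. facet_weight p P v)"
    using u facet_normals_subset_sphere[of P] finite_facet_normals_off_origin[OF P]
    by (intro measure_Lp_surface_area_measure P finite_in_sphere_borel) auto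
  then show ?thesis by simp
qed

text \<open>Equality of masses carries over to integrals because all measures involved have finite support.\<close>

lemma SL_contravariant_combination:
  fixes \<mu> :: "(real^'n) set \<Rightarrow> (real^'n) measure"
  assumes \<mu>: "\<And>P. P \<in> polytopes_o \<Longrightarrow> \<mu> P \<in> sphere_measures"
    and eq: "\<And>P A. P \<in> polytopes_o \<Longrightarrow> A \<in> sets sphere_borel \<Longrightarrow> measure (\<mu> P) A =
      c1 * measure (Lp_surface_area_measure p P) A + c2 * measure (Lp_surface_area_measure p (uminus ` P)) A"
  shows "SL_contravariant p \<mu>"
proof -
  let ?S = "Lp_surface_area_measure p :: (real^'n) set \<Rightarrow> _"
  have int: "(LINT u|\<mu> P. f u) = c1 * (LINT u|?S P. f u) + c2 * (LINT u|?S (uminus ` P). f u)"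
    if P: "P \<in> polytopes_o" and f: "continuous_on (- {0}) f" for P and f :: "real^'n \<Rightarrow> real"
  proof -
    define U where "U = facet_normals_off_origin P \<union> facet_normals_off_origin (uminus ` P)"
    have P': "uminus ` P \<in> polytopes_o" by (rule polytopes_o_uminus[OF P])
    have U: "finite U" "facet_normals_off_origin P \<subseteq> U" "facet_normals_off_origin (uminus ` P) \<subseteq> U" "U \<subseteq> sphere 0 1"
      unfolding U_def using finite_facet_normals_off_origin[OF P] finite_facet_normals_off_origin[OF P']
        facet_normals_subset_sphere by auto
    have "(LINT u|\<mu> P. f u) = (\<Sum>u\<in>U. (c1 * facet_weight p P u + c2 * facet_weight p (uminus ` P) u) * f u)"
    proof (rule integral_finitely_supported[OF \<mu>[OF P] U(1,4) _ f])
      fix A :: "(real^'n) set" assume "A \<in> sets sphere_borel"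
      then show "measure (\<mu> P) A = (\<Sum>u\<in>U \<inter> A. c1 * facet_weight p P u + c2 * facet_weight p (uminus ` P) u)"
        by (simp add: eq[OF P] measure_Lp_surface_area_measure[OF P _ U(1,2,4)]
            measure_Lp_surface_area_measure[OF P' _ U(1,3,4)] sum.distrib sum_distrib_left)
    qed
    also have "\<dots> = c1 * (LINT u|?S P. f u) + c2 * (LINT u|?S (uminus ` P). f u)"
      by (simp add: integral_Lp_surface_area_measure[OF P U(1,2,4) f]
          integral_Lp_surface_area_measure[OF P' U(1,3,4) f] sum.distrib sum_distrib_left distrib_right mult.assoc)
    finally show ?thesis .
  qed
  show ?thesis
    unfolding SL_contravariant_def
  proof (intro allI impI ballI)
    fix \<phi> :: "real^'n^'n" and P :: "(real^'n) set" and f :: "real^'n \<Rightarrow> real"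
    assume \<phi>: "det \<phi> = 1" and P: "P \<in> polytopes_o"
      and f: "continuous_on (- {0}) f \<and> (\<forall>t>0. \<forall>x. x \<noteq> 0 \<longrightarrow> f (t *\<^sub>R x) = t powr p * f x)"
    have \<phi>P: "(*v) \<phi> ` P \<in> polytopes_o" using P by (simp add: polytopes_o_image)
    have cT: "continuous_on (- {0}) (\<lambda>u. f (transpose (matrix_inv \<phi>) *v u))"
      using f \<phi> by (intro continuous_on_comp_contragredient) auto
    have "(LINT u|?S ((*v) \<phi> ` P). f u) = (LINT u|?S P. f (transpose (matrix_inv \<phi>) *v u))"
      "(LINT u|?S (uminus ` (*v) \<phi> ` P). f u) = (LINT u|?S (uminus ` P). f (transpose (matrix_inv \<phi>) *v u))"
      using SL_contravariant_Lp_surface_area_measure[of p, where 'n='n]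
        SL_contravariant_reflected[OF SL_contravariant_Lp_surface_area_measure[of p, where 'n='n]] \<phi> P f
      unfolding SL_contravariant_def by blast+
    then show "(LINT u|\<mu> ((*v) \<phi> ` P). f u) = (LINT u|\<mu> P. f (transpose (matrix_inv \<phi>) *v u))"
      using int[OF \<phi>P] int[OF P cT] f by simp
  qed
qed

theorem theorem17:
  fixes \<mu> :: "(real^'n) set \<Rightarrow> (real^'n) measure" and p :: real
  assumes "CARD('n) \<ge> 3"
    and "p > 0" and "p \<noteq> 1"
    and "\<mu> \<in> polytopes_o \<rightarrow> sphere_measures"
  shows "(measure_valuation \<mu> \<and> SL_contravariant p \<mu>) \<longleftrightarrow>
    (\<exists>c\<^sub>1 c\<^sub>2 :: real. c\<^sub>1 \<ge> 0 \<and> c\<^sub>2 \<ge> 0 \<and>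
      (\<forall>P \<in> polytopes_o. \<forall>A \<in> sets sphere_borel.
         measure (\<mu> P) A =
           c\<^sub>1 * measure (Lp_surface_area_measure p P) A
           + c\<^sub>2 * measure (Lp_surface_area_measure p (uminus ` P)) A))"
proof
  let ?S = "Lp_surface_area_measure p :: (real^'n) set \<Rightarrow> _"
  let ?S' = "\<lambda>P :: (real^'n) set. ?S (uminus ` P)"
  assume "measure_valuation \<mu> \<and> SL_contravariant p \<mu>"
  then have \<mu>: "contravariant_valuation \<mu> p" using assms by unfold_locales auto
  have S: "contravariant_valuation ?S p" and S': "contravariant_valuation ?S' p"
    using contravariant_valuation_Lp_surface_area_measure[OF assms(2,3,1)] .
  let ?T = "std_simplex UNIV :: (real^'n) set"
  define u :: "real^'n" where "u = 1 /\<^sub>R norm (1 :: real^'n)"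
  define r where "r = norm (1 :: real^'n) powr p"
  define k where "k = facet_weight p ?T u"
  have T: "?T \<in> polytopes_o" "uminus ` ?T \<in> polytopes_o"
    using std_simplex_in_polytopes_o polytopes_o_uminus by blast+
  have nu: "norm u = 1" "norm (- u) = 1" and r: "r > 0" by (simp_all add: u_def r_def)
  have k: "k > 0" and k': "facet_weight p ?T (- u) = 0"
    using facet_weight_std_simplex[of p, where 'n='n] by (simp_all add: k_def u_def)
  have front_S: "contravariant_valuation.front_mass ?S p = k / r"
    and back_S: "contravariant_valuation.back_mass ?S p = 0"
    using masses_of_std_simplex[OF S, folded u_def r_def] r k'
    unfolding measure_Lp_surface_area_measure_singleton[OF T(1) nu(1)]
      measure_Lp_surface_area_measure_singleton[OF T(1) nu(2)] k_def
    by (simp_all add: field_simps)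
  have front_S': "contravariant_valuation.front_mass ?S' p = 0"
    and back_S': "contravariant_valuation.back_mass ?S' p = k / r"
    using masses_of_std_simplex[OF S', folded u_def r_def] r k'
    unfolding measure_Lp_surface_area_measure_singleton[OF T(2) nu(1)]
      measure_Lp_surface_area_measure_singleton[OF T(2) nu(2)] facet_weight_reflected[OF T(1)] k_def
    by (simp_all add: field_simps)
  define c1 where "c1 = contravariant_valuation.front_mass \<mu> p * r / k"
  define c2 where "c2 = contravariant_valuation.back_mass \<mu> p * r / k"
  have "c1 \<ge> 0" "c2 \<ge> 0"
    unfolding c1_def c2_def contravariant_valuation.front_mass_def[OF \<mu>] contravariant_valuation.back_mass_def[OF \<mu>]
    using contravariant_valuation.simplex_moment_nonneg[OF \<mu>] k r by simp_all
  moreover have "measure (\<mu> P) A = c1 * measure (?S P) A + c2 * measure (?S' P) A"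
    if "P \<in> polytopes_o" "A \<in> sets sphere_borel" for P A
    using that k r
    by (intro contravariant_valuation_determined[OF \<mu> S S'])
      (simp_all add: front_S back_S front_S' back_S' c1_def c2_def)
  ultimately show "\<exists>c\<^sub>1 c\<^sub>2 :: real. c\<^sub>1 \<ge> 0 \<and> c\<^sub>2 \<ge> 0 \<and>
      (\<forall>P \<in> polytopes_o. \<forall>A \<in> sets sphere_borel.
         measure (\<mu> P) A = c\<^sub>1 * measure (?S P) A + c\<^sub>2 * measure (?S (uminus ` P)) A)"
    by blast
next
  assume "\<exists>c\<^sub>1 c\<^sub>2 :: real. c\<^sub>1 \<ge> 0 \<and> c\<^sub>2 \<ge> 0 \<and>
      (\<forall>P \<in> polytopes_o. \<forall>A \<in> sets sphere_borel.
         measure (\<mu> P) A = c\<^sub>1 * measure (Lp_surface_area_measure p P) A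
           + c\<^sub>2 * measure (Lp_surface_area_measure p (uminus ` P)) A)"
  then obtain c1 c2 where eq: "\<And>P A. P \<in> polytopes_o \<Longrightarrow> A \<in> sets sphere_borel \<Longrightarrow> measure (\<mu> P) A =
      c1 * measure (Lp_surface_area_measure p P) A + c2 * measure (Lp_surface_area_measure p (uminus ` P)) A"
    by blast
  have "measure_valuation \<mu>"
    unfolding measure_valuation_def
  proof (intro allI impI ballI, elim conjE)
    fix P Q A :: "(real^'n) set"
    assume *: "P \<in> polytopes_o" "Q \<in> polytopes_o" "P \<union> Q \<in> polytopes_o" "P \<inter> Q \<in> polytopes_o"
      and A: "A \<in> sets sphere_borel"
    let ?m = "\<lambda>P. measure (Lp_surface_area_measure p P) A" and ?m' = "\<lambda>P. measure (Lp_surface_area_measure p (uminus ` P)) A"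
    have "?m (P \<union> Q) + ?m (P \<inter> Q) = ?m P + ?m Q" "?m' (P \<union> Q) + ?m' (P \<inter> Q) = ?m' P + ?m' Q"
      using measure_valuation_Lp_surface_area_measure[of p, where 'n='n]
        measure_valuation_reflected[OF measure_valuation_Lp_surface_area_measure[of p, where 'n='n]] * A
      unfolding measure_valuation_def by blast+
    then show "measure (\<mu> (P \<union> Q)) A + measure (\<mu> (P \<inter> Q)) A = measure (\<mu> P) A + measure (\<mu> Q) A"
      unfolding eq[OF *(1) A] eq[OF *(2) A] eq[OF *(3) A] eq[OF *(4) A] by algebra
  qed
  moreover have "SL_contravariant p \<mu>"
    using assms(4) eq by (intro SL_contravariant_combination) auto
  ultimately show "measure_valuation \<mu> \<and> SL_contravariant p \<mu>" ..
qed

end
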